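(* Let $K,L\in\mathcal{K}_o^n$ and let $Q\in\mathcal{S}_{c+}^n$. If $\varphi,\psi:(0,\infty)\to(0,\infty)$ are increasing and convex, then $$\widetilde{V}_{\varphi,\psi}(K,L,Q)\ge\varphi\!\left(\frac{V_n(K)}{V_n(Q)}\,\psi\!\left(\left(\frac{V_n(L)}{V_n(K)}\right)^{1/n}\right)\right)V_n(Q).$$ If $\varphi$ and $\psi$ are strictly convex, equality holds if and only if $K$, $L$, and $Q$ are dilatates of each other.
   Context: $\mathcal{K}_o^n$ is the class of compact convex sets in $\mathbb{R}^n$ containing the origin $o$ in their interiors. $\mathcal{S}_{c+}^n$ is the class of star bodies: compact sets $L$ that are star-shaped about the origin and whose radial function $\rho_L(u)=\sup\{\lambda>0:\lambda u\in L\}$, $u\in S^{n-1}$, is positive and continuous on $S^{n-1}$ (so a star body is determined by its radial function). $V_n$ is $n$-dimensional volume. Two sets are dilatates of each other if one is $c$ times the other for some $c>0$. For $K\in\mathcal{K}_o^n$, $h_K(u)=\sup_{x\in K}\langle u,x\rangle$ is the support function, and for $\mathcal{H}^{n-1}$-almost all $u\in S^{n-1}$, $\alpha_K(u)$ denotes the unique outer unit normal vector of $K$ at the boundary point $\rho_K(u)u$. For continuous $\varphi,\psi:(0,\infty)\to(0,\infty)$, $K,L\in\mathcal{K}_o^n$, and $Q\in\mathcal{S}_{c+}^n$, the $(\varphi,\psi)$-mixed volume is $$\widetilde{V}_{\varphi,\psi}(K,L,Q)=\frac1n\int_{S^{n-1}}\varphi\!\left(\psi\!\left(\frac{h_L(\alpha_K(u))}{h_K(\alpha_K(u))}\right)\left(\frac{\rho_K(u)}{\rho_Q(u)}\right)^n\right)\rho_Q(u)^n\,du,$$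 where $du=d\mathcal{H}^{n-1}(u)$. *)

theory Defs
  imports "HOL-Analysis.Analysis"
begin

text \<open>
  The \<open>m\<close>-dimensional Hausdorff measure, with the usual normalising factor \<open>\<omega>\<^sub>m / 2^m\<close>
  (\<open>\<omega>\<^sub>m\<close> the volume of the Euclidean unit ball of dimension \<open>m\<close>), which makes it agree with
  Lebesgue measure on \<open>m\<close>-dimensional space.  The empty set needs a separate clause because
  \<open>0 ^ 0 = 1\<close>.  Covering sets must be bounded since \<open>diameter\<close> is unspecified otherwise.
\<close>

definition hausdorff_content :: "nat \<Rightarrow> 'a::metric_space set \<Rightarrow> ennreal" where
  "hausdorff_content m C =
     (if C = {} then 0 else ennreal (unit_ball_vol (real m) * (diameter C / 2) ^ m))"

definition hausdorff_pre_measure :: "nat \<Rightarrow> real \<Rightarrow> 'a::metric_space set \<Rightarrow> ennreal" where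
  "hausdorff_pre_measure m \<delta> A =
     (INF C \<in> {C :: nat \<Rightarrow> 'a set. A \<subseteq> (\<Union>i. C i) \<and> (\<forall>i. bounded (C i) \<and> diameter (C i) \<le> \<delta>)}.
        (\<Sum>i. hausdorff_content m (C i)))"

definition hausdorff_outer_measure :: "nat \<Rightarrow> 'a::metric_space set \<Rightarrow> ennreal" where
  "hausdorff_outer_measure m A = (SUP \<delta> \<in> {0<..}. hausdorff_pre_measure m \<delta> A)"

text \<open>
  \<open>lambda_system\<close> is the family of Caratheodory-measurable sets of the outer measure, so the
  resulting measure is complete.  Hence modifying an integrand on a null set affects neither its
  measurability nor its integral.
\<close>

definition hausdorff_measure :: "nat \<Rightarrow> 'a::metric_space measure" where
  "hausdorff_measure m =
     measure_of UNIV (lambda_system UNIV (Pow UNIV) (hausdorff_outer_measure m)) (hausdorff_outer_measure m)"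

definition convex_bodies_o :: "'a::euclidean_space set set" where
  "convex_bodies_o = {K. compact K \<and> convex K \<and> 0 \<in> interior K}"

text \<open>
  Inserting \<open>0\<close> fixes the convention that the supremum of the empty set of positive numbers
  is \<open>0\<close>; the real-valued \<open>Sup\<close> of the empty set is unspecified.
\<close>

definition radial_function :: "'a::euclidean_space set \<Rightarrow> 'a \<Rightarrow> real" where
  "radial_function L u = Sup (insert 0 {t. 0 < t \<and> t *\<^sub>R u \<in> L})"

definition star_bodies :: "'a::euclidean_space set set" where
  "star_bodies =
     {L. compact L \<and> 0 \<in> L \<and> (\<forall>x\<in>L. closed_segment 0 x \<subseteq> L) \<and>
         (\<forall>u\<in>sphere 0 1. 0 < radial_function L u) \<and>
         continuous_on (sphere 0 1) (radial_function L)}"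

definition support_function :: "'a::euclidean_space set \<Rightarrow> 'a \<Rightarrow> real" where
  "support_function K u = (SUP x\<in>K. u \<bullet> x)"

definition outer_unit_normal :: "'a::euclidean_space set \<Rightarrow> 'a \<Rightarrow> 'a \<Rightarrow> bool" where
  "outer_unit_normal K x v \<longleftrightarrow> x \<in> frontier K \<and> norm v = 1 \<and> (\<forall>y\<in>K. y \<bullet> v \<le> x \<bullet> v)"

text \<open>
  For a convex body with \<open>0\<close> in its interior the normal is unique for almost all directions
  \<open>u\<close>; on the exceptional null set the value is unspecified.
\<close>

definition radial_gauss_map :: "'a::euclidean_space set \<Rightarrow> 'a \<Rightarrow> 'a" where
  "radial_gauss_map K u = (THE v. outer_unit_normal K (radial_function K u *\<^sub>R u) v)"

definition dilatates :: "'a::real_vector set \<Rightarrow> 'a set \<Rightarrow> bool" where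
  "dilatates A B \<longleftrightarrow> (\<exists>c>0. A = (\<lambda>x. c *\<^sub>R x) ` B)"

definition strictly_convex_on :: "'a::real_vector set \<Rightarrow> ('a \<Rightarrow> real) \<Rightarrow> bool" where
  "strictly_convex_on S f \<longleftrightarrow> convex S \<and>
     (\<forall>x\<in>S. \<forall>y\<in>S. \<forall>t. x \<noteq> y \<and> 0 < t \<and> t < 1 \<longrightarrow>
        f ((1 - t) *\<^sub>R x + t *\<^sub>R y) < (1 - t) * f x + t * f y)"

text \<open>
  The functions \<open>\<phi>\<close> and \<open>\<psi>\<close> are meant to be given on \<open>(0, \<infinity>)\<close>; their values elsewhere are
  irrelevant, since for the bodies in question the arguments below are positive almost everywhere.
\<close>

definition mixed_volume ::
  "(real \<Rightarrow> real) \<Rightarrow> (real \<Rightarrow> real) \<Rightarrow> 'a::euclidean_space set \<Rightarrow> 'a set \<Rightarrow> 'a set \<Rightarrow> real" where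
  "mixed_volume \<phi> \<psi> K L Q =
     1 / real DIM('a) *
     (LINT u : sphere 0 1 | hausdorff_measure (DIM('a) - 1).
        \<phi> (\<psi> (support_function L (radial_gauss_map K u) / support_function K (radial_gauss_map K u))
             * (radial_function K u / radial_function Q u) ^ DIM('a))
        * radial_function Q u ^ DIM('a))"

end

theory Submission
  imports Defs
begin

text \<open>
Write \<open>n\<close> for the dimension and \<open>f(u) = h\<^sub>L(\<alpha>\<^sub>K(u)) / h\<^sub>K(\<alpha>\<^sub>K(u))\<close>.  The measure
\<open>(1/n) \<rho>\<^sub>Q(u)\<^sup>n du\<close> on the sphere is the image of Lebesgue measure on \<open>Q\<close> under \<open>x \<mapsto> x / |x|\<close>, so the
mixed volume is the integral of \<open>\<phi> (\<psi> (f) (\<rho>\<^sub>K / \<rho>\<^sub>Q)\<^sup>n)\<close> over \<open>Q\<close>.  Jensen's inequality for \<open>\<phi>\<close> on \<open>Q\<close>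
leaves the integral of \<open>\<psi> (f) (\<rho>\<^sub>K / \<rho>\<^sub>Q)\<^sup>n\<close> over \<open>Q\<close>, which equals the integral of \<open>\<psi> (f)\<close> over \<open>K\<close>.
Jensen's inequality for \<open>\<psi>\<close> on \<open>K\<close> leaves the integral of \<open>f\<close> over \<open>K\<close>, and Minkowski's first inequality
bounds that from below by \<open>V(K) (V(L) / V(K))\<^sup>1\<^sup>/\<^sup>n\<close>.  This is the inequality.

Minkowski's first inequality (\<open>minkowski_first_inequality\<close>) comes from the Brunn--Minkowski inequality for
\<open>K + \<epsilon>L\<close> together with a pointwise bound: if \<open>v\<close> is the normal of \<open>K\<close> in direction \<open>u\<close>, then \<open>K + \<epsilon>L\<close> lies in the
half-space with normal \<open>v\<close> at height \<open>h\<^sub>K(v) + \<epsilon> h\<^sub>L(v)\<close>, whence \<open>\<rho> \<le> (1 + \<epsilon>f) \<rho>\<^sub>K\<close> in direction \<open>u\<close> for the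
radial function \<open>\<rho>\<close> of \<open>K + \<epsilon>L\<close>.  Thus the volume of \<open>K + \<epsilon>L\<close> is at most the integral of \<open>(1 + \<epsilon>f)\<^sup>n\<close> over
\<open>K\<close>, and \<open>\<epsilon> \<rightarrow> 0\<close> gives the claim; no derivative of a volume is taken.  The Brunn--Minkowski
inequality is proved by induction on the dimension from a one-dimensional Prekopa--Leindler inequality.

In the case of equality with strictly convex functions, both uses of Jensen's inequality are equalities, so that
\<open>f\<close> is almost everywhere a constant \<open>c\<close> with \<open>V(L) = c\<^sup>n V(K)\<close>, and \<open>\<rho>\<^sub>K / \<rho>\<^sub>Q\<close> is almost everywhere
constant, hence constant by continuity.  The former says that \<open>L\<close> satisfies almost all the inequalities that cut out
\<open>cK\<close>; so \<open>L \<subseteq> cK\<close>, and equality of the volumes forces \<open>L = cK\<close>.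

Two facts make the integrals meaningful.  First, the \<open>(n-1)\<close>-dimensional Hausdorff measure on the
sphere is \<open>n\<close> times the volume of cones (\<open>hausdorff_outer_eq_sphere_measure\<close>).  One inequality follows from the
isodiametric inequality, since a small piece of the sphere is almost isometric to its central projection to
a hyperplane.  The other follows from Vitali's covering lemma, since caps attain almost equality there.
Secondly, almost every direction of \<open>K\<close> has only one normal, and \<open>\<alpha>\<^sub>K\<close> is continuous on
those directions.  The normals in direction \<open>u\<close> correspond to the subgradients at \<open>u\<close> of the gauge of \<open>K\<close>, and
a Lipschitz convex function has directional derivatives almost everywhere (\<open>symmetric_derivative_set_null\<close>).
\<close>

section \<open>The Brunn--Minkowski and isodiametric inequalities\<close>

interpretation lborel_prod: product_sigma_finite "\<lambda>_. lborel :: real measure"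
  by standard

text \<open>
The Lebesgue measure, of dimension \<open>card I\<close>, of the section of \<open>A\<close> by the coordinate subspace spanned by the basis
vectors in \<open>I\<close>.  Making the dimension a set of vectors allows induction on it, and gives access to
hyperplanes of the ambient space, for which there is no type.
\<close>

definition coord_vol :: "'a::euclidean_space set \<Rightarrow> 'a set \<Rightarrow> ennreal" where
  "coord_vol I A = (\<integral>\<^sup>+ x. indicator A (\<Sum>i\<in>I. x i *\<^sub>R i) \<partial>(\<Pi>\<^sub>M i\<in>I. lborel))"

lemma coord_vol_mono: "A \<subseteq> B \<Longrightarrow> coord_vol I A \<le> coord_vol I B"
  unfolding coord_vol_def by (intro nn_integral_mono) (auto simp: indicator_def)

lemma coord_vol_Basis:
  fixes A :: "'a::euclidean_space set"
  assumes [measurable]: "A \<in> sets borel"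
  shows "coord_vol Basis A = emeasure lborel A"
proof -
  have "emeasure lborel A = (\<integral>\<^sup>+ x. indicator A x \<partial>lborel)"
    by simp
  also have "\<dots> = coord_vol Basis A"
    unfolding coord_vol_def lborel_eq[where 'a = 'a] by (intro nn_integral_distr) measurable
  finally show ?thesis ..
qed

lemma coord_vol_empty: "coord_vol {} A = indicator A 0"
  unfolding coord_vol_def by (simp add: PiM_empty nn_integral_count_space_finite)

lemma measurable_coord_vol_slice [measurable]:
  fixes A :: "'a::euclidean_space set"
  assumes [measurable]: "A \<in> sets borel" and "finite I"
  shows "(\<lambda>r. coord_vol I {x. x + r *\<^sub>R b \<in> A}) \<in> borel_measurable borel"
proof -
  interpret finite_product_sigma_finite "\<lambda>_. lborel :: real measure" I
    by standard fact
  have "(\<lambda>r. \<integral>\<^sup>+ x. indicator A ((\<Sum>i\<in>I. x i *\<^sub>R i) + r *\<^sub>R b) \<partial>(\<Pi>\<^sub>M i\<in>I. lborel)) \<in> borel_measurable borel"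
    by measurable
  thus ?thesis
    unfolding coord_vol_def by (simp add: indicator_def)
qed

text \<open>
Fubini's theorem.  The slices are translates of \<open>A\<close> itself, so an induction over \<open>I\<close> never leaves the
ambient space.
\<close>

lemma coord_vol_insert:
  fixes A :: "'a::euclidean_space set"
  assumes [measurable]: "A \<in> sets borel" and I: "finite I" "b \<notin> I"
  shows "coord_vol (insert b I) A = (\<integral>\<^sup>+ r. coord_vol I {x. x + r *\<^sub>R b \<in> A} \<partial>lborel)"
proof -
  have "coord_vol (insert b I) A =
     (\<integral>\<^sup>+ r. (\<integral>\<^sup>+ x. indicator A (\<Sum>i\<in>insert b I. (x(b := r)) i *\<^sub>R i) \<partial>(\<Pi>\<^sub>M i\<in>I. lborel)) \<partial>lborel)"
    unfolding coord_vol_def using I by (subst lborel_prod.product_nn_integral_insert_rev) auto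
  also have "\<dots> = (\<integral>\<^sup>+ r. coord_vol I {x. x + r *\<^sub>R b \<in> A} \<partial>lborel)"
    unfolding coord_vol_def
  proof (intro nn_integral_cong)
    fix r :: real and x :: "'a \<Rightarrow> real"
    have "(\<Sum>i\<in>I. (x(b := r)) i *\<^sub>R i) = (\<Sum>i\<in>I. x i *\<^sub>R i)"
      using I by (intro sum.cong) auto
    thus "indicator A (\<Sum>i\<in>insert b I. (x(b := r)) i *\<^sub>R i) =
        (indicator {x. x + r *\<^sub>R b \<in> A} (\<Sum>i\<in>I. x i *\<^sub>R i) :: ennreal)"
      using I by (simp add: indicator_def add.commute)
  qed
  finally show ?thesis .
qed

lemma borel_translate_scale:
  fixes A :: "'a::euclidean_space set"
  assumes [measurable]: "A \<in> sets borel"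
  shows "{x. c *\<^sub>R x + d \<in> A} \<in> sets borel"
  by measurable

lemma coord_vol_scale:
  fixes A :: "'a::euclidean_space set"
  assumes "finite I" "A \<in> sets borel" "c \<noteq> 0"
  shows "coord_vol I A = ennreal (\<bar>c\<bar> ^ card I) * coord_vol I {x. c *\<^sub>R x \<in> A}"
  using assms(1,2)
proof (induction I arbitrary: A rule: finite_induct)
  case empty
  thus ?case by (simp add: coord_vol_empty indicator_def)
next
  case (insert b I)
  note [measurable] = insert.prems
  have 1: "{x. x + r *\<^sub>R b \<in> A} \<in> sets borel" for r
    using borel_translate_scale[of A 1 "r *\<^sub>R b"] insert.prems by simp
  have 2: "{x. c *\<^sub>R x \<in> A} \<in> sets borel"
    using borel_translate_scale[of A c 0] insert.prems by simp
  have "coord_vol (insert b I) A = (\<integral>\<^sup>+ r. coord_vol I {x. x + r *\<^sub>R b \<in> A} \<partial>lborel)"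
    using insert.hyps insert.prems by (intro coord_vol_insert) auto
  also have "\<dots> = (\<integral>\<^sup>+ r. ennreal (\<bar>c\<bar> ^ card I) * coord_vol I {x. c *\<^sub>R x + r *\<^sub>R b \<in> A} \<partial>lborel)"
    by (intro nn_integral_cong, subst insert.IH[OF 1]) simp
  also have "\<dots> = ennreal \<bar>c\<bar> * (\<integral>\<^sup>+ r. ennreal (\<bar>c\<bar> ^ card I) * coord_vol I {x. c *\<^sub>R x + (c * r) *\<^sub>R b \<in> A} \<partial>lborel)"
  proof (subst nn_integral_real_affine[where c = c and t = 0])
    have eq: "(\<lambda>r. ennreal (\<bar>c\<bar> ^ card I) * coord_vol I {x. c *\<^sub>R x + r *\<^sub>R b \<in> A}) = (\<lambda>r. coord_vol I {x. x + r *\<^sub>R b \<in> A})"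
      by (intro ext, subst insert.IH[OF 1]) simp
    show "(\<lambda>r. ennreal (\<bar>c\<bar> ^ card I) * coord_vol I {x. c *\<^sub>R x + r *\<^sub>R b \<in> A}) \<in> borel_measurable borel"
      unfolding eq using measurable_coord_vol_slice[of A I b] insert by blast
  qed (use \<open>c \<noteq> 0\<close> in auto)
  also have "\<dots> = ennreal \<bar>c\<bar> * (\<integral>\<^sup>+ r. ennreal (\<bar>c\<bar> ^ card I) * coord_vol I {x. x + r *\<^sub>R b \<in> {x. c *\<^sub>R x \<in> A}} \<partial>lborel)"
    by (simp add: scaleR_add_right)
  also have "\<dots> = ennreal \<bar>c\<bar> * (ennreal (\<bar>c\<bar> ^ card I) * (\<integral>\<^sup>+ r. coord_vol I {x. x + r *\<^sub>R b \<in> {x. c *\<^sub>R x \<in> A}} \<partial>lborel))"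
    using measurable_coord_vol_slice[OF 2 insert.hyps(1)] by (subst nn_integral_cmult) auto
  also have "\<dots> = ennreal (\<bar>c\<bar> ^ card (insert b I)) * coord_vol (insert b I) {x. c *\<^sub>R x \<in> A}"
    using insert.hyps by (subst coord_vol_insert[OF 2]) (auto simp: ennreal_mult mult.assoc)
  finally show ?case .
qed

lemma coord_vol_cball_pos:
  fixes I :: "'a::euclidean_space set"
  assumes "I \<subseteq> Basis" "r > 0"
  shows "coord_vol I (cball 0 r) = ennreal (unit_ball_vol (real (card I)) * r ^ card I)"
proof -
  have I: "finite I" using assms finite_subset finite_Basis by blast
  have n: "norm (\<Sum>i\<in>I. x i *\<^sub>R i) = sqrt (\<Sum>i\<in>I. (x i)\<^sup>2)" for x
  proof -
    have "(norm (\<Sum>i\<in>I. x i *\<^sub>R i))\<^sup>2 = (\<Sum>i\<in>I. (norm (x i *\<^sub>R i))\<^sup>2)"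
    proof (rule norm_sum_Pythagorean[OF I])
      show "pairwise (\<lambda>i j. orthogonal (x i *\<^sub>R i) (x j *\<^sub>R j)) I"
        using assms(1) by (auto simp: pairwise_def orthogonal_def inner_not_same_Basis subset_iff)
    qed
    also have "\<dots> = (\<Sum>i\<in>I. (x i)\<^sup>2)"
      using assms(1) by (intro sum.cong) auto
    finally show ?thesis by (metis norm_ge_zero real_sqrt_unique)
  qed
  have "coord_vol I (cball 0 r) = (\<integral>\<^sup>+ x. indicator ({f. sqrt (\<Sum>i\<in>I. (f i)\<^sup>2) \<le> r} \<inter> space (\<Pi>\<^sub>M i\<in>I. lborel)) x \<partial>(\<Pi>\<^sub>M i\<in>I. lborel))"
    unfolding coord_vol_def by (intro nn_integral_cong) (auto simp: indicator_def n)
  also have "\<dots> = emeasure (\<Pi>\<^sub>M i\<in>I. lborel) ({f. sqrt (\<Sum>i\<in>I. (f i)\<^sup>2) \<le> r} \<inter> space (\<Pi>\<^sub>M i\<in>I. lborel))"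
    using I by (intro nn_integral_indicator) measurable
  also have "\<dots> = ennreal (unit_ball_vol (real (card I)) * r ^ card I)"
    by (rule emeasure_cball_aux[OF I assms(2)])
  finally show ?thesis .
qed

lemma coord_vol_cball_le:
  fixes I :: "'a::euclidean_space set"
  assumes "I \<subseteq> Basis" "r \<ge> 0"
  shows "coord_vol I (cball 0 r) \<le> ennreal (unit_ball_vol (real (card I)) * r ^ card I)"
proof (rule tendsto_lowerbound)
  show "((\<lambda>s. ennreal (unit_ball_vol (real (card I)) * s ^ card I)) \<longlongrightarrow>
      ennreal (unit_ball_vol (real (card I)) * r ^ card I)) (at_right r)"
    by (intro tendsto_intros)
  show "\<forall>\<^sub>F s in at_right r. coord_vol I (cball 0 r) \<le> ennreal (unit_ball_vol (real (card I)) * s ^ card I)"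
    using eventually_at_right_less[of r]
  proof eventually_elim
    case (elim s)
    have "coord_vol I (cball 0 r) \<le> coord_vol I (cball 0 s)"
      using elim by (intro coord_vol_mono) auto
    thus ?case using elim assms coord_vol_cball_pos[of I s] by simp
  qed
qed auto

lemma coord_vol_finite:
  fixes I :: "'a::euclidean_space set"
  assumes "I \<subseteq> Basis" "bounded A"
  shows "coord_vol I A < \<infinity>"
proof -
  obtain r where r: "r > 0" "A \<subseteq> cball 0 r"
    using assms(2) unfolding bounded_pos by (auto simp: subset_iff)
  have "coord_vol I A \<le> coord_vol I (cball 0 r)"
    using r by (intro coord_vol_mono)
  also have "\<dots> < \<infinity>" using coord_vol_cball_pos[OF assms(1) r(1)] by simp
  finally show ?thesis .
qed

text \<open>
The translates of \<open>A\<close> by the least point of \<open>B\<close> and of \<open>B\<close> by the greatest point of \<open>A\<close> both lie in the sum set,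
and they meet in one point.
\<close>

lemma emeasure_real_add_compact:
  fixes A B C :: "real set"
  assumes "compact A" "compact B" "A \<noteq> {}" "B \<noteq> {}" "C \<in> sets borel"
    and C: "\<And>x y. x \<in> A \<Longrightarrow> y \<in> B \<Longrightarrow> x + y \<in> C"
  shows "emeasure lborel A + emeasure lborel B \<le> emeasure lborel C"
proof -
  obtain a where a: "a \<in> A" "\<And>x. x \<in> A \<Longrightarrow> x \<le> a"
    using compact_attains_sup[OF assms(1,3)] by blast
  obtain b where b: "b \<in> B" "\<And>x. x \<in> B \<Longrightarrow> b \<le> x"
    using compact_attains_inf[OF assms(2,4)] by blast
  let ?A = "(\<lambda>x. b + x) ` A" and ?B = "(\<lambda>x. a + x) ` B"
  have cA: "?A \<in> sets borel" and cB: "?B \<in> sets borel"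
    using assms by (auto intro!: borel_compact compact_translation)
  have "emeasure lborel (?A \<inter> ?B) \<le> emeasure lborel {a + b}"
  proof (rule emeasure_mono)
    show "?A \<inter> ?B \<subseteq> {a + b}"
    proof (safe)
      fix x y assume *: "x \<in> A" "y \<in> B" "b + x = a + y"
      show "b + x = a + b" using a(2)[OF *(1)] b(2)[OF *(2)] *(3) by auto
    qed
  qed auto
  hence z: "?A \<inter> ?B \<in> null_sets lborel" using cA cB by auto
  have tr: "emeasure lborel ((\<lambda>x. c + x) ` S) = emeasure lborel S" if "compact S" for c and S :: "real set"
  proof -
    have "emeasure lborel S = (\<integral>\<^sup>+x. indicator S x \<partial>lborel)"
      using borel_compact[OF that] by simp
    also have "\<dots> = ennreal \<bar>1\<bar> * (\<integral>\<^sup>+x. indicator S (-c + 1 * x) \<partial>lborel)"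
      using borel_compact[OF that] by (intro nn_integral_real_affine) auto
    also have "\<dots> = (\<integral>\<^sup>+x. indicator ((\<lambda>x. c + x) ` S) x \<partial>lborel)"
    proof -
      have "x \<in> (\<lambda>x. c + x) ` S \<longleftrightarrow> - c + 1 * x \<in> S" for x
        by (auto intro: image_eqI[of _ _ "- c + x"])
      thus ?thesis by (simp add: indicator_def)
    qed
    also have "\<dots> = emeasure lborel ((\<lambda>x. c + x) ` S)"
      using borel_compact[OF compact_translation[OF that]] by simp
    finally show ?thesis ..
  qed
  have "emeasure lborel A + emeasure lborel B = emeasure lborel ?A + emeasure lborel ?B"
    using tr assms by simp
  also have "\<dots> = emeasure lborel (?A \<union> ?B)"
    using z cA cB by (intro emeasure_Un'[symmetric]) auto
  also have "\<dots> \<le> emeasure lborel C"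
  proof (rule emeasure_mono)
    show "?A \<union> ?B \<subseteq> C"
      using C[OF _ b(1)] C[OF a(1)] by (auto simp: add.commute[of b])
  qed (use assms in simp)
  finally show ?thesis .
qed

lemma emeasure_real_compact_approx:
  fixes A :: "real set"
  assumes "A \<in> sets borel" "bounded A" "A \<noteq> {}" "e > 0"
  obtains K where "compact K" "K \<subseteq> A" "K \<noteq> {}" "emeasure lborel A \<le> emeasure lborel K + ennreal e"
proof -
  obtain T where T: "closed T" "T \<subseteq> A" "A - T \<in> lmeasurable" "emeasure lebesgue (A - T) < ennreal e"
    using sets_lebesgue_inner_closed[of A e] assms by auto
  obtain a where a: "a \<in> A" using assms by blast
  show ?thesis
  proof (rule that[of "insert a T"])
    have "bounded T" using T assms bounded_subset by blast
    thus "compact (insert a T)" using T by (simp add: compact_eq_bounded_closed compact_insert)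
    have "emeasure lborel A = emeasure lborel (insert a T) + emeasure lborel (A - insert a T)"
    proof (subst plus_emeasure)
      show "insert a T \<in> sets lborel" using T by simp
      show "A - insert a T \<in> sets lborel" using T assms by simp
      show "emeasure lborel A = emeasure lborel (insert a T \<union> (A - insert a T))"
        using T a by (metis Un_Diff_cancel insert_subset sup.absorb2)
    qed auto
    also have "emeasure lborel (A - insert a T) \<le> emeasure lborel (A - T)"
      using T assms by (intro emeasure_mono) auto
    also have "emeasure lborel (A - T) = emeasure lebesgue (A - T)"
      using T assms by simp
    also have "\<dots> \<le> ennreal e" using T by simp
    finally show "emeasure lborel A \<le> emeasure lborel (insert a T) + ennreal e"
      by (simp add: add_left_mono)
  qed (use T a in auto)
qed

lemma brunn_minkowski_real:
  fixes A B C :: "real set"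
  assumes "A \<in> sets borel" "B \<in> sets borel" "bounded A" "bounded B" "A \<noteq> {}" "B \<noteq> {}"
    and C: "C \<in> sets borel" "\<And>x y. x \<in> A \<Longrightarrow> y \<in> B \<Longrightarrow> (1 - t) * x + t * y \<in> C"
    and t: "0 < t" "t < 1"
  shows "ennreal (1 - t) * emeasure lborel A + ennreal t * emeasure lborel B \<le> emeasure lborel C"
proof (rule ennreal_le_epsilon)
  fix e :: real assume e: "e > 0"
  obtain K where K: "compact K" "K \<subseteq> A" "K \<noteq> {}" "emeasure lborel A \<le> emeasure lborel K + ennreal e"
    using emeasure_real_compact_approx[of A e] assms e by blast
  obtain M where M: "compact M" "M \<subseteq> B" "M \<noteq> {}" "emeasure lborel B \<le> emeasure lborel M + ennreal e"
    using emeasure_real_compact_approx[of B e] assms e by blast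
  have sc: "emeasure lborel ((\<lambda>x. c * x) ` S) = ennreal c * emeasure lborel S" if "c > 0" "compact S" for c and S :: "real set"
  proof -
    have "emeasure lborel ((\<lambda>x. c * x) ` S) = (\<integral>\<^sup>+x. indicator ((\<lambda>x. c * x) ` S) x \<partial>lborel)"
      using borel_compact[OF compact_scaling[OF that(2), of c]] by simp
    also have "\<dots> = \<bar>c\<bar> * (\<integral>\<^sup>+x. indicator ((\<lambda>x. c * x) ` S) (0 + c * x) \<partial>lborel)"
      using borel_compact[OF compact_scaling[OF that(2), of c]] that by (intro nn_integral_real_affine) auto
    also have "\<dots> = \<bar>c\<bar> * (\<integral>\<^sup>+x. indicator S x \<partial>lborel)"
      using that by (intro arg_cong2[where f = "(*)"] nn_integral_cong) (auto simp: indicator_def image_iff)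
    also have "\<dots> = ennreal c * emeasure lborel S"
      using borel_compact[OF that(2)] that by simp
    finally show ?thesis .
  qed
  have "ennreal (1 - t) * emeasure lborel A + ennreal t * emeasure lborel B \<le>
        ennreal (1 - t) * (emeasure lborel K + ennreal e) + ennreal t * (emeasure lborel M + ennreal e)"
    using K M by (intro add_mono mult_left_mono) auto
  also have "\<dots> = ennreal (1 - t) * emeasure lborel K + ennreal t * emeasure lborel M +
      (ennreal (1 - t) + ennreal t) * ennreal e"
    by (simp add: distrib_left distrib_right ac_simps)
  also have "ennreal (1 - t) + ennreal t = 1"
    using t by (subst ennreal_plus[symmetric]) auto
  also have "ennreal (1 - t) * emeasure lborel K + ennreal t * emeasure lborel M =
      emeasure lborel ((\<lambda>x. (1 - t) * x) ` K) + emeasure lborel ((\<lambda>x. t * x) ` M)"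
    using sc K M t by simp
  also have "\<dots> \<le> emeasure lborel C"
    using K M C by (intro emeasure_real_add_compact) (auto intro: compact_scaling[where 'a = real, simplified])
  finally show "ennreal (1 - t) * emeasure lborel A + ennreal t * emeasure lborel B \<le> emeasure lborel C + ennreal e"
    by (simp add: add_right_mono)
qed

lemma nn_integral_layer_cake:
  fixes f :: "real \<Rightarrow> real"
  assumes [measurable]: "f \<in> borel_measurable borel" and "\<And>x. 0 \<le> f x"
  shows "(\<integral>\<^sup>+x. ennreal (f x) \<partial>lborel) = (\<integral>\<^sup>+s. indicator {0<..} s * emeasure lborel {x. s < f x} \<partial>lborel)"
proof -
  have "(\<integral>\<^sup>+x. ennreal (f x) \<partial>lborel) = (\<integral>\<^sup>+x. \<integral>\<^sup>+s. indicator {s. 0 < s \<and> s < f x} s \<partial>lborel \<partial>lborel)"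
  proof (intro nn_integral_cong)
    fix x
    have "{s. 0 < s \<and> s < f x} = {0<..<f x}" by auto
    thus "ennreal (f x) = (\<integral>\<^sup>+s. indicator {s. 0 < s \<and> s < f x} s \<partial>lborel)"
      using assms(2)[of x] by simp
  qed
  also have "\<dots> = (\<integral>\<^sup>+x. \<integral>\<^sup>+s. indicator {p. 0 < snd p \<and> snd p < f (fst p)} (x, s) \<partial>lborel \<partial>lborel)"
    by (simp add: indicator_def)
  also have "\<dots> = (\<integral>\<^sup>+s. \<integral>\<^sup>+x. indicator {p. 0 < snd p \<and> snd p < f (fst p)} (x, s) \<partial>lborel \<partial>lborel)"
  proof (rule lborel_pair.Fubini'[symmetric])
    have "{p \<in> space (lborel \<Otimes>\<^sub>M lborel). 0 < snd p \<and> snd p < f (fst p)} \<in> sets (lborel \<Otimes>\<^sub>M lborel)"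
      by measurable
    hence "{p. 0 < snd p \<and> snd p < f (fst p)} \<in> sets (lborel \<Otimes>\<^sub>M lborel)"
      by (simp add: space_pair_measure)
    thus "(\<lambda>(x, s). indicator {p. 0 < snd p \<and> snd p < f (fst p)} (x, s) :: ennreal) \<in> borel_measurable (lborel \<Otimes>\<^sub>M lborel)"
      by (simp add: case_prod_beta')
  qed
  also have "\<dots> = (\<integral>\<^sup>+s. \<integral>\<^sup>+x. indicator {0<..} s * indicator {x. s < f x} x \<partial>lborel \<partial>lborel)"
    by (intro nn_integral_cong) (auto simp: indicator_def)
  also have "\<dots> = (\<integral>\<^sup>+s. indicator {0<..} s * emeasure lborel {x. s < f x} \<partial>lborel)"
  proof (intro nn_integral_cong)
    fix s :: real
    have "(\<integral>\<^sup>+x. indicator {0<..} s * indicator {x. s < f x} x \<partial>lborel) =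
       indicator {0<..} s * (\<integral>\<^sup>+x. indicator {x. s < f x} x \<partial>lborel)"
      by (rule nn_integral_cmult) simp
    thus "(\<integral>\<^sup>+x. indicator {0<..} s * indicator {x. s < f x} x \<partial>lborel) =
       indicator {0<..} s * emeasure lborel {x. s < f x}"
      by simp
  qed
  finally show ?thesis .
qed

lemma borel_measurable_emeasure_superlevel [measurable]:
  fixes f :: "real \<Rightarrow> real"
  assumes [measurable]: "f \<in> borel_measurable borel"
  shows "(\<lambda>s. emeasure lborel {x. s < f x}) \<in> borel_measurable borel"
proof -
  have "(\<lambda>s. emeasure lborel {x. s < f x}) = (\<lambda>s. \<integral>\<^sup>+x. (if s < f x then 1 else 0) \<partial>lborel)"
  proof
    fix s
    have "(\<integral>\<^sup>+x. (if s < f x then 1 else 0) \<partial>lborel) = (\<integral>\<^sup>+x. indicator {x. s < f x} x \<partial>lborel)"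
      by (intro nn_integral_cong) auto
    thus "emeasure lborel {x. s < f x} = (\<integral>\<^sup>+x. (if s < f x then 1 else 0) \<partial>lborel)"
      by simp
  qed
  also have "\<dots> \<in> borel_measurable borel" by measurable
  finally show ?thesis .
qed

text \<open>
The level sets of \<open>F\<close>, \<open>G\<close> and \<open>H\<close> satisfy the one-dimensional Brunn--Minkowski inequality, which is additive;
integrating over the levels gives the claim.  The normalisation of the suprema makes the level sets of \<open>F\<close>
and \<open>G\<close> nonempty for the same levels.
\<close>

lemma prekopa_leindler_real:
  fixes F G H :: "real \<Rightarrow> real"
  assumes [measurable]: "F \<in> borel_measurable borel" "G \<in> borel_measurable borel" "H \<in> borel_measurable borel"
    and F: "\<And>x. 0 \<le> F x" "\<And>x. F x \<le> 1" "\<And>s. s < 1 \<Longrightarrow> \<exists>x. s < F x" "bounded {x. F x \<noteq> 0}"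
    and G: "\<And>x. 0 \<le> G x" "\<And>x. G x \<le> 1" "\<And>s. s < 1 \<Longrightarrow> \<exists>x. s < G x" "bounded {x. G x \<noteq> 0}"
    and H: "\<And>x. 0 \<le> H x" "\<And>x y s. 0 < s \<Longrightarrow> s < F x \<Longrightarrow> s < G y \<Longrightarrow> s < H ((1 - t) * x + t * y)"
    and t: "0 < t" "t < 1"
  shows "ennreal (1 - t) * (\<integral>\<^sup>+x. ennreal (F x) \<partial>lborel) + ennreal t * (\<integral>\<^sup>+x. ennreal (G x) \<partial>lborel)
      \<le> (\<integral>\<^sup>+x. ennreal (H x) \<partial>lborel)"
proof -
  have "ennreal (1 - t) * (\<integral>\<^sup>+x. ennreal (F x) \<partial>lborel) + ennreal t * (\<integral>\<^sup>+x. ennreal (G x) \<partial>lborel) =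
     (\<integral>\<^sup>+s. ennreal (1 - t) * (indicator {0<..} s * emeasure lborel {x. s < F x}) +
         ennreal t * (indicator {0<..} s * emeasure lborel {x. s < G x}) \<partial>lborel)"
    using F(1) G(1) by (simp add: nn_integral_layer_cake nn_integral_add nn_integral_cmult)
  also have "\<dots> \<le> (\<integral>\<^sup>+s. indicator {0<..} s * emeasure lborel {x. s < H x} \<partial>lborel)"
  proof (intro nn_integral_mono)
    fix s :: real
    consider "s \<le> 0" | "s \<ge> 1" | "0 < s" "s < 1" by linarith
    thus "ennreal (1 - t) * (indicator {0<..} s * emeasure lborel {x. s < F x}) +
         ennreal t * (indicator {0<..} s * emeasure lborel {x. s < G x}) \<le>
         indicator {0<..} s * emeasure lborel {x. s < H x}"
    proof cases
      case 2
      have "{x. s < F x} = {}" "{x. s < G x} = {}"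
        using F(2) G(2) 2 by (auto simp: not_less intro: order_trans)
      thus ?thesis by simp
    next
      case 3
      have "ennreal (1 - t) * emeasure lborel {x. s < F x} + ennreal t * emeasure lborel {x. s < G x} \<le>
         emeasure lborel {x. s < H x}"
      proof (rule brunn_minkowski_real)
        show "bounded {x. s < F x}" by (rule bounded_subset[OF F(4)]) (use 3 in auto)
        show "bounded {x. s < G x}" by (rule bounded_subset[OF G(4)]) (use 3 in auto)
        show "{x. s < F x} \<noteq> {}" "{x. s < G x} \<noteq> {}"
          using F(3)[OF 3(2)] G(3)[OF 3(2)] by simp_all
        show "(1 - t) * x + t * y \<in> {x. s < H x}" if "x \<in> {x. s < F x}" "y \<in> {x. s < G x}" for x y
          using H(2)[OF 3(1)] that by simp
      qed (use t in measurable)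
      thus ?thesis using 3 by simp
    qed auto
  qed
  also have "\<dots> = (\<integral>\<^sup>+x. ennreal (H x) \<partial>lborel)"
    using H(1) by (subst nn_integral_layer_cake) auto
  finally show ?thesis .
qed

lemma coord_vol_mono_span:
  assumes "\<And>x. x \<in> span I \<Longrightarrow> x \<in> A \<Longrightarrow> x \<in> B"
  shows "coord_vol I A \<le> coord_vol I B"
  unfolding coord_vol_def
proof (intro nn_integral_mono)
  fix x :: "'a \<Rightarrow> real"
  have "(\<Sum>i\<in>I. x i *\<^sub>R i) \<in> span I"
    by (intro span_sum span_scale span_base)
  thus "indicator A (\<Sum>i\<in>I. x i *\<^sub>R i) \<le> (indicator B (\<Sum>i\<in>I. x i *\<^sub>R i) :: ennreal)"
    using assms by (auto simp: indicator_def)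
qed

lemma span_orthogonal_Basis:
  fixes x :: "'a::euclidean_space"
  assumes "insert b I \<subseteq> Basis" "b \<notin> I" "x \<in> span I"
  shows "x \<bullet> b = 0"
proof -
  have "orthogonal b x"
  proof (rule orthogonal_to_span[OF assms(3)])
    fix y assume "y \<in> I"
    thus "orthogonal b y" using assms by (metis inner_not_same_Basis insert_subset orthogonal_def subsetD)
  qed
  thus ?thesis by (simp add: orthogonal_def inner_commute)
qed

lemma norm_add_orthogonal_Basis:
  fixes x :: "'a::euclidean_space"
  assumes "insert b I \<subseteq> Basis" "b \<notin> I" "x \<in> span I"
  shows "norm x \<le> norm (x + r *\<^sub>R b)" "\<bar>r\<bar> \<le> norm (x + r *\<^sub>R b)"
proof -
  have "x \<bullet> b = 0" by (rule span_orthogonal_Basis[OF assms])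
  moreover have "b \<bullet> b = 1" using assms by simp
  ultimately have *: "(norm (x + r *\<^sub>R b))\<^sup>2 = (norm x)\<^sup>2 + r\<^sup>2"
    unfolding power2_norm_eq_inner by (simp add: inner_add_left inner_add_right inner_commute power2_eq_square)
  show "norm x \<le> norm (x + r *\<^sub>R b)"
    by (rule power2_le_imp_le[OF _ norm_ge_zero], unfold *) simp
  show "\<bar>r\<bar> \<le> norm (x + r *\<^sub>R b)"
    by (rule power2_le_imp_le[OF _ norm_ge_zero], unfold *) simp
qed

text \<open>
The section volumes of a compact set in a coordinate direction form a function to which
\<open>prekopa_leindler_real\<close> applies after division by its supremum.
\<close>

lemma coord_vol_slices:
  fixes A :: "'a::euclidean_space set"
  assumes "insert b I \<subseteq> Basis" "b \<notin> I" "compact A"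
    and v_def: "\<And>r. v r = enn2real (coord_vol I {x. x + r *\<^sub>R b \<in> A})"
  shows "v \<in> borel_measurable borel" "bdd_above (range v)" "bounded {r. v r \<noteq> 0}"
    "\<And>r. coord_vol I {x. x + r *\<^sub>R b \<in> A} = ennreal (v r)"
    "(\<integral>\<^sup>+ r. ennreal (v r) \<partial>lborel) = ennreal (enn2real (coord_vol (insert b I) A))"
proof -
  have I: "finite I" by (rule finite_subset[OF _ finite_Basis]) (use assms(1) in auto)
  note A = borel_compact[OF assms(3)]
  show "v \<in> borel_measurable borel"
  proof -
    have "(\<lambda>r. enn2real (coord_vol I {x. x + r *\<^sub>R b \<in> A})) \<in> borel_measurable borel"
      using measurable_coord_vol_slice[OF A I] by measurable
    thus ?thesis by (simp add: v_def[abs_def])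
  qed
  obtain R where R: "R > 0" "\<And>x. x \<in> A \<Longrightarrow> norm x \<le> R"
    using compact_imp_bounded[OF assms(3)] unfolding bounded_pos by auto
  have le: "coord_vol I {x. x + r *\<^sub>R b \<in> A} \<le> coord_vol I (cball 0 R)" for r
  proof (rule coord_vol_mono_span)
    fix x assume "x \<in> span I" "x \<in> {x. x + r *\<^sub>R b \<in> A}"
    thus "x \<in> cball 0 R"
      using norm_add_orthogonal_Basis(1)[OF assms(1,2), of x r] R(2)[of "x + r *\<^sub>R b"] by auto
  qed
  have fin: "coord_vol I (cball 0 R) < \<infinity>"
    using assms(1) by (intro coord_vol_finite) auto
  show v: "coord_vol I {x. x + r *\<^sub>R b \<in> A} = ennreal (v r)" for r
    unfolding v_def using le[of r] fin by (simp add: order.strict_trans1)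
  show "bdd_above (range v)"
    unfolding v_def by (rule bdd_aboveI2[where M = "enn2real (coord_vol I (cball 0 R))"], rule enn2real_mono[OF le]) (use fin in simp)
  show "bounded {r. v r \<noteq> 0}"
  proof (rule boundedI)
    fix r assume "r \<in> {r. v r \<noteq> 0}"
    hence "\<not> coord_vol I {x. x + r *\<^sub>R b \<in> A} \<le> coord_vol I {}"
      by (auto simp: v_def coord_vol_def)
    then obtain x where "x \<in> span I" "x + r *\<^sub>R b \<in> A"
      using coord_vol_mono_span[of I "{x. x + r *\<^sub>R b \<in> A}" "{}"] by blast
    thus "norm r \<le> R"
      using norm_add_orthogonal_Basis(2)[OF assms(1,2), of x r] R(2)[of "x + r *\<^sub>R b"] by auto
  qed
  have "(\<integral>\<^sup>+ r. ennreal (v r) \<partial>lborel) = coord_vol (insert b I) A"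
    by (simp add: coord_vol_insert[OF A I assms(2)] v)
  also have "\<dots> = ennreal (enn2real (coord_vol (insert b I) A))"
    using coord_vol_finite[OF assms(1) compact_imp_bounded[OF assms(3)]] by simp
  finally show "(\<integral>\<^sup>+ r. ennreal (v r) \<partial>lborel) = ennreal (enn2real (coord_vol (insert b I) A))" .
qed

lemma compact_slice:
  fixes A :: "'a::euclidean_space set"
  assumes "compact A"
  shows "compact {x. x + c \<in> A}"
proof -
  have "{x. x + c \<in> A} = (\<lambda>x. x - c) ` A"
    by (auto simp: image_iff intro!: bexI[of _ "_ + c"])
  thus ?thesis using compact_translation_subtract[OF assms] by metis
qed

lemma ennreal_lincomb:
  "0 \<le> p \<Longrightarrow> 0 \<le> q \<Longrightarrow> 0 \<le> x \<Longrightarrow> 0 \<le> y \<Longrightarrow>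
     ennreal p * ennreal x + ennreal q * ennreal y = ennreal (p * x + q * y)"
  by (simp add: ennreal_mult)

text \<open>
Induction on the dimension: the slice of the combination at height \<open>(1 - t) x + t y\<close> contains the combination of the
slices of \<open>A\<close> at height \<open>x\<close> and of \<open>B\<close> at height \<open>y\<close>, so the section volumes satisfy the hypothesis of the one-dimensional
Prekopa--Leindler inequality.  The multiplicative form is the one that survives this induction.
\<close>

lemma brunn_minkowski_coord_vol:
  fixes A B C :: "'a::euclidean_space set"
  assumes "I \<subseteq> Basis" and t: "0 < t" "t < 1"
    and "compact A" "compact B" "compact C"
    and "\<And>x y. x \<in> A \<Longrightarrow> y \<in> B \<Longrightarrow> (1 - t) *\<^sub>R x + t *\<^sub>R y \<in> C"
  shows "enn2real (coord_vol I A) powr (1 - t) * enn2real (coord_vol I B) powr t \<le> enn2real (coord_vol I C)"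
  using finite_subset[OF assms(1) finite_Basis] assms(1) assms(4-)
proof (induction I arbitrary: A B C rule: finite_induct)
  case empty
  show ?case
    using empty.prems(5)[of 0 0] by (auto simp: coord_vol_empty indicator_def)
next
  case (insert b I)
  define v where "v = (\<lambda>A r. enn2real (coord_vol I {x. x + r *\<^sub>R b \<in> A}))"
  note sA = coord_vol_slices[OF insert.prems(1) insert.hyps(2) insert.prems(2), of "v A", OF fun_cong[OF fun_cong[OF v_def]]]
  note sB = coord_vol_slices[OF insert.prems(1) insert.hyps(2) insert.prems(3), of "v B", OF fun_cong[OF fun_cong[OF v_def]]]
  note sC = coord_vol_slices[OF insert.prems(1) insert.hyps(2) insert.prems(4), of "v C", OF fun_cong[OF fun_cong[OF v_def]]]
  have v0: "0 \<le> v D r" for D r by (simp add: v_def)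
  \<comment> \<open>Division by the suprema brings both section functions to supremum one; if a supremum vanishes, so does one side.\<close>
  define a where "a = (SUP r. v A r)"
  define c where "c = (SUP r. v B r)"
  let ?V = "\<lambda>D. enn2real (coord_vol (insert b I) D)"
  have lea: "v A r \<le> a" for r unfolding a_def by (rule cSUP_upper[OF UNIV_I sA(2)])
  have lec: "v B r \<le> c" for r unfolding c_def by (rule cSUP_upper[OF UNIV_I sB(2)])
  have zero: "?V D = 0" if "\<And>r. v D r = 0" "compact D" for D
    using coord_vol_slices(5)[OF insert.prems(1) insert.hyps(2) that(2), of "v D", OF fun_cong[OF fun_cong[OF v_def]]] that(1)
    by simp
  show ?case
  proof (cases "a = 0 \<or> c = 0")
    case True
    hence "?V A = 0 \<or> ?V B = 0"
      using lea lec v0 zero insert.prems(2,3) by (metis order_antisym)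
    thus ?thesis by auto
  next
    case False
    have a: "a > 0" and c: "c > 0"
      using False lea[of 0] lec[of 0] v0[of A 0] v0[of B 0] by linarith+
    define d where "d = a powr (1 - t) * c powr t"
    have d: "d > 0" using a c by (simp add: d_def)
    have scale: "(\<integral>\<^sup>+r. ennreal (v D r / k) \<partial>lborel) = ennreal (?V D / k)" if "k > 0" "compact D" for D k
    proof -
      note sD = coord_vol_slices[OF insert.prems(1) insert.hyps(2) that(2), of "v D", OF fun_cong[OF fun_cong[OF v_def]]]
      have "(\<integral>\<^sup>+r. ennreal (v D r / k) \<partial>lborel) = (\<integral>\<^sup>+r. ennreal (1 / k) * ennreal (v D r) \<partial>lborel)"
        using that v0 by (intro nn_integral_cong) (simp add: ennreal_mult[symmetric])
      also have "\<dots> = ennreal (1 / k) * (\<integral>\<^sup>+r. ennreal (v D r) \<partial>lborel)"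
        using sD(1) by (intro nn_integral_cmult) measurable
      also have "\<dots> = ennreal (?V D / k)"
        using sD(5) that by (simp add: ennreal_mult[symmetric])
      finally show ?thesis .
    qed
    have ex: "\<exists>x. s < f x / k" if "s < 1" "k > 0" "k = (SUP r. f r)" "bdd_above (range f)" for s k and f :: "real \<Rightarrow> real"
    proof -
      have "s * k < k" using that by simp
      hence "s * k < (SUP r. f r)" using that by simp
      hence "\<exists>r. s * k < f r" using less_cSUP_iff[of UNIV f "s * k"] that(4) by auto
      thus ?thesis using that by (auto simp: field_simps)
    qed
    have "ennreal (1 - t) * (\<integral>\<^sup>+r. ennreal (v A r / a) \<partial>lborel) + ennreal t * (\<integral>\<^sup>+r. ennreal (v B r / c) \<partial>lborel)
        \<le> (\<integral>\<^sup>+r. ennreal (v C r / d) \<partial>lborel)"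
    proof (rule prekopa_leindler_real)
      show "(\<lambda>r. v A r / a) \<in> borel_measurable borel" "(\<lambda>r. v B r / c) \<in> borel_measurable borel"
        "(\<lambda>r. v C r / d) \<in> borel_measurable borel"
        using sA(1) sB(1) sC(1) by measurable
      show "0 \<le> v A x / a" "v A x / a \<le> 1" "0 \<le> v B x / c" "v B x / c \<le> 1" "0 \<le> v C x / d" for x
        using a c d v0 lea lec by simp_all
      show "\<exists>x. s < v A x / a" if "s < 1" for s
        by (rule ex[OF that a a_def sA(2)])
      show "\<exists>x. s < v B x / c" if "s < 1" for s
        by (rule ex[OF that c c_def sB(2)])
      show "bounded {x. v A x / a \<noteq> 0}" "bounded {x. v B x / c \<noteq> 0}"
        using sA(3) sB(3) a c by simp_all
      fix x y s :: real
      assume s: "0 < s" "s < v A x / a" "s < v B y / c"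
      have "s * d = (s * a) powr (1 - t) * (s * c) powr t"
        using s a c by (simp add: d_def powr_mult mult_ac powr_add[symmetric])
      also have "\<dots> < v A x powr (1 - t) * v B y powr t"
        using s a c t by (intro mult_strict_mono' powr_less_mono2) (auto simp: field_simps)
      also have "\<dots> \<le> v C ((1 - t) * x + t * y)"
        unfolding v_def
      proof (rule insert.IH)
        fix p q assume "p \<in> {p. p + x *\<^sub>R b \<in> A}" "q \<in> {q. q + y *\<^sub>R b \<in> B}"
        hence "(1 - t) *\<^sub>R (p + x *\<^sub>R b) + t *\<^sub>R (q + y *\<^sub>R b) \<in> C"
          using insert.prems(5) by simp
        thus "(1 - t) *\<^sub>R p + t *\<^sub>R q \<in> {z. z + ((1 - t) * x + t * y) *\<^sub>R b \<in> C}"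
          by (simp add: algebra_simps)
      qed (use insert.prems(1-4) in \<open>auto intro!: compact_slice\<close>)
      finally show "s < v C ((1 - t) * x + t * y) / d"
        using d by (simp add: field_simps)
    qed (use t in auto)
    hence "ennreal ((1 - t) * (?V A / a) + t * (?V B / c)) \<le> ennreal (?V C / d)"
      unfolding scale[OF a insert.prems(2)] scale[OF c insert.prems(3)] scale[OF d insert.prems(4)]
      using t a c by (subst (asm) ennreal_lincomb) auto
    hence le: "(1 - t) * (?V A / a) + t * (?V B / c) \<le> ?V C / d"
      using d by (subst (asm) ennreal_le_iff) auto
    show ?thesis
    proof (cases "?V A = 0 \<or> ?V B = 0")
      case False
      hence pos: "?V A > 0" "?V B > 0"
        by (simp_all add: less_le)
      have "(?V A / a) powr (1 - t) * (?V B / c) powr t \<le> (1 - t) * (?V A / a) + t * (?V B / c)"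
        using t a c pos by (intro Youngs_inequality_0) auto
      also note le
      also have "(?V A / a) powr (1 - t) * (?V B / c) powr t = ?V A powr (1 - t) * ?V B powr t / d"
        using a c pos by (simp add: powr_divide d_def)
      finally show ?thesis using d by (simp add: divide_le_cancel)
    qed auto
  qed
qed

lemma compact_lincomb:
  fixes A B :: "'a::euclidean_space set"
  assumes "compact A" "compact B"
  shows "compact {a *\<^sub>R x + c *\<^sub>R y | x y. x \<in> A \<and> y \<in> B}"
  using compact_sums[OF compact_scaling[OF assms(1), of a] compact_scaling[OF assms(2), of c]]
  by (rule back_subst[of compact]) (auto simp: image_iff; blast)

text \<open>
The symmetral \<open>(A - A) / 2\<close> has at least the volume of \<open>A\<close> by the Brunn--Minkowski inequality, and, being symmetric
with diameter at most \<open>d\<close>, it lies in the ball of radius \<open>d / 2\<close> about the origin.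
\<close>

lemma isodiametric_coord_vol:
  fixes A :: "'a::euclidean_space set"
  assumes I: "I \<subseteq> Basis" and A: "compact A" and d: "d \<ge> 0"
    and diam: "\<And>x y. x \<in> A \<Longrightarrow> y \<in> A \<Longrightarrow> dist x y \<le> d"
  shows "coord_vol I A \<le> ennreal (unit_ball_vol (real (card I)) * (d / 2) ^ card I)"
proof -
  let ?v = "\<lambda>A. enn2real (coord_vol I A)"
  define B where "B = {x. -1 *\<^sub>R x \<in> A}"
  have B': "B = uminus ` A" by (auto simp: B_def image_iff intro!: bexI[of _ "- _"])
  have B: "compact B" using A by (auto simp: B' intro: compact_negations)
  \<comment> \<open>Since \<open>B\<close> is the reflection of \<open>A\<close>, this is the symmetral of \<open>A\<close>.\<close>
  define C where "C = {(1 / 2) *\<^sub>R x + (1 / 2) *\<^sub>R y | x y. x \<in> A \<and> y \<in> B}"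
  have C: "compact C" unfolding C_def by (rule compact_lincomb[OF A B])
  have fin: "finite I" using I finite_Basis finite_subset by blast
  have fA: "coord_vol I A < \<infinity>" and fC: "coord_vol I C < \<infinity>"
    using coord_vol_finite[OF I compact_imp_bounded] A C by auto
  have "coord_vol I A = coord_vol I B"
    using coord_vol_scale[OF fin borel_compact[OF A], of "-1"] by (simp add: B_def)
  hence "?v A = ?v A powr (1 - 1 / 2) * ?v B powr (1 / 2)"
    by (simp add: powr_half_sqrt)
  also have "\<dots> \<le> ?v C"
    using I A B C by (intro brunn_minkowski_coord_vol) (auto simp: C_def)
  finally have "ennreal (?v A) \<le> ennreal (?v C)"
    by (rule ennreal_leI)
  hence "coord_vol I A \<le> coord_vol I C"
    using fA fC by (metis ennreal_enn2real infinity_ennreal_def)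
  also have "\<dots> \<le> coord_vol I (cball 0 (d / 2))"
  proof (rule coord_vol_mono)
    show "C \<subseteq> cball 0 (d / 2)"
    proof
      fix z assume "z \<in> C"
      then obtain x y where "z = (1 / 2) *\<^sub>R x + (1 / 2) *\<^sub>R (- y)" "x \<in> A" "y \<in> A"
        unfolding C_def B' by blast
      hence z: "z = (1 / 2) *\<^sub>R (x - y)" "x \<in> A" "y \<in> A"
        by (simp_all add: scaleR_diff_right)
      thus "z \<in> cball 0 (d / 2)" using diam[of x y] by (simp add: dist_norm)
    qed
  qed
  also have "\<dots> \<le> ennreal (unit_ball_vol (real (card I)) * (d / 2) ^ card I)"
    using I d by (intro coord_vol_cball_le) auto
  finally show ?thesis .
qed

lemma brunn_minkowski_mult:
  fixes A B C :: "'a::euclidean_space set"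
  assumes "0 < t" "t < 1" "compact A" "compact B" "compact C"
    and "\<And>x y. x \<in> A \<Longrightarrow> y \<in> B \<Longrightarrow> (1 - t) *\<^sub>R x + t *\<^sub>R y \<in> C"
  shows "measure lborel A powr (1 - t) * measure lborel B powr t \<le> measure lborel C"
  using brunn_minkowski_coord_vol[OF subset_refl assms] assms
  by (simp add: coord_vol_Basis borel_compact measure_def)

lemma measure_lborel_scale:
  fixes A :: "'a::euclidean_space set"
  assumes "A \<in> sets borel" "c > 0"
  shows "measure lborel ((\<lambda>x. c *\<^sub>R x) ` A) = c ^ DIM('a) * measure lborel A"
proof -
  have e: "(\<lambda>x. c *\<^sub>R x) ` A = {x. (1 / c) *\<^sub>R x \<in> A}"
    using assms(2) by (auto simp: image_iff intro!: bexI[of _ "(1 / c) *\<^sub>R _"])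
  have m: "(\<lambda>x. c *\<^sub>R x) ` A \<in> sets borel"
    unfolding e using borel_translate_scale[OF assms(1), of "1 / c" 0] by simp
  have "{x. c *\<^sub>R x \<in> (\<lambda>x. c *\<^sub>R x) ` A} = A" using assms(2) by (auto simp: image_iff)
  hence "emeasure lborel ((\<lambda>x. c *\<^sub>R x) ` A) = ennreal (c ^ DIM('a)) * emeasure lborel A"
    using coord_vol_scale[OF finite_Basis m, of c] assms m by (simp add: coord_vol_Basis)
  thus ?thesis using assms by (simp add: measure_def enn2real_mult)
qed

text \<open>
The additive form follows from the multiplicative one by rescaling both sets to unit volume.
\<close>

lemma brunn_minkowski:
  fixes A B C :: "'a::euclidean_space set"
  assumes A: "compact A" "measure lborel A > 0" and B: "compact B" "measure lborel B > 0" and C: "compact C"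
    and AB: "\<And>x y. x \<in> A \<Longrightarrow> y \<in> B \<Longrightarrow> x + y \<in> C"
  defines "n \<equiv> real DIM('a)"
  shows "(measure lborel A powr (1 / n) + measure lborel B powr (1 / n)) ^ DIM('a) \<le> measure lborel C"
proof -
  define a where "a = measure lborel A powr (1 / n)"
  define b where "b = measure lborel B powr (1 / n)"
  \<comment> \<open>With this \<open>t\<close> the combination of \<open>A / a\<close> and \<open>B / b\<close> is the sum of \<open>A\<close> and \<open>B\<close> divided by \<open>a + b\<close>.\<close>
  define t where "t = b / (a + b)"
  have n: "n > 0" by (simp add: n_def)
  have a: "a > 0" "a ^ DIM('a) = measure lborel A" and b: "b > 0" "b ^ DIM('a) = measure lborel B"
    using A B n by (simp_all add: a_def b_def powr_realpow[symmetric] powr_powr n_def[symmetric])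
  have t: "0 < t" "t < 1" "1 - t = a / (a + b)" using a b by (auto simp: t_def field_simps)
  let ?S = "\<lambda>c X. (\<lambda>x::'a. c *\<^sub>R x) ` X"
  have "measure lborel (?S (1 / a) A) powr (1 - t) * measure lborel (?S (1 / b) B) powr t \<le> measure lborel (?S (1 / (a + b)) C)"
  proof (rule brunn_minkowski_mult)
    fix x y assume "x \<in> ?S (1 / a) A" "y \<in> ?S (1 / b) B"
    then obtain p q where pq: "p \<in> A" "q \<in> B" "x = (1 / a) *\<^sub>R p" "y = (1 / b) *\<^sub>R q" by auto
    have "(1 - t) *\<^sub>R x + t *\<^sub>R y = (1 / (a + b)) *\<^sub>R (p + q)"
      unfolding pq t(3) unfolding t_def using a b by (simp add: scaleR_add_right)
    thus "(1 - t) *\<^sub>R x + t *\<^sub>R y \<in> ?S (1 / (a + b)) C"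
      using AB[OF pq(1,2)] by (metis imageI)
  qed (use A B C t in \<open>auto intro: compact_scaling\<close>)
  also have "measure lborel (?S (1 / a) A) = 1"
    using A a by (subst measure_lborel_scale) (auto simp: borel_compact power_divide)
  also have "measure lborel (?S (1 / b) B) = 1"
    using B b by (subst measure_lborel_scale) (auto simp: borel_compact power_divide)
  also have "measure lborel (?S (1 / (a + b)) C) = measure lborel C / (a + b) ^ DIM('a)"
    using C a b by (subst measure_lborel_scale) (auto simp: borel_compact power_divide)
  finally have "1 \<le> measure lborel C / (a + b) ^ DIM('a)" by simp
  hence "(a + b) ^ DIM('a) \<le> measure lborel C"
    using a b by (simp add: le_divide_eq_1_pos)
  thus ?thesis by (simp add: a_def b_def)
qed

section \<open>Invariance of Lebesgue measure under isometric involutions\<close>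

lemma lborel_translation:
  fixes A :: "'a::euclidean_space set"
  assumes "A \<in> sets borel"
  shows "emeasure lborel {y. x + y \<in> A} = emeasure lborel A"
proof -
  have "(lborel :: 'a measure) = distr lborel borel (\<lambda>y. x + y)"
    using lborel_affine[of 1 x] by (simp add: density_1)
  hence "emeasure lborel A = emeasure (distr lborel borel (\<lambda>y. x + y)) A" by simp
  also have "\<dots> = emeasure lborel {y. x + y \<in> A}"
    using assms by (subst emeasure_distr) (auto simp: vimage_def)
  finally show ?thesis ..
qed

text \<open>
The classical argument for the uniqueness of Haar measure: both sides are the double integral of the indicator of
\<open>x + y \<in> A\<close>, \<open>y \<in> B\<close>, evaluated in the two orders after a translation of \<open>y\<close>.
\<close>

lemma translation_invariant_lborel_swap:
  fixes M :: "'a::euclidean_space measure"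
  assumes M: "sigma_finite_measure M" "sets M = sets borel"
    and inv: "\<And>x A. A \<in> sets borel \<Longrightarrow> emeasure M {y. x + y \<in> A} = emeasure M A"
    and [measurable]: "A \<in> sets borel" "B \<in> sets borel"
  shows "emeasure M A * emeasure lborel B = emeasure M {x. - x \<in> B} * emeasure lborel A"
proof -
  interpret M: sigma_finite_measure M by fact
  interpret P: pair_sigma_finite M "lborel :: 'a measure" ..
  interpret Q: pair_sigma_finite "lborel :: 'a measure" M ..
  have [measurable_cong]: "sets M = sets borel" by fact
  have sp: "space M = UNIV" using sets_eq_imp_space_eq[OF M(2)] by simp
  have "emeasure M A * emeasure lborel B = (\<integral>\<^sup>+ y. emeasure M A * indicator B y \<partial>lborel)"
    by (simp add: nn_integral_cmult)
  also have "\<dots> = (\<integral>\<^sup>+ y. (\<integral>\<^sup>+ x. indicator A (y + x) * indicator B y \<partial>M) \<partial>lborel)"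
  proof (rule nn_integral_cong)
    fix y :: 'a
    have "emeasure M A = (\<integral>\<^sup>+ x. indicator {x. y + x \<in> A} x \<partial>M)"
      using inv[of A y] M(2) by (subst nn_integral_indicator) (auto)
    also have "\<dots> = (\<integral>\<^sup>+ x. indicator A (y + x) \<partial>M)" by (simp add: indicator_def)
    finally show "emeasure M A * indicator B y = (\<integral>\<^sup>+ x. indicator A (y + x) * indicator B y \<partial>M)"
      by (simp add: nn_integral_multc)
  qed
  also have "\<dots> = (\<integral>\<^sup>+ x. (\<integral>\<^sup>+ y. indicator A (y + x) * indicator B y \<partial>lborel) \<partial>M)"
    by (rule P.Fubini') measurable
  also have "\<dots> = (\<integral>\<^sup>+ x. (\<integral>\<^sup>+ y. indicator A y * indicator B (y - x) \<partial>lborel) \<partial>M)"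
  proof (rule nn_integral_cong)
    fix x :: 'a
    have eq: "(lborel :: 'a measure) = distr lborel borel (\<lambda>y. x + y)"
      using lborel_affine[of 1 x] by (simp add: density_1)
    have "(\<integral>\<^sup>+ y. indicator A y * indicator B (y - x) \<partial>lborel) =
       (\<integral>\<^sup>+ y. indicator A y * indicator B (y - x) \<partial>distr lborel borel (\<lambda>y. x + y) :: ennreal)"
      using eq by simp
    also have "\<dots> = (\<integral>\<^sup>+ y. indicator A (y + x) * indicator B y \<partial>lborel)"
      by (subst nn_integral_distr) (auto simp: add.commute)
    finally show "(\<integral>\<^sup>+ y. indicator A (y + x) * indicator B y \<partial>lborel) =
      (\<integral>\<^sup>+ y. indicator A y * indicator B (y - x) \<partial>lborel :: ennreal)" ..
  qed
  also have "\<dots> = (\<integral>\<^sup>+ y. (\<integral>\<^sup>+ x. indicator A y * indicator B (y - x) \<partial>M) \<partial>lborel)"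
    by (rule Q.Fubini') measurable
  also have "\<dots> = (\<integral>\<^sup>+ y. emeasure M {x. - x \<in> B} * indicator A y \<partial>lborel)"
  proof (rule nn_integral_cong)
    fix y :: 'a
    have B: "{x. - x \<in> B} \<in> sets borel" by measurable
    have "{x. y - x \<in> B} = {x. (- y) + x \<in> {x. - x \<in> B}}" by auto
    hence "emeasure M {x. y - x \<in> B} = emeasure M {x. - x \<in> B}"
      using inv[OF B, of "-y"] by simp
    moreover have "(\<integral>\<^sup>+ x. indicator B (y - x) \<partial>M) = emeasure M {x. y - x \<in> B}"
    proof -
      have mB: "{x. y - x \<in> B} \<in> sets M" unfolding M(2) by measurable
      have "(\<integral>\<^sup>+ x. indicator B (y - x) \<partial>M) = (\<integral>\<^sup>+ x. indicator {x. y - x \<in> B} x \<partial>M)"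
        by (rule nn_integral_cong) (simp add: indicator_def)
      thus ?thesis using mB by simp
    qed
    ultimately show "(\<integral>\<^sup>+ x. indicator A y * indicator B (y - x) \<partial>M) = emeasure M {x. - x \<in> B} * indicator A y"
      by (simp add: nn_integral_cmult mult.commute)
  qed
  also have "\<dots> = emeasure M {x. - x \<in> B} * emeasure lborel A"
    by (simp add: nn_integral_cmult)
  finally show ?thesis .
qed

text \<open>
The image of Lebesgue measure is again translation invariant, hence a multiple of Lebesgue measure; the unit
ball, which is mapped to itself, shows that the factor is one.
\<close>

lemma emeasure_lborel_isometric_involution:
  fixes T :: "'a::euclidean_space \<Rightarrow> 'a"
  assumes T: "linear T" "\<And>x. T (T x) = x" "\<And>x. norm (T x) = norm x"
    and A: "A \<in> sets borel"
  shows "emeasure lborel {x. T x \<in> A} = emeasure lborel A"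
proof -
  have [measurable]: "T \<in> borel_measurable borel"
    using T(1) by (intro borel_measurable_continuous_onI linear_continuous_on linear_conv_bounded_linear[THEN iffD1])
  define M where "M = distr (lborel :: 'a measure) borel T"
  have eM: "emeasure M X = emeasure lborel {x. T x \<in> X}" if "X \<in> sets borel" for X
    unfolding M_def using that by (subst emeasure_distr) (auto simp: vimage_def)
  have meas: "{x. T x \<in> X} \<in> sets borel" if [measurable]: "X \<in> sets borel" for X
    by measurable
  have fin: "emeasure M (cball 0 r) = emeasure lborel (cball (0::'a) r)" for r
    using T(3) by (simp add: eM cball_def)
  have "sigma_finite_measure M"
  proof
    show "\<exists>C. countable C \<and> C \<subseteq> sets M \<and> \<Union>C = space M \<and> (\<forall>a\<in>C. emeasure M a \<noteq> \<infinity>)"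
    proof (intro exI conjI)
      show "countable (range (\<lambda>n::nat. cball (0::'a) (real n)))" by simp
      show "range (\<lambda>n::nat. cball (0::'a) (real n)) \<subseteq> sets M" by (auto simp: M_def)
      show "\<Union>(range (\<lambda>n::nat. cball (0::'a) (real n))) = space M"
        using real_arch_simple by (auto simp: M_def)
      show "\<forall>a\<in>range (\<lambda>n::nat. cball (0::'a) (real n)). emeasure M a \<noteq> \<infinity>"
        by (auto simp: fin emeasure_cball)
    qed
  qed
  moreover have "sets M = sets borel" by (simp add: M_def)
  moreover have "emeasure M {y. x + y \<in> X} = emeasure M X" if X: "X \<in> sets borel" for x X
  proof -
    have m: "{y. x + y \<in> X} \<in> sets borel" using X by measurable
    have "{z. x + T z \<in> X} = {z. T x + z \<in> {z. T z \<in> X}}"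
      using T by (auto simp: linear_add)
    thus ?thesis using lborel_translation[OF meas[OF X], of "T x"] by (simp add: eM X m)
  qed
  ultimately have "emeasure M A * emeasure lborel (cball (0::'a) 1) =
      emeasure M {x. - x \<in> cball (0::'a) 1} * emeasure lborel A"
    using A by (intro translation_invariant_lborel_swap) auto
  also have "{x. - x \<in> cball (0::'a) 1} = cball 0 1" by auto
  also have "emeasure M (cball 0 1) = emeasure lborel (cball (0::'a) 1)" by (rule fin)
  finally have "emeasure lborel (cball (0::'a) 1) * emeasure M A = emeasure lborel (cball (0::'a) 1) * emeasure lborel A"
    by (simp add: mult.commute)
  moreover have "emeasure lborel (cball (0::'a) 1) \<noteq> 0" "emeasure lborel (cball (0::'a) 1) \<noteq> top"
    using unit_ball_vol_pos[of "real DIM('a)"] by (auto simp: emeasure_cball simp del: unit_ball_vol_pos)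
  ultimately show ?thesis
    using A by (simp add: ennreal_mult_cancel_left eM)
qed

text \<open>
The Householder reflection in the hyperplane orthogonal to \<open>u - b\<close>; if \<open>u = b\<close>, division by zero turns the formula
into the identity.
\<close>

lemma exists_isometric_involution_swap:
  fixes u b :: "'a::euclidean_space"
  assumes "norm u = norm b"
  obtains T where "linear T" "\<And>x. T (T x) = x" "\<And>x y. T x \<bullet> T y = x \<bullet> y" "T u = b"
proof -
  define w where "w = u - b"
  define T where "T x = x - (2 * (x \<bullet> w) / (w \<bullet> w)) *\<^sub>R w" for x
  have ww: "w \<bullet> w = 2 * (u \<bullet> w)"
    using assms by (simp add: w_def inner_diff_left inner_diff_right norm_eq inner_commute)
  have w0: "w = 0" if "w \<bullet> w = 0" using that by simp
  have Tw: "T x \<bullet> w = - (x \<bullet> w)" for x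
    using w0 by (cases "w = 0") (auto simp: T_def inner_diff_left)
  show ?thesis
  proof (rule that)
    show "linear T"
      by (intro linearI) (auto simp: T_def inner_add_left algebra_simps add_divide_distrib)
    show "T (T x) = x" for x
      unfolding T_def[of "T x"] Tw by (simp add: T_def)
    show "T x \<bullet> T y = x \<bullet> y" for x y
    proof -
      have "T x \<bullet> T y = T x \<bullet> y - (2 * (y \<bullet> w) / (w \<bullet> w)) * (T x \<bullet> w)"
        by (simp add: T_def[of y] inner_diff_right)
      also have "\<dots> = x \<bullet> y"
        unfolding Tw by (simp add: T_def inner_diff_left inner_diff_right inner_commute mult.commute)
      finally show ?thesis .
    qed
    show "T u = b"
      using ww by (cases "w = 0") (auto simp: T_def w_def)
  qed
qed

section \<open>The Hausdorff measure as a Caratheodory measure\<close>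

lemma hausdorff_content_mono:
  assumes "A \<subseteq> B" "bounded B"
  shows "hausdorff_content m A \<le> hausdorff_content m B"
proof -
  have "diameter A \<le> diameter B" by (rule diameter_subset[OF assms])
  moreover have "0 \<le> diameter A" using assms bounded_subset by (intro diameter_ge_0) blast
  ultimately show ?thesis
    using assms by (auto simp: hausdorff_content_def intro!: ennreal_leI mult_left_mono power_mono)
qed

lemma hausdorff_pre_measure_le_cover:
  assumes "A \<subseteq> (\<Union>i. C i)" "\<And>i::nat. bounded (C i)" "\<And>i. diameter (C i) \<le> d"
  shows "hausdorff_pre_measure m d A \<le> (\<Sum>i. hausdorff_content m (C i))"
  unfolding hausdorff_pre_measure_def using assms by (intro INF_lower) auto

lemma hausdorff_pre_measure_le_content:
  assumes "bounded A" "diameter A \<le> d" "0 \<le> d"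
  shows "hausdorff_pre_measure m d A \<le> hausdorff_content m A"
proof -
  have "hausdorff_pre_measure m d A \<le> (\<Sum>i. hausdorff_content m (if i = (0::nat) then A else {}))"
    using assms by (intro hausdorff_pre_measure_le_cover) (auto split: if_splits)
  also have "\<dots> = hausdorff_content m A"
    by (subst suminf_finite[of "{0}"]) (auto simp: hausdorff_content_def)
  finally show ?thesis .
qed

lemma hausdorff_pre_measure_empty: "0 \<le> d \<Longrightarrow> hausdorff_pre_measure m d {} = 0"
  using hausdorff_pre_measure_le_content[of "{}" d m] by (simp add: hausdorff_content_def)

lemma hausdorff_pre_measure_mono:
  "A \<subseteq> B \<Longrightarrow> hausdorff_pre_measure m d A \<le> hausdorff_pre_measure m d B"
  unfolding hausdorff_pre_measure_def by (intro INF_superset_mono) auto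

lemma hausdorff_pre_measure_antimono:
  "d \<le> d' \<Longrightarrow> hausdorff_pre_measure m d' A \<le> hausdorff_pre_measure m d A"
  unfolding hausdorff_pre_measure_def by (intro INF_superset_mono) (auto intro: order_trans)

lemma hausdorff_pre_measure_close:
  assumes "hausdorff_pre_measure m d A < e"
  obtains C where "A \<subseteq> (\<Union>i::nat. C i)" "\<And>i. bounded (C i)" "\<And>i. diameter (C i) \<le> d"
    "(\<Sum>i. hausdorff_content m (C i)) < e"
  using assms unfolding hausdorff_pre_measure_def INF_less_iff by auto

lemma hausdorff_pre_measure_countably_subadditive:
  fixes A :: "nat \<Rightarrow> 'a::metric_space set"
  shows "hausdorff_pre_measure m d (\<Union>i. A i) \<le> (\<Sum>i. hausdorff_pre_measure m d (A i))"
proof (rule ennreal_le_epsilon)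
  let ?O = "hausdorff_pre_measure m d"
  fix e :: real assume "0 < e" "(\<Sum>n. ?O (A n)) < top"
  hence *: "\<And>n. ?O (A n) < ?O (A n) + e * (1/2)^Suc n"
    by (auto simp add: less_top dest!: ennreal_suminf_lessD)
  have "\<exists>C. A n \<subseteq> (\<Union>i::nat. C i) \<and> (\<forall>i. bounded (C i)) \<and> (\<forall>i. diameter (C i) \<le> d) \<and>
      (\<Sum>i. hausdorff_content m (C i)) \<le> ?O (A n) + e * (1/2)^Suc n" for n
    using hausdorff_pre_measure_close[OF *[of n]] by (metis less_imp_le)
  then obtain B :: "nat \<Rightarrow> nat \<Rightarrow> 'a set" where B: "\<And>n. A n \<subseteq> (\<Union>i. B n i)" "\<And>n i. bounded (B n i)"
      "\<And>n i. diameter (B n i) \<le> d"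
      and Ble: "\<And>n. (\<Sum>i. hausdorff_content m (B n i)) \<le> ?O (A n) + e * (1/2)^Suc n"
    by metis
  define C where "C = case_prod B o prod_decode"
  have A_C: "(\<Union>i. A i) \<subseteq> (\<Union>i. C i)"
    using B(1) by (auto simp add: C_def subset_eq) (metis prod.case prod_encode_inverse)
  have "?O (\<Union>i. A i) \<le> (\<Sum>i. hausdorff_content m (C i))"
    using A_C B by (intro hausdorff_pre_measure_le_cover) (auto simp: C_def split_def)
  also have "\<dots> = (\<Sum>n. \<Sum>i. hausdorff_content m (B n i))"
    unfolding C_def comp_def
    using suminf_ennreal_2dimen[of "\<lambda>n. \<Sum>i. hausdorff_content m (B n i)" "\<lambda>(n, i). hausdorff_content m (B n i)"]
    by (simp add: split_def)
  also have "\<dots> \<le> (\<Sum>n. ?O (A n) + e * (1/2) ^ Suc n)"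
    by (intro suminf_le Ble) auto
  also have "... = (\<Sum>n. ?O (A n)) + (\<Sum>n. ennreal e * ennreal ((1/2) ^ Suc n))"
    using \<open>0 < e\<close> by (subst suminf_add[symmetric])
                     (auto simp del: ennreal_suminf_cmult simp add: ennreal_mult[symmetric])
  also have "\<dots> = (\<Sum>n. ?O (A n)) + e"
    unfolding ennreal_suminf_cmult
    by (subst suminf_ennreal_eq[OF zero_le_power power_half_series]) auto
  finally show "?O (\<Union>i. A i) \<le> (\<Sum>n. ?O (A n)) + e" .
qed

lemma hausdorff_pre_measure_Un:
  assumes "0 \<le> d"
  shows "hausdorff_pre_measure m d (A \<union> B) \<le> hausdorff_pre_measure m d A + hausdorff_pre_measure m d B"
proof -
  let ?f = "\<lambda>i::nat. if i = 0 then A else if i = 1 then B else {}"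
  have "hausdorff_pre_measure m d (A \<union> B) \<le> hausdorff_pre_measure m d (\<Union>i. ?f i)"
    by (intro hausdorff_pre_measure_mono) (force split: if_splits)
  also have "\<dots> \<le> (\<Sum>i. hausdorff_pre_measure m d (?f i))"
    by (rule hausdorff_pre_measure_countably_subadditive)
  also have "\<dots> = hausdorff_pre_measure m d A + hausdorff_pre_measure m d B"
    using assms by (subst suminf_finite[of "{0, 1}"]) (auto simp: hausdorff_pre_measure_empty)
  finally show ?thesis .
qed

lemma hausdorff_pre_measure_finite_UN:
  assumes "0 \<le> d" "finite I"
  shows "hausdorff_pre_measure m d (\<Union>i\<in>I. A i) \<le> (\<Sum>i\<in>I. hausdorff_pre_measure m d (A i))"
  using assms(2)
proof (induction I rule: finite_induct)
  case (insert x F)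
  have "hausdorff_pre_measure m d (\<Union>i\<in>insert x F. A i) \<le>
      hausdorff_pre_measure m d (A x) + hausdorff_pre_measure m d (\<Union>i\<in>F. A i)"
    using hausdorff_pre_measure_Un[OF assms(1)] by simp
  also have "\<dots> \<le> hausdorff_pre_measure m d (A x) + (\<Sum>i\<in>F. hausdorff_pre_measure m d (A i))"
    by (intro add_left_mono insert.IH)
  finally show ?case using insert.hyps by simp
qed (use assms in \<open>simp add: hausdorff_pre_measure_empty\<close>)

lemma hausdorff_pre_le_outer: "0 < d \<Longrightarrow> hausdorff_pre_measure m d A \<le> hausdorff_outer_measure m A"
  unfolding hausdorff_outer_measure_def by (intro SUP_upper) auto

lemma hausdorff_outer_leI:
  assumes "e > 0" "\<And>d. 0 < d \<Longrightarrow> d < e \<Longrightarrow> hausdorff_pre_measure m d A \<le> c"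
  shows "hausdorff_outer_measure m A \<le> c"
  unfolding hausdorff_outer_measure_def
proof (intro SUP_least)
  fix d :: real assume "d \<in> {0<..}"
  hence "hausdorff_pre_measure m d A \<le> hausdorff_pre_measure m (min d (e / 2)) A"
    by (intro hausdorff_pre_measure_antimono) auto
  also have "\<dots> \<le> c" using \<open>d \<in> {0<..}\<close> assms(1) by (intro assms(2)) auto
  finally show "hausdorff_pre_measure m d A \<le> c" .
qed

lemma hausdorff_outer_eq_SUP:
  assumes "e > 0"
  shows "hausdorff_outer_measure m A = (SUP k::nat. hausdorff_pre_measure m (e / real (k + 2)) A)"
proof (rule antisym)
  show "hausdorff_outer_measure m A \<le> (SUP k::nat. hausdorff_pre_measure m (e / real (k + 2)) A)"
    unfolding hausdorff_outer_measure_def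
  proof (rule SUP_mono)
    fix d :: real assume d: "d \<in> {0<..}"
    obtain k :: nat where k: "e / d < real k" using reals_Archimedean2 by blast
    hence "e / real (k + 2) \<le> d" using d assms by (simp add: field_simps)
    thus "\<exists>k\<in>UNIV. hausdorff_pre_measure m d A \<le> hausdorff_pre_measure m (e / real (k + 2)) A"
      using hausdorff_pre_measure_antimono by blast
  qed
  show "(SUP k::nat. hausdorff_pre_measure m (e / real (k + 2)) A) \<le> hausdorff_outer_measure m A"
    using assms by (intro SUP_least hausdorff_pre_le_outer) auto
qed

lemma hausdorff_outer_empty: "hausdorff_outer_measure m {} = 0"
  using hausdorff_outer_leI[of 1 m "{}" 0] by (simp add: hausdorff_pre_measure_empty)

lemma hausdorff_outer_mono: "A \<subseteq> B \<Longrightarrow> hausdorff_outer_measure m A \<le> hausdorff_outer_measure m B"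
  unfolding hausdorff_outer_measure_def by (intro SUP_mono) (auto intro: hausdorff_pre_measure_mono)

lemma hausdorff_outer_countably_subadditive:
  "hausdorff_outer_measure m (\<Union>i::nat. A i) \<le> (\<Sum>i. hausdorff_outer_measure m (A i))"
proof (rule hausdorff_outer_leI[of 1])
  fix d :: real assume "0 < d"
  have "hausdorff_pre_measure m d (\<Union>i. A i) \<le> (\<Sum>i. hausdorff_pre_measure m d (A i))"
    by (rule hausdorff_pre_measure_countably_subadditive)
  also have "\<dots> \<le> (\<Sum>i. hausdorff_outer_measure m (A i))"
    using \<open>0 < d\<close> by (intro suminf_le hausdorff_pre_le_outer) auto
  finally show "hausdorff_pre_measure m d (\<Union>i. A i) \<le> (\<Sum>i. hausdorff_outer_measure m (A i))" .
qed simp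

lemma hausdorff_outer_Un:
  "hausdorff_outer_measure m (A \<union> B) \<le> hausdorff_outer_measure m A + hausdorff_outer_measure m B"
proof (rule hausdorff_outer_leI[of 1])
  fix d :: real assume "0 < d"
  thus "hausdorff_pre_measure m d (A \<union> B) \<le> hausdorff_outer_measure m A + hausdorff_outer_measure m B"
    by (intro order_trans[OF hausdorff_pre_measure_Un] add_mono hausdorff_pre_le_outer) auto
qed simp

lemma hausdorff_outer_measure_space:
  "outer_measure_space (Pow UNIV) (hausdorff_outer_measure m)"
  unfolding outer_measure_space_def positive_def increasing_def countably_subadditive_def
  by (auto simp: hausdorff_outer_empty intro: hausdorff_outer_mono hausdorff_outer_countably_subadditive)

text \<open>
Covering sets of diameter less than the distance of \<open>A\<close> and \<open>B\<close> meet only one of the two, so every fine cover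
of the union splits.
\<close>

lemma hausdorff_outer_separated:
  assumes "e > 0" "\<And>x y. x \<in> A \<Longrightarrow> y \<in> B \<Longrightarrow> e \<le> dist x y"
  shows "hausdorff_outer_measure m A + hausdorff_outer_measure m B \<le> hausdorff_outer_measure m (A \<union> B)"
proof -
  have pre: "hausdorff_pre_measure m d A + hausdorff_pre_measure m d B \<le> hausdorff_outer_measure m (A \<union> B)"
    if d: "0 < d" "d < e" for d
  proof -
    have "hausdorff_pre_measure m d A + hausdorff_pre_measure m d B \<le> hausdorff_pre_measure m d (A \<union> B)"
      unfolding hausdorff_pre_measure_def[of m d "A \<union> B"]
    proof (intro INF_greatest, safe)
      fix C :: "nat \<Rightarrow> 'a set"
      assume C: "A \<union> B \<subseteq> \<Union> (range C)" "\<forall>i. bounded (C i) \<and> diameter (C i) \<le> d"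
      let ?A = "\<lambda>i. C i \<inter> A" and ?B = "\<lambda>i. C i \<inter> B"
      have sub: "bounded (C i \<inter> X)" "diameter (C i \<inter> X) \<le> d" for i X
        using C(2) diameter_subset[of "C i \<inter> X" "C i"] bounded_subset[of "C i" "C i \<inter> X"]
        by (auto intro: order_trans)
      have "hausdorff_pre_measure m d A + hausdorff_pre_measure m d B \<le>
          (\<Sum>i. hausdorff_content m (?A i)) + (\<Sum>i. hausdorff_content m (?B i))"
        using C(1) sub by (intro add_mono hausdorff_pre_measure_le_cover) auto
      also have "\<dots> = (\<Sum>i. hausdorff_content m (?A i) + hausdorff_content m (?B i))"
        by (intro suminf_add) auto
      also have "\<dots> \<le> (\<Sum>i. hausdorff_content m (C i))"
      proof (intro suminf_le allI)
        fix i
        have "?A i = {} \<or> ?B i = {}"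
        proof (rule ccontr)
          assume "\<not> ?thesis"
          then obtain x y where "x \<in> C i" "x \<in> A" "y \<in> C i" "y \<in> B" by auto
          moreover have "dist x y \<le> d"
            using diameter_bounded_bound[of "C i" x y] C(2) calculation by (meson order_trans)
          ultimately show False using assms(2)[of x y] d by auto
        qed
        thus "hausdorff_content m (?A i) + hausdorff_content m (?B i) \<le> hausdorff_content m (C i)"
          using C(2) hausdorff_content_mono[of "?A i" "C i" m] hausdorff_content_mono[of "?B i" "C i" m]
          by (auto simp: hausdorff_content_def[of m "{}"])
      qed auto
      finally show "hausdorff_pre_measure m d A + hausdorff_pre_measure m d B \<le> (\<Sum>i. hausdorff_content m (C i))" .
    qed
    also have "\<dots> \<le> hausdorff_outer_measure m (A \<union> B)" using d by (intro hausdorff_pre_le_outer)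
    finally show ?thesis .
  qed
  have inc: "incseq (\<lambda>k. hausdorff_pre_measure m (e / real (k + 2)) X)" for X :: "'a set"
    using assms(1) by (intro monoI hausdorff_pre_measure_antimono) (auto simp: frac_le)
  have "hausdorff_outer_measure m A + hausdorff_outer_measure m B =
      (SUP k. hausdorff_pre_measure m (e / real (k + 2)) A + hausdorff_pre_measure m (e / real (k + 2)) B)"
    unfolding hausdorff_outer_eq_SUP[OF assms(1)] by (rule ennreal_SUP_add[OF inc inc, symmetric])
  also have "\<dots> \<le> hausdorff_outer_measure m (A \<union> B)"
    using assms(1) by (intro SUP_least pre) (auto simp: field_simps intro!: add_pos_nonneg)
  finally show ?thesis .
qed

lemma hausdorff_outer_separated_UN:
  fixes D :: "nat \<Rightarrow> 'a::metric_space set"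
  assumes "\<And>k. \<exists>e>0. \<forall>x\<in>(\<Union>j<k. D j). \<forall>y\<in>D k. e \<le> dist x y"
  shows "(\<Sum>k<N. hausdorff_outer_measure m (D k)) \<le> hausdorff_outer_measure m (\<Union>k<N. D k)"
proof (induction N)
  case (Suc N)
  obtain e where e: "e > 0" "\<And>x y. x \<in> (\<Union>j<N. D j) \<Longrightarrow> y \<in> D N \<Longrightarrow> e \<le> dist x y"
    using assms[of N] by blast
  have "(\<Sum>k<Suc N. hausdorff_outer_measure m (D k)) \<le>
      hausdorff_outer_measure m (\<Union>k<N. D k) + hausdorff_outer_measure m (D N)"
    using Suc.IH by (simp add: add_right_mono)
  also have "\<dots> \<le> hausdorff_outer_measure m ((\<Union>k<N. D k) \<union> D N)"
    by (rule hausdorff_outer_separated[OF e])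
  also have "(\<Union>k<N. D k) \<union> D N = (\<Union>k<Suc N. D k)"
    by (auto simp: less_Suc_eq)
  finally show ?case .
qed simp

lemma ennreal_suminf_tail_small:
  fixes f :: "nat \<Rightarrow> ennreal"
  assumes "(\<Sum>i. f i) < top" "e > 0"
  shows "\<exists>n. (\<Sum>i. f (i + n)) \<le> ennreal e"
proof -
  have f: "f i < top" for i
    using ennreal_suminf_lessD[OF assms(1)] by blast
  define g where "g i = enn2real (f i)" for i
  have fg: "f i = ennreal (g i)" for i using f[of i] by (simp add: g_def)
  have g0: "0 \<le> g i" for i by (simp add: g_def)
  have sg: "summable g"
    using assms(1) g0 by (intro summable_suminf_not_top) (auto simp: fg)
  obtain N where N: "norm (\<Sum>i. g (i + N)) < e"
    using suminf_exist_split[OF assms(2) sg] by blast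
  have "(\<Sum>i. f (i + N)) = ennreal (\<Sum>i. g (i + N))"
    unfolding fg using g0 sg by (intro suminf_ennreal2) auto
  also have "\<dots> \<le> ennreal e" using N by (intro ennreal_leI) auto
  finally show ?thesis by blast
qed

text \<open>
Caratheodory's criterion for metric outer measures.  Points of \<open>A\<close> far from \<open>F\<close> are separated from \<open>F\<close>, so
only the points outside \<open>F\<close> at a small positive distance matter.  They lie in thin layers around \<open>F\<close>; every
other layer is separated from the previous ones, which bounds the sum of their measures by twice the measure of \<open>A\<close>
and makes its tails small.
\<close>

lemma hausdorff_caratheodory_closed:
  fixes F :: "'a::metric_space set"
  assumes F: "closed F"
  shows "hausdorff_outer_measure m (A \<inter> F) + hausdorff_outer_measure m (A - F) \<le> hausdorff_outer_measure m A"
proof (cases "F = {} \<or> hausdorff_outer_measure m A = top")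
  case True
  thus ?thesis by (auto simp: hausdorff_outer_empty)
next
  case False
  let ?H = "hausdorff_outer_measure m :: 'a set \<Rightarrow> ennreal"
  define f where "f x = infdist x F" for x
  have f0: "f x = 0" if "x \<in> F" for x using that by (simp add: f_def)
  have fpos: "f x > 0" if "x \<notin> F" for x
    using infdist_pos_not_in_closed[OF F _ that] False by (simp add: f_def)
  have lip: "f x \<le> f y + dist x y" for x y unfolding f_def by (rule infdist_triangle)
  \<comment> \<open>\<open>B k\<close> exhausts \<open>A - F\<close>, and \<open>D k\<close> is the layer that is added from \<open>B k\<close> to \<open>B (k + 1)\<close>.\<close>
  define B where "B k = {x \<in> A. 1 / real (k + 1) \<le> f x}" for k
  define D where "D k = {x \<in> A. 1 / real (k + 2) \<le> f x \<and> f x < 1 / real (k + 1)}" for k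
  \<comment> \<open>Layers of equal parity are separated by the layers in between; \<open>p\<close> selects the parity.\<close>
  have part: "(\<Sum>k<N. ?H (D (2 * k + p))) \<le> ?H A" for N p
  proof -
    have "(\<Sum>k<N. ?H (D (2 * k + p))) \<le> ?H (\<Union>k<N. D (2 * k + p))"
    proof (rule hausdorff_outer_separated_UN)
      fix k
      show "\<exists>e>0. \<forall>x\<in>\<Union>j<k. D (2 * j + p). \<forall>y\<in>D (2 * k + p). e \<le> dist x y"
      proof (cases "k = 0")
        case True
        thus ?thesis by (intro exI[of _ 1]) auto
      next
        case k: False
        let ?e = "1 / real (2 * k + p) - 1 / real (2 * k + p + 1)"
        have "1 / real (2 * k + p + 1) < 1 / real (2 * k + p)"
          using k by (intro divide_strict_left_mono) auto
        hence "?e > 0" by simp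
        moreover have "?e \<le> dist x y" if "j < k" "x \<in> D (2 * j + p)" "y \<in> D (2 * k + p)" for j x y
        proof -
          have "1 / real (2 * k + p) \<le> 1 / real (2 * j + p + 2)"
            using that(1) by (intro divide_left_mono) auto
          also have "\<dots> \<le> f x" using that(2) by (simp add: D_def)
          finally have "1 / real (2 * k + p) \<le> f x" .
          moreover have "f y < 1 / real (2 * k + p + 1)" using that(3) by (simp add: D_def)
          ultimately show ?thesis using lip[of x y] by linarith
        qed
        ultimately show ?thesis by blast
      qed
    qed
    also have "\<dots> \<le> ?H A" by (intro hausdorff_outer_mono) (auto simp: D_def)
    finally show ?thesis .
  qed
  have sum2: "(\<Sum>k<2 * N. ?H (D k)) = (\<Sum>k<N. ?H (D (2 * k + 0))) + (\<Sum>k<N. ?H (D (2 * k + 1)))" for N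
    by (induction N) (auto simp: algebra_simps)
  have "(\<Sum>k. ?H (D k)) \<le> 2 * ?H A"
  proof (rule suminf_le_const)
    fix N
    have "(\<Sum>k<N. ?H (D k)) \<le> (\<Sum>k<2 * N. ?H (D k))"
      by (intro sum_mono2) auto
    also have "\<dots> \<le> ?H A + ?H A" unfolding sum2 by (intro add_mono part)
    finally show "(\<Sum>k<N. ?H (D k)) \<le> 2 * ?H A" by (simp add: mult_2)
  qed simp
  also have "\<dots> < top" using False by (simp add: ennreal_mult_less_top less_top)
  finally have fin: "(\<Sum>k. ?H (D k)) < top" .
  show ?thesis
  proof (rule ennreal_le_epsilon)
    fix e :: real assume "e > 0"
    then obtain n where n: "(\<Sum>k. ?H (D (k + n))) \<le> ennreal e"
      using ennreal_suminf_tail_small[OF fin] by blast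
    have "A - F \<subseteq> B n \<union> (\<Union>k. D (k + n))"
    proof
      fix x assume x: "x \<in> A - F"
      show "x \<in> B n \<union> (\<Union>k. D (k + n))"
      proof (cases "x \<in> B n")
        case xB: False
        define k where "k = (LEAST k. 1 / real (k + 1) \<le> f x)"
        obtain j where "inverse (real (Suc j)) < f x"
          using reals_Archimedean[OF fpos[of x]] x by auto
        hence "1 / real (j + 1) \<le> f x" by (simp add: inverse_eq_divide)
        hence k: "1 / real (k + 1) \<le> f x" unfolding k_def by (rule LeastI)
        have kn: "k > n"
        proof (rule ccontr)
          assume "\<not> k > n"
          hence "1 / real (n + 1) \<le> 1 / real (k + 1)" by (intro divide_left_mono) auto
          thus False using k xB x by (auto simp: B_def)
        qed
        then obtain i where i: "k = Suc (i + n)" using less_iff_Suc_add by (auto simp: add.commute)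
        have "\<not> 1 / real (i + n + 1) \<le> f x"
          using not_less_Least[of "i + n" "\<lambda>k. 1 / real (k + 1) \<le> f x"] i unfolding k_def by auto
        hence "x \<in> D (i + n)" using k x i by (auto simp: D_def add.assoc)
        thus ?thesis by blast
      qed auto
    qed
    hence "?H (A - F) \<le> ?H (B n \<union> (\<Union>k. D (k + n)))" by (rule hausdorff_outer_mono)
    also have "\<dots> \<le> ?H (B n) + ?H (\<Union>k. D (k + n))" by (rule hausdorff_outer_Un)
    also have "\<dots> \<le> ?H (B n) + ennreal e"
      by (intro add_left_mono order_trans[OF hausdorff_outer_countably_subadditive n])
    finally have "?H (A \<inter> F) + ?H (A - F) \<le> (?H (A \<inter> F) + ?H (B n)) + ennreal e"
      by (simp add: add_left_mono add.assoc)
    also have "?H (A \<inter> F) + ?H (B n) \<le> ?H ((A \<inter> F) \<union> B n)"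
    proof (rule hausdorff_outer_separated)
      fix x y assume "x \<in> A \<inter> F" "y \<in> B n"
      thus "1 / real (n + 1) \<le> dist x y"
        using lip[of y x] f0[of x] by (auto simp: B_def dist_commute)
    qed simp
    also have "\<dots> \<le> ?H A" by (intro hausdorff_outer_mono) (auto simp: B_def)
    finally show "?H (A \<inter> F) + ?H (A - F) \<le> ?H A + ennreal e"
      by (simp add: add_right_mono)
  qed
qed

lemma hausdorff_lambda_system_iff:
  "E \<in> lambda_system UNIV (Pow UNIV) (hausdorff_outer_measure m) \<longleftrightarrow>
    (\<forall>A. hausdorff_outer_measure m (A \<inter> E) + hausdorff_outer_measure m (A - E) \<le> hausdorff_outer_measure m A)"
proof -
  have "hausdorff_outer_measure m A \<le> hausdorff_outer_measure m (A \<inter> E) + hausdorff_outer_measure m (A - E)" for A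
    using hausdorff_outer_Un[of m "A \<inter> E" "A - E"] by (simp add: Int_Diff_Un)
  thus ?thesis
    unfolding algebra.lambda_system_eq[OF algebra_Pow] by (auto intro: order_antisym)
qed

lemma sigma_algebra_hausdorff_lambda_system:
  "measure_space UNIV (lambda_system UNIV (Pow UNIV) (hausdorff_outer_measure m)) (hausdorff_outer_measure m)"
  by (rule sigma_algebra.caratheodory_lemma[OF sigma_algebra_Pow hausdorff_outer_measure_space])

lemma space_hausdorff_measure [simp]: "space (hausdorff_measure m) = UNIV"
  by (simp add: hausdorff_measure_def)

lemma sets_hausdorff_measure:
  "sets (hausdorff_measure m) = lambda_system UNIV (Pow UNIV) (hausdorff_outer_measure m)"
proof -
  note sigma_algebra_hausdorff_lambda_system[unfolded measure_space_def, THEN conjunct1]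
  from sigma_algebra.sigma_sets_eq[OF this] show ?thesis
    by (simp add: hausdorff_measure_def)
qed

lemma emeasure_hausdorff_measure:
  assumes "A \<in> sets (hausdorff_measure m)"
  shows "emeasure (hausdorff_measure m) A = hausdorff_outer_measure m A"
  unfolding hausdorff_measure_def
  by (rule emeasure_measure_of_sigma)
     (use sigma_algebra_hausdorff_lambda_system[of m] assms in \<open>auto simp: measure_space_def sets_hausdorff_measure\<close>)

lemma borel_subset_sets_hausdorff_measure:
  "sets borel \<subseteq> sets (hausdorff_measure m :: 'a::metric_space measure)"
proof -
  have "Collect closed \<subseteq> sets (hausdorff_measure m :: 'a measure)"
    unfolding sets_hausdorff_measure using hausdorff_caratheodory_closed
    by (auto simp only: hausdorff_lambda_system_iff mem_Collect_eq subset_eq)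
  from sets.sigma_sets_subset[OF this]
  have "sigma_sets UNIV (Collect closed) \<subseteq> sets (hausdorff_measure m :: 'a measure)" by simp
  thus ?thesis by (simp add: borel_eq_closed)
qed

text \<open>
Completeness: the exceptional directions, where \<open>radial_gauss_map\<close> has an unspecified value, cannot spoil
measurability.
\<close>

lemma hausdorff_null_measurable:
  assumes "hausdorff_outer_measure m N = 0" "E \<subseteq> N"
  shows "E \<in> sets (hausdorff_measure m)"
  unfolding sets_hausdorff_measure hausdorff_lambda_system_iff
proof
  fix A
  have "hausdorff_outer_measure m (A \<inter> E) \<le> hausdorff_outer_measure m N"
    using assms(2) by (intro hausdorff_outer_mono) auto
  hence "hausdorff_outer_measure m (A \<inter> E) = 0" using assms(1) by simp
  thus "hausdorff_outer_measure m (A \<inter> E) + hausdorff_outer_measure m (A - E) \<le> hausdorff_outer_measure m A"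
    by (simp add: hausdorff_outer_mono)
qed

section \<open>Cone measure on the unit sphere\<close>

lemma borel_measurable_sgn_vec [measurable]: "(sgn :: 'a::euclidean_space \<Rightarrow> 'a) \<in> borel_measurable borel"
  unfolding sgn_div_norm[abs_def] by measurable

text \<open>
For subsets of the sphere this is the truncated cone over the set; as \<open>sgn 0 = 0\<close>, the apex is left out there.
\<close>

definition unit_cone :: "'a::euclidean_space set \<Rightarrow> 'a set" where
  "unit_cone A = {x \<in> cball 0 1. sgn x \<in> A}"

lemma unit_cone_borel [measurable]: "A \<in> sets borel \<Longrightarrow> unit_cone A \<in> sets borel"
proof -
  assume A: "A \<in> sets borel"
  have "unit_cone A = cball 0 1 \<inter> (sgn -` A)" by (auto simp: unit_cone_def)
  moreover have "sgn -` A \<in> sets borel"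
    using measurable_sets[OF borel_measurable_sgn_vec A] by simp
  ultimately show ?thesis by simp
qed

text \<open>
The factor is the one for which a piece of the sphere has the volume of its cone times \<open>n\<close>, as surface area
should.
\<close>

definition sphere_measure :: "'a::euclidean_space measure" where
  "sphere_measure = density (distr (density lborel (indicator (cball 0 1))) borel sgn) (\<lambda>_. ennreal (real DIM('a)))"

lemma sets_sphere_measure [simp, measurable_cong]: "sets sphere_measure = sets borel"
  by (simp add: sphere_measure_def)

lemma space_sphere_measure [simp]: "space sphere_measure = UNIV"
  by (simp add: sphere_measure_def)

lemma emeasure_sphere_measure:
  fixes A :: "'a::euclidean_space set"
  assumes [measurable]: "A \<in> sets borel"
  shows "emeasure sphere_measure A = ennreal (real DIM('a)) * emeasure lborel (unit_cone A)"
proof -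
  have [measurable]: "cball (0::'a) 1 \<in> sets borel" by simp
  have "emeasure sphere_measure A = ennreal (real DIM('a)) * emeasure (distr (density lborel (indicator (cball 0 1))) borel sgn) A"
    unfolding sphere_measure_def by (subst emeasure_density) (auto simp: nn_integral_cmult)
  also have "emeasure (distr (density lborel (indicator (cball 0 1))) borel sgn) A =
      emeasure (density lborel (indicator (cball (0::'a) 1))) {x. sgn x \<in> A}"
    by (subst emeasure_distr) (auto simp: vimage_def)
  also have "\<dots> = (\<integral>\<^sup>+ x. indicator (cball 0 1) x * indicator {x. sgn x \<in> A} x \<partial>lborel)"
    by (rule emeasure_density) measurable
  also have "\<dots> = (\<integral>\<^sup>+ x. indicator (unit_cone A) x \<partial>lborel)"
    by (rule nn_integral_cong) (auto simp: indicator_def unit_cone_def)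
  finally show ?thesis by simp
qed

lemma emeasure_sphere_measure_Int_sphere:
  fixes A :: "'a::euclidean_space set"
  assumes [measurable]: "A \<in> sets borel"
  shows "emeasure sphere_measure (A \<inter> sphere 0 1) = emeasure sphere_measure A"
proof -
  have "unit_cone (A \<inter> sphere 0 1) = unit_cone A - {0}"
    by (auto simp: unit_cone_def norm_sgn)
  moreover have "emeasure lborel (unit_cone A - {0}) = emeasure lborel (unit_cone A)"
    by (rule emeasure_Diff_null_set) auto
  ultimately show ?thesis by (simp add: emeasure_sphere_measure)
qed

lemma emeasure_sphere_measure_finite: "emeasure (sphere_measure :: 'a::euclidean_space measure) A < top"
proof -
  have "emeasure (sphere_measure :: 'a measure) A \<le> emeasure sphere_measure (space (sphere_measure :: 'a measure))"
    by (rule emeasure_space)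
  also have "\<dots> = ennreal (real DIM('a)) * emeasure lborel (cball (0::'a) 1)"
    by (simp add: emeasure_sphere_measure unit_cone_def cball_def)
  also have "\<dots> < top" by (simp add: emeasure_cball ennreal_mult_less_top)
  finally show ?thesis .
qed

lemma unit_cone_isometric_involution:
  assumes "linear T" "\<And>x y. T x \<bullet> T y = x \<bullet> y"
  shows "unit_cone {x. T x \<in> A} = {x. T x \<in> unit_cone A}"
proof -
  have "norm (T x) = norm x" for x using assms(2)[of x x] by (simp add: norm_eq_sqrt_inner)
  thus ?thesis
    using assms(1) by (auto simp: unit_cone_def sgn_div_norm linear_scale)
qed

lemma nn_integral_monomial:
  assumes "0 \<le> (c::real)"
  shows "(\<integral>\<^sup>+ s. indicator {0<..c} s * ennreal (s ^ m) \<partial>lborel) = ennreal (c ^ Suc m / real (Suc m))"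
proof -
  have "(\<integral>\<^sup>+ s. indicator {0<..c} s * ennreal (s ^ m) \<partial>lborel) = (\<integral>\<^sup>+ s. ennreal (s ^ m) * indicator {0..c} s \<partial>lborel)"
  proof (rule nn_integral_cong_AE)
    show "AE s in lborel. indicator {0<..c} s * ennreal (s ^ m) = ennreal (s ^ m) * indicator {0..c} s"
      using AE_lborel_singleton[of "0::real"] by eventually_elim (auto simp: indicator_def)
  qed
  also have "\<dots> = c ^ Suc m / real (Suc m) - 0 ^ Suc m / real (Suc m)"
  proof (rule nn_integral_FTC_Icc)
    fix x :: real
    show "((\<lambda>x. x ^ Suc m / real (Suc m)) has_real_derivative x ^ m) (at x)"
      using DERIV_cdivide[OF DERIV_pow[of "Suc m" x], of "real (Suc m)"] by (simp del: of_nat_Suc power_Suc)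
  qed (use assms in auto)
  finally show ?thesis by simp
qed

lemma emeasure_lborel_slices:
  fixes X :: "'a::euclidean_space set"
  assumes "b \<in> Basis" "X \<in> sets borel"
  shows "emeasure lborel X = (\<integral>\<^sup>+ s. coord_vol (Basis - {b}) {x. x + s *\<^sub>R b \<in> X} \<partial>lborel)"
proof -
  have "emeasure lborel X = coord_vol (insert b (Basis - {b})) X"
    using assms by (simp add: coord_vol_Basis insert_absorb)
  also have "\<dots> = (\<integral>\<^sup>+ s. coord_vol (Basis - {b}) {x. x + s *\<^sub>R b \<in> X} \<partial>lborel)"
    using assms by (intro coord_vol_insert) auto
  finally show ?thesis .
qed

text \<open>
Near \<open>b\<close> the central projection of the sphere to the tangent hyperplane at \<open>b\<close> is almost an isometry: the
two scale factors \<open>1 / (u \<bullet> b)\<close> and \<open>1 / (w \<bullet> b)\<close> are close to one, and their difference is of the order of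
\<open>\<delta>\<close> times the distance of the points.
\<close>

lemma gnomonic_lipschitz:
  fixes u w b :: "'a::euclidean_space"
  assumes n: "norm u = 1" "norm w = 1" "norm b = 1"
    and d: "dist u b \<le> \<delta>" "dist w b \<le> \<delta>" "0 \<le> \<delta>" "\<delta> < 1"
  shows "dist (u /\<^sub>R (u \<bullet> b)) (w /\<^sub>R (w \<bullet> b)) \<le> sqrt (1 + \<delta>\<^sup>2) / (1 - \<delta>\<^sup>2) * dist u w"
proof -
  have ip: "x \<bullet> y = 1 - (dist x y)\<^sup>2 / 2" if "norm x = 1" "norm y = 1" for x y :: 'a
  proof -
    have "(dist x y)\<^sup>2 = x \<bullet> x - 2 * (x \<bullet> y) + y \<bullet> y"
      unfolding dist_norm power2_norm_eq_inner by (simp add: inner_diff_left inner_diff_right inner_commute)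
    thus ?thesis using that by (simp add: norm_eq_1 field_simps)
  qed
  define s where "s = u \<bullet> b"
  define r where "r = w \<bullet> b"
  define D where "D = dist u w"
  have sq: "(dist u b)\<^sup>2 \<le> \<delta>\<^sup>2" "(dist w b)\<^sup>2 \<le> \<delta>\<^sup>2"
    using d by (auto intro: power_mono)
  have d2: "\<delta>\<^sup>2 < 1" using d by (simp add: abs_square_less_1)
  have s: "1 - \<delta>\<^sup>2 / 2 \<le> s" "s \<le> 1" and r: "1 - \<delta>\<^sup>2 / 2 \<le> r" "r \<le> 1"
    using sq ip[of u b] ip[of w b] n by (auto simp: s_def r_def)
  have pos: "s > 0" "r > 0" using s r d2 by auto
  have rs: "1 - \<delta>\<^sup>2 \<le> r * s"
  proof -
    have "(1 - \<delta>\<^sup>2 / 2) * (1 - \<delta>\<^sup>2 / 2) \<le> r * s"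
      using s r d2 by (intro mult_mono) auto
    moreover have "(1 - \<delta>\<^sup>2 / 2) * (1 - \<delta>\<^sup>2 / 2) = 1 - \<delta>\<^sup>2 + (\<delta>\<^sup>2 / 2)\<^sup>2"
      by (simp add: power2_eq_square algebra_simps)
    ultimately show ?thesis using zero_le_power2[of "\<delta>\<^sup>2 / 2"] by linarith
  qed
  have rs1: "r * s \<le> 1" using s r pos by (simp add: mult_le_one)
  have diff: "\<bar>r - s\<bar> \<le> \<delta> * D"
  proof -
    have "r - s = ((dist u b)\<^sup>2 - (dist w b)\<^sup>2) / 2"
      using ip[of u b] ip[of w b] n by (simp add: r_def s_def field_simps)
    also have "\<dots> = (dist u b - dist w b) * ((dist u b + dist w b) / 2)"
      by (simp add: power2_eq_square algebra_simps)
    finally have "\<bar>r - s\<bar> = \<bar>dist u b - dist w b\<bar> * \<bar>(dist u b + dist w b) / 2\<bar>"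
      by (simp only: abs_mult)
    hence "\<bar>r - s\<bar> = \<bar>dist u b - dist w b\<bar> * ((dist u b + dist w b) / 2)"
      by simp
    also have "\<dots> \<le> D * \<delta>"
      unfolding D_def using d dist_triangle[of u b w] dist_triangle[of w b u]
      by (intro mult_mono) (auto simp: dist_commute)
    finally show ?thesis by (simp add: mult.commute)
  qed
  have "(dist (u /\<^sub>R s) (w /\<^sub>R r))\<^sup>2 = (norm (r *\<^sub>R u - s *\<^sub>R w))\<^sup>2 / (r * s)\<^sup>2"
  proof -
    have "u /\<^sub>R s - w /\<^sub>R r = (1 / (r * s)) *\<^sub>R (r *\<^sub>R u - s *\<^sub>R w)"
      using pos by (simp add: scaleR_diff_right field_simps)
    thus ?thesis using pos by (simp add: dist_norm power_divide power_mult_distrib)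
  qed
  also have "(norm (r *\<^sub>R u - s *\<^sub>R w))\<^sup>2 = (r - s)\<^sup>2 + r * s * D\<^sup>2"
  proof -
    have "(norm (r *\<^sub>R u - s *\<^sub>R w))\<^sup>2 = r * r * (u \<bullet> u) - 2 * r * s * (u \<bullet> w) + s * s * (w \<bullet> w)"
      unfolding power2_norm_eq_inner by (simp add: inner_diff_left inner_diff_right inner_commute algebra_simps)
    also have "\<dots> = (r - s)\<^sup>2 + r * s * D\<^sup>2"
      using n by (simp add: ip[OF n(1,2)] D_def power2_eq_square algebra_simps norm_eq_1)
    finally show ?thesis .
  qed
  also have "\<dots> \<le> (\<delta> * D)\<^sup>2 + 1 * D\<^sup>2"
    using power_mono[OF diff abs_ge_zero, of 2] rs1 by (intro add_mono mult_right_mono) auto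
  also have "((\<delta> * D)\<^sup>2 + 1 * D\<^sup>2) / (r * s)\<^sup>2 \<le> ((\<delta> * D)\<^sup>2 + 1 * D\<^sup>2) / (1 - \<delta>\<^sup>2)\<^sup>2"
    using rs d2 pos by (intro divide_left_mono power_mono mult_pos_pos) auto
  also have "\<dots> = (sqrt (1 + \<delta>\<^sup>2) / (1 - \<delta>\<^sup>2) * D)\<^sup>2"
    by (simp add: power_divide power_mult_distrib algebra_simps)
  finally have "(dist (u /\<^sub>R s) (w /\<^sub>R r))\<^sup>2 \<le> (sqrt (1 + \<delta>\<^sup>2) / (1 - \<delta>\<^sup>2) * D)\<^sup>2"
    by (simp add: divide_right_mono)
  thus ?thesis unfolding s_def r_def D_def
    by (rule power2_le_imp_le) (use d2 in auto)
qed

text \<open>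
The cone over \<open>E\<close> lies in the cone of height one over the central projection \<open>G\<close> of \<open>E\<close> to the tangent hyperplane at \<open>b\<close>,
whose volume is that of \<open>G\<close> divided by \<open>n\<close>.  The isodiametric inequality in the hyperplane bounds the volume of
\<open>G\<close>, and the projection hardly increases the diameter.
\<close>

lemma sphere_measure_le_aux:
  fixes E :: "'a::euclidean_space set"
  assumes E: "compact E" "E \<subseteq> sphere 0 1" "b \<in> E" "b \<in> Basis"
    and d: "\<And>u w. u \<in> E \<Longrightarrow> w \<in> E \<Longrightarrow> dist u w \<le> d" "0 \<le> d" "d \<le> \<delta>" "\<delta> < 1"
  defines "m \<equiv> DIM('a) - 1"
  shows "emeasure sphere_measure E \<le> ennreal ((sqrt (1 + \<delta>\<^sup>2) / (1 - \<delta>\<^sup>2)) ^ m * (unit_ball_vol (real m) * (d / 2) ^ m))"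
proof -
  let ?I = "Basis - {b}"
  define L where "L = sqrt (1 + \<delta>\<^sup>2) / (1 - \<delta>\<^sup>2)"
  have d2: "\<delta>\<^sup>2 < 1" using d by (simp add: abs_square_less_1)
  have L: "L > 0" using d2 by (simp add: L_def add_pos_nonneg)
  have m: "card ?I = m" "DIM('a) = Suc m" using E(4) DIM_positive[where 'a = 'a] by (simp_all add: m_def)
  have nb: "norm b = 1" "b \<bullet> b = 1" using E(4) by auto
  have n1: "norm u = 1" if "u \<in> E" for u using that E(2) by auto
  have bpos: "u \<bullet> b > 0" if "u \<in> E" for u
  proof -
    have "(dist u b)\<^sup>2 \<le> \<delta>\<^sup>2" using d(1)[OF that E(3)] d by (intro power_mono) auto
    moreover have "(dist u b)\<^sup>2 = 2 - 2 * (u \<bullet> b)"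
      unfolding dist_norm power2_norm_eq_inner using n1[OF that] nb
      by (simp add: inner_diff_left inner_diff_right inner_commute norm_eq_1)
    ultimately show ?thesis using d2 by linarith
  qed
  define G where "G = (\<lambda>u. u /\<^sub>R (u \<bullet> b) - b) ` E"
  have G: "compact G" unfolding G_def
    using bpos by (intro compact_continuous_image continuous_intros E) (auto simp: less_imp_neq[symmetric])
  have diamG: "dist x y \<le> L * d" if xy: "x \<in> G" "y \<in> G" for x y
  proof -
    obtain u w where uw: "u \<in> E" "w \<in> E" "x = u /\<^sub>R (u \<bullet> b) - b" "y = w /\<^sub>R (w \<bullet> b) - b"
      using xy by (auto simp: G_def)
    have "dist x y = dist (u /\<^sub>R (u \<bullet> b)) (w /\<^sub>R (w \<bullet> b))" by (simp add: uw dist_norm)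
    also have "\<dots> \<le> L * dist u w"
      unfolding L_def using n1 uw nb E(3) d order_trans[OF d(1)[OF _ E(3)] d(3)] by (intro gnomonic_lipschitz) auto
    also have "\<dots> \<le> L * d" using L d(1)[OF uw(1,2)] by simp
    finally show ?thesis .
  qed
  have slice: "coord_vol ?I {x. x + s *\<^sub>R b \<in> unit_cone E} \<le> (indicator {0<..1} s * ennreal (s ^ m)) * coord_vol ?I G" for s
  proof (cases "s \<in> {0<..1}")
    case True
    have "coord_vol ?I {x. x + s *\<^sub>R b \<in> unit_cone E} \<le> coord_vol ?I {x. (1 / s) *\<^sub>R x \<in> G}"
    proof (rule coord_vol_mono_span, clarify)
      fix x assume x: "x \<in> span ?I" "x + s *\<^sub>R b \<in> unit_cone E"
      define y where "y = x + s *\<^sub>R b"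
      have yb: "y \<bullet> b = s" using span_orthogonal_Basis[OF _ _ x(1), of b] E(4) nb by (auto simp: y_def inner_add_left)
      hence y0: "norm y > 0" using True by auto
      have u: "sgn y \<in> E" using x by (simp add: unit_cone_def y_def)
      have eq: "sgn y /\<^sub>R (sgn y \<bullet> b) - b = (1 / s) *\<^sub>R x"
      proof -
        have "sgn y \<bullet> b = s / norm y" by (simp add: sgn_div_norm yb divide_inverse mult.commute)
        hence "sgn y /\<^sub>R (sgn y \<bullet> b) = (inverse (s / norm y) * inverse (norm y)) *\<^sub>R y"
          by (simp add: sgn_div_norm)
        also have "inverse (s / norm y) * inverse (norm y) = 1 / s"
          using y0 by (simp add: divide_inverse)
        finally show ?thesis using True by (simp add: y_def scaleR_add_right)
      qed
      show "(1 / s) *\<^sub>R x \<in> G" unfolding G_def unfolding eq[symmetric] by (rule imageI[OF u])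
    qed
    also have "\<dots> = ennreal (\<bar>s\<bar> ^ card ?I) * coord_vol ?I {x. s *\<^sub>R x \<in> {x. (1 / s) *\<^sub>R x \<in> G}}"
      using True G borel_translate_scale[OF borel_compact[OF G], of "1 / s" 0] by (intro coord_vol_scale) auto
    also have "\<dots> = (indicator {0<..1} s * ennreal (s ^ m)) * coord_vol ?I G"
      using True m by simp
    finally show ?thesis .
  next
    case False
    have "coord_vol ?I {x. x + s *\<^sub>R b \<in> unit_cone E} \<le> coord_vol ?I {}"
    proof (rule coord_vol_mono_span)
      fix x assume x: "x \<in> span ?I" "x \<in> {x. x + s *\<^sub>R b \<in> unit_cone E}"
      define y where "y = x + s *\<^sub>R b"
      have yb: "y \<bullet> b = s" using span_orthogonal_Basis[OF _ _ x(1), of b] E(4) nb by (auto simp: y_def inner_add_left)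
      have u: "sgn y \<in> E" "norm y \<le> 1" using x by (auto simp: unit_cone_def y_def)
      have "norm y > 0" using u n1[of "sgn y"] by (auto simp: norm_sgn split: if_splits)
      hence "s > 0" using bpos[OF u(1)] yb by (simp add: sgn_div_norm zero_less_mult_iff)
      moreover have "s \<le> 1" using Cauchy_Schwarz_ineq2[of y b] yb u nb by simp
      ultimately show "x \<in> {}" using False by simp
    qed
    thus ?thesis by (simp add: coord_vol_def)
  qed
  have "emeasure lborel (unit_cone E) = (\<integral>\<^sup>+ s. coord_vol ?I {x. x + s *\<^sub>R b \<in> unit_cone E} \<partial>lborel)"
    using E borel_compact[OF E(1)] by (intro emeasure_lborel_slices) auto
  also have "\<dots> \<le> (\<integral>\<^sup>+ s. (indicator {0<..1} s * ennreal (s ^ m)) * coord_vol ?I G \<partial>lborel)"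
    by (intro nn_integral_mono slice)
  also have "\<dots> = ennreal (1 / real (Suc m)) * coord_vol ?I G"
    by (subst nn_integral_multc) (auto simp: nn_integral_monomial)
  finally have le: "emeasure lborel (unit_cone E) \<le> ennreal (1 / real (Suc m)) * coord_vol ?I G" .
  have "emeasure sphere_measure E \<le> ennreal (real (Suc m)) * (ennreal (1 / real (Suc m)) * coord_vol ?I G)"
    using borel_compact[OF E(1)] m le by (simp add: emeasure_sphere_measure mult_left_mono del: of_nat_Suc)
  also have "\<dots> = coord_vol ?I G"
    by (simp add: mult.assoc[symmetric] ennreal_mult[symmetric] del: of_nat_Suc)
  also have "\<dots> \<le> ennreal (unit_ball_vol (real (card ?I)) * (L * d / 2) ^ card ?I)"
    using G L d diamG by (intro isodiametric_coord_vol) auto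
  also have "\<dots> = ennreal (L ^ m * (unit_ball_vol (real m) * (d / 2) ^ m))"
    using m by (simp add: power_mult_distrib power_divide mult_ac)
  finally show ?thesis by (simp add: L_def)
qed

lemma sphere_measure_isometric_involution:
  fixes A :: "'a::euclidean_space set"
  assumes T: "linear T" "\<And>x. T (T x) = x" "\<And>x y. T x \<bullet> T y = x \<bullet> y" and A: "A \<in> sets borel"
  shows "emeasure sphere_measure {x. T x \<in> A} = emeasure sphere_measure A"
proof -
  have nT: "norm (T x) = norm x" for x using T(3)[of x x] by (simp add: norm_eq_sqrt_inner)
  have [measurable]: "T \<in> borel_measurable borel"
    using T(1) by (intro borel_measurable_continuous_onI linear_continuous_on linear_conv_bounded_linear[THEN iffD1])
  have "{x. T x \<in> A} \<in> sets borel" using A by measurable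
  thus ?thesis
    using emeasure_lborel_isometric_involution[OF T(1,2) nT unit_cone_borel[OF A]] A
    by (simp add: emeasure_sphere_measure unit_cone_isometric_involution[OF T(1,3)])
qed

lemma sphere_measure_le:
  fixes E :: "'a::euclidean_space set"
  assumes E: "compact E" "E \<subseteq> sphere 0 1" "E \<noteq> {}"
    and d: "\<And>u w. u \<in> E \<Longrightarrow> w \<in> E \<Longrightarrow> dist u w \<le> d" "0 \<le> d" "d \<le> \<delta>" "\<delta> < 1"
  defines "m \<equiv> DIM('a) - 1"
  shows "emeasure sphere_measure E \<le> ennreal ((sqrt (1 + \<delta>\<^sup>2) / (1 - \<delta>\<^sup>2)) ^ m * (unit_ball_vol (real m) * (d / 2) ^ m))"
proof -
  obtain u where u: "u \<in> E" using E by blast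
  obtain b :: 'a where b: "b \<in> Basis" using nonempty_Basis by blast
  have "norm u = norm b" using u E(2) b by auto
  then obtain T where T: "linear T" "\<And>x. T (T x) = x" "\<And>x y. T x \<bullet> T y = x \<bullet> y" "T u = b"
    by (rule exists_isometric_involution_swap) blast
  have nT: "norm (T x) = norm x" for x using T(3)[of x x] by (simp add: norm_eq_sqrt_inner)
  have dT: "dist (T x) (T y) = dist x y" for x y
    using nT[of "x - y"] by (simp add: dist_norm linear_diff[OF T(1)])
  have e: "{x. T x \<in> E} = T ` E" using T(2) by (auto simp: image_iff) metis
  have "emeasure sphere_measure E = emeasure sphere_measure {x. T x \<in> E}"
    using sphere_measure_isometric_involution[OF T(1-3) borel_compact[OF E(1)]] by simp
  also have "\<dots> \<le> ennreal ((sqrt (1 + \<delta>\<^sup>2) / (1 - \<delta>\<^sup>2)) ^ m * (unit_ball_vol (real m) * (d / 2) ^ m))"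
    unfolding m_def
  proof (rule sphere_measure_le_aux)
    show "compact {x. T x \<in> E}" unfolding e
      using T(1) by (intro compact_continuous_image E linear_continuous_on linear_conv_bounded_linear[THEN iffD1])
    show "{x. T x \<in> E} \<subseteq> sphere 0 1" using E(2) nT by (auto simp: subset_iff)
    show "b \<in> {x. T x \<in> E}" using u T by auto
    fix x w assume "x \<in> {x. T x \<in> E}" "w \<in> {x. T x \<in> E}"
    thus "dist x w \<le> d" using d(1)[of "T x" "T w"] dT by simp
  qed (use b d in auto)
  finally show ?thesis .
qed

text \<open>
The cone over the cap contains the cone of height \<open>1 - r\<^sup>2/2\<close> whose section at height \<open>s\<close> is a ball of radius \<open>s r\<close>: such a
cone stays in the unit ball, and its directions deviate from \<open>b\<close> by a chord of length at most \<open>r\<close>.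
\<close>

lemma sphere_measure_cap_ge_aux:
  fixes b :: "'a::euclidean_space"
  assumes b: "b \<in> Basis" and r: "0 < r" "r \<le> 1"
  defines "m \<equiv> DIM('a) - 1"
  shows "ennreal ((1 - r\<^sup>2 / 2) ^ Suc m * (unit_ball_vol (real m) * r ^ m)) \<le> emeasure sphere_measure (cball b r)"
proof -
  let ?I = "Basis - {b}"
  define c where "c = 1 - r\<^sup>2 / 2"
  have r2: "r\<^sup>2 \<le> 1" "0 < r\<^sup>2" using r by (auto simp: power_le_one)
  have c: "0 < c" "c \<le> 1" using r2 by (auto simp: c_def)
  have cr: "c\<^sup>2 * (1 + r\<^sup>2) \<le> 1"
  proof -
    have "c\<^sup>2 * (1 + r\<^sup>2) = 1 - (r\<^sup>2)\<^sup>2 * (3 / 4 - r\<^sup>2 / 4)"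
      by (simp add: c_def power2_eq_square algebra_simps)
    moreover have "0 \<le> (r\<^sup>2)\<^sup>2 * (3 / 4 - r\<^sup>2 / 4)" using r2 by (intro mult_nonneg_nonneg) auto
    ultimately show ?thesis by linarith
  qed
  have m: "card ?I = m" "DIM('a) = Suc m" using b DIM_positive[where 'a = 'a] by (simp_all add: m_def)
  have nb: "norm b = 1" "b \<bullet> b = 1" using b by auto
  have slice: "(indicator {0<..c} s * ennreal (s ^ m)) * ennreal (unit_ball_vol (real m) * r ^ m) \<le>
       coord_vol ?I {x. x + s *\<^sub>R b \<in> unit_cone (cball b r)}" for s
  proof (cases "s \<in> {0<..c}")
    case True
    have "(indicator {0<..c} s * ennreal (s ^ m)) * ennreal (unit_ball_vol (real m) * r ^ m) = coord_vol ?I (cball 0 (s * r))"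
      using True r m by (subst coord_vol_cball_pos) (auto simp: ennreal_mult[symmetric] power_mult_distrib mult_ac)
    also have "\<dots> \<le> coord_vol ?I {x. x + s *\<^sub>R b \<in> unit_cone (cball b r)}"
    proof (rule coord_vol_mono_span, clarify)
      fix x assume x: "x \<in> span ?I" "x \<in> cball 0 (s * r)"
      define y where "y = x + s *\<^sub>R b"
      have xb: "x \<bullet> b = 0" using b by (intro span_orthogonal_Basis[OF _ _ x(1)]) auto
      have yb: "y \<bullet> b = s" using xb nb by (simp add: y_def inner_add_left)
      have "(norm y)\<^sup>2 = (norm x)\<^sup>2 + s\<^sup>2"
        unfolding y_def power2_norm_eq_inner using xb nb
        by (simp add: inner_add_left inner_add_right inner_commute power2_eq_square)
      moreover have "(norm x)\<^sup>2 \<le> (s * r)\<^sup>2" using x by (intro power_mono) auto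
      ultimately have ny2: "(norm y)\<^sup>2 \<le> s\<^sup>2 * (1 + r\<^sup>2)" by (simp add: power_mult_distrib algebra_simps)
      have key: "(c * norm y)\<^sup>2 \<le> s\<^sup>2"
      proof -
        have "(c * norm y)\<^sup>2 \<le> c\<^sup>2 * (s\<^sup>2 * (1 + r\<^sup>2))"
          using ny2 by (simp add: power_mult_distrib mult_left_mono)
        also have "\<dots> = s\<^sup>2 * (c\<^sup>2 * (1 + r\<^sup>2))" by simp
        also have "\<dots> \<le> s\<^sup>2 * 1" using cr by (intro mult_left_mono) auto
        finally show ?thesis by simp
      qed
      hence cy: "c * norm y \<le> s" by (rule power2_le_imp_le) (use True in auto)
      also have "s \<le> c * 1" using True by auto
      finally have y1: "norm y \<le> 1" using c(1) by (rule mult_left_le_imp_le)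
      have y0: "norm y > 0" using yb True by auto
      have "(dist b (sgn y))\<^sup>2 = 1 - 2 * (s / norm y) + 1"
      proof -
        have "norm (sgn y) = 1" using y0 by (simp add: norm_sgn)
        hence "sgn y \<bullet> sgn y = 1" by (simp add: norm_eq_1)
        moreover have "b \<bullet> sgn y = s / norm y"
          using yb by (simp add: sgn_div_norm inner_commute divide_inverse mult.commute)
        ultimately show ?thesis
          unfolding dist_norm power2_norm_eq_inner using nb
          by (simp add: inner_diff_left inner_diff_right inner_commute)
      qed
      also have "s / norm y \<ge> c" using cy y0 by (simp add: field_simps)
      hence "1 - 2 * (s / norm y) + 1 \<le> r\<^sup>2" by (simp add: c_def)
      finally have "dist b (sgn y) \<le> r" by (rule power2_le_imp_le) (use r in auto)
      thus "x + s *\<^sub>R b \<in> unit_cone (cball b r)" using y1 by (simp add: unit_cone_def y_def)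
    qed
    finally show ?thesis .
  qed auto
  have "ennreal (c ^ Suc m / real (Suc m)) * ennreal (unit_ball_vol (real m) * r ^ m) =
      (\<integral>\<^sup>+ s. (indicator {0<..c} s * ennreal (s ^ m)) * ennreal (unit_ball_vol (real m) * r ^ m) \<partial>lborel)"
    using c by (subst nn_integral_multc) (auto simp: nn_integral_monomial)
  also have "\<dots> \<le> (\<integral>\<^sup>+ s. coord_vol ?I {x. x + s *\<^sub>R b \<in> unit_cone (cball b r)} \<partial>lborel)"
    by (intro nn_integral_mono slice)
  also have "\<dots> = emeasure lborel (unit_cone (cball b r))"
    using b by (intro emeasure_lborel_slices[symmetric]) auto
  finally have "ennreal (real (Suc m)) * (ennreal (c ^ Suc m / real (Suc m)) * ennreal (unit_ball_vol (real m) * r ^ m)) \<le>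
      emeasure sphere_measure (cball b r)"
    using m by (simp add: emeasure_sphere_measure mult_left_mono del: of_nat_Suc)
  also have "ennreal (real (Suc m)) * (ennreal (c ^ Suc m / real (Suc m)) * ennreal (unit_ball_vol (real m) * r ^ m)) =
      ennreal (c ^ Suc m * (unit_ball_vol (real m) * r ^ m))"
    using c r by (simp add: mult.assoc[symmetric] ennreal_mult[symmetric] del: of_nat_Suc power_Suc)
  finally show ?thesis by (simp add: c_def)
qed

lemma sphere_measure_cap_ge:
  fixes a :: "'a::euclidean_space"
  assumes a: "norm a = 1" and r: "0 < r" "r \<le> 1"
  defines "m \<equiv> DIM('a) - 1"
  shows "ennreal ((1 - r\<^sup>2 / 2) ^ Suc m * (unit_ball_vol (real m) * r ^ m)) \<le> emeasure sphere_measure (cball a r)"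
proof -
  obtain b :: 'a where b: "b \<in> Basis" using nonempty_Basis by blast
  have "norm a = norm b" using a b by auto
  then obtain T where T: "linear T" "\<And>x. T (T x) = x" "\<And>x y. T x \<bullet> T y = x \<bullet> y" "T a = b"
    by (rule exists_isometric_involution_swap) blast
  have nT: "norm (T x) = norm x" for x using T(3)[of x x] by (simp add: norm_eq_sqrt_inner)
  have dT: "dist (T x) (T y) = dist x y" for x y
    using nT[of "x - y"] by (simp add: dist_norm linear_diff[OF T(1)])
  have "{x. T x \<in> cball b r} = cball a r" using dT T(4) by (auto simp: mem_cball)
  thus ?thesis
    using sphere_measure_cap_ge_aux[OF b r] sphere_measure_isometric_involution[OF T(1-3), of "cball b r"]
    by (simp add: m_def)
qed

section \<open>Hausdorff measure of the unit sphere\<close>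

text \<open>
Any cover may be replaced by the traces of its closures on the sphere, to which \<open>sphere_measure_le\<close> applies.
\<close>

lemma sphere_measure_le_hausdorff_pre_measure:
  fixes A :: "'a::euclidean_space set"
  assumes A: "A \<in> sets borel" "A \<subseteq> sphere 0 1" and d: "0 < \<delta>" "\<delta> < 1"
  defines "m \<equiv> DIM('a) - 1"
  shows "emeasure sphere_measure A \<le> ennreal ((sqrt (1 + \<delta>\<^sup>2) / (1 - \<delta>\<^sup>2)) ^ m) * hausdorff_pre_measure m \<delta> A"
proof -
  \<comment> \<open>The distortion of \<open>m\<close>-dimensional volume by the central projection tends to one with \<open>\<delta>\<close>.\<close>
  define L where "L = (sqrt (1 + \<delta>\<^sup>2) / (1 - \<delta>\<^sup>2)) ^ m"
  have d2: "\<delta>\<^sup>2 < 1" using d by (simp add: abs_square_less_1)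
  have L: "L > 0" using d2 by (simp add: L_def add_pos_nonneg)
  have "ennreal (1 / L) * emeasure sphere_measure A \<le> hausdorff_pre_measure m \<delta> A"
    unfolding hausdorff_pre_measure_def
  proof (intro INF_greatest, clarify)
    fix C :: "nat \<Rightarrow> 'a set" assume C: "A \<subseteq> \<Union> (range C)" "\<forall>i. bounded (C i) \<and> diameter (C i) \<le> \<delta>"
    define E where "E i = closure (C i) \<inter> sphere 0 1" for i
    have cE: "compact (E i)" for i
      unfolding E_def using C(2) by (intro closed_Int_compact) auto
    have le: "ennreal (1 / L) * emeasure sphere_measure (E i) \<le> hausdorff_content m (C i)" for i
    proof (cases "E i = {}")
      case False
      hence ne: "C i \<noteq> {}" by (auto simp: E_def)
      have b: "bounded (closure (C i))" using C(2) by auto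
      have "emeasure sphere_measure (E i) \<le> ennreal ((sqrt (1 + \<delta>\<^sup>2) / (1 - \<delta>\<^sup>2)) ^ m *
          (unit_ball_vol (real m) * (diameter (C i) / 2) ^ m))"
        unfolding m_def
      proof (rule sphere_measure_le)
        fix u w assume "u \<in> E i" "w \<in> E i"
        thus "dist u w \<le> diameter (C i)"
          using diameter_bounded_bound[OF b, of u w] C(2) by (simp add: E_def diameter_closure)
      qed (use cE False C(2) d diameter_ge_0 in \<open>auto simp: E_def\<close>)
      also have "\<dots> = ennreal L * hausdorff_content m (C i)"
        using ne L by (simp add: L_def hausdorff_content_def ennreal_mult')
      finally have "ennreal (1 / L) * emeasure sphere_measure (E i) \<le> ennreal (1 / L) * (ennreal L * hausdorff_content m (C i))"
        by (intro mult_left_mono) auto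
      thus ?thesis using L by (simp add: mult.assoc[symmetric] ennreal_mult[symmetric])
    qed simp
    have "A \<subseteq> (\<Union>i. E i)"
    proof
      fix t assume t: "t \<in> A"
      then obtain i where "t \<in> C i" using C(1) by blast
      hence "t \<in> E i" using t A(2) closure_subset[of "C i"] by (auto simp: E_def)
      thus "t \<in> (\<Union>i. E i)" by blast
    qed
    hence "emeasure sphere_measure A \<le> emeasure sphere_measure (\<Union>i. E i)"
      using cE borel_compact by (intro emeasure_mono) auto
    also have "\<dots> \<le> (\<Sum>i. emeasure sphere_measure (E i))"
      using cE borel_compact by (intro emeasure_subadditive_countably) auto
    finally have "ennreal (1 / L) * emeasure sphere_measure A \<le> ennreal (1 / L) * (\<Sum>i. emeasure sphere_measure (E i))"
      by (intro mult_left_mono) auto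
    also have "\<dots> = (\<Sum>i. ennreal (1 / L) * emeasure sphere_measure (E i))"
      by simp
    also have "\<dots> \<le> (\<Sum>i. hausdorff_content m (C i))"
      by (intro suminf_le le) auto
    finally show "ennreal (1 / L) * emeasure sphere_measure A \<le> (\<Sum>i. hausdorff_content m (C i))" .
  qed
  hence "ennreal L * (ennreal (1 / L) * emeasure sphere_measure A) \<le> ennreal L * hausdorff_pre_measure m \<delta> A"
    by (intro mult_left_mono) auto
  thus ?thesis using L by (simp add: mult.assoc[symmetric] ennreal_mult[symmetric] L_def[symmetric])
qed

lemma sphere_measure_le_hausdorff:
  fixes A :: "'a::euclidean_space set"
  assumes A: "A \<in> sets borel" "A \<subseteq> sphere 0 1"
  shows "emeasure sphere_measure A \<le> hausdorff_outer_measure (DIM('a) - 1) A"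
proof (cases "hausdorff_outer_measure (DIM('a) - 1) A = top")
  case False
  let ?m = "DIM('a) - 1" let ?H = "hausdorff_outer_measure (DIM('a) - 1) A"
  define L where "L \<delta> = (sqrt (1 + \<delta>\<^sup>2) / (1 - \<delta>\<^sup>2)) ^ ?m" for \<delta> :: real
  have "(L \<longlongrightarrow> L 0) (at_right 0)"
    unfolding L_def[abs_def] by (intro tendsto_intros) auto
  hence "((\<lambda>\<delta>. ?H * ennreal (L \<delta>)) \<longlongrightarrow> ?H * ennreal (L 0)) (at_right 0)"
    using False by (intro ennreal_tendsto_cmult tendsto_ennrealI) (auto simp: less_top)
  hence "((\<lambda>\<delta>. ennreal (L \<delta>) * ?H) \<longlongrightarrow> ennreal (L 0) * ?H) (at_right 0)"
    by (simp only: mult.commute)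
  moreover have "\<forall>\<^sub>F \<delta> in at_right 0. emeasure sphere_measure A \<le> ennreal (L \<delta>) * ?H"
  proof -
    have "\<forall>\<^sub>F \<delta> in at_right (0::real). \<delta> \<in> {0<..<1}"
      by (rule eventually_at_right_real) simp
    thus ?thesis
    proof eventually_elim
      case (elim \<delta>)
      have "emeasure sphere_measure A \<le> ennreal (L \<delta>) * hausdorff_pre_measure ?m \<delta> A"
        unfolding L_def using elim by (intro sphere_measure_le_hausdorff_pre_measure A) auto
      also have "\<dots> \<le> ennreal (L \<delta>) * ?H"
        using elim by (intro mult_left_mono hausdorff_pre_le_outer) auto
      finally show ?case .
    qed
  qed
  ultimately have "emeasure sphere_measure A \<le> ennreal (L 0) * ?H"
    by (rule tendsto_lowerbound) simp
  thus ?thesis by (simp add: L_def)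
qed simp

lemma vitali_sphere:
  fixes U :: "'a::euclidean_space set"
  assumes U: "open U" and d: "0 < \<delta>"
  shows "\<exists>(J :: nat set) (a :: nat \<Rightarrow> 'a) r.
    (\<forall>k\<in>J. norm (a k) = 1 \<and> 0 < r k \<and> r k \<le> \<delta> \<and> cball (a k) (r k) \<subseteq> U) \<and>
    disjoint_family_on (\<lambda>k. cball (a k) (r k)) J \<and>
    U \<inter> sphere 0 1 \<subseteq> (\<Union>k\<in>J. cball (a k) (5 * r k))"
proof -
  define K where "K = {(a, r). norm a = 1 \<and> 0 < r \<and> r \<le> \<delta> \<and> cball a r \<subseteq> U}"
  have "U \<inter> sphere 0 1 \<subseteq> (\<Union>i\<in>K. cball (fst i) (snd i))"
  proof
    fix x assume x: "x \<in> U \<inter> sphere 0 1"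
    then obtain e where e: "e > 0" "cball x e \<subseteq> U" using U open_contains_cball by blast
    have "cball x (min e \<delta>) \<subseteq> U" using e by auto
    hence "(x, min e \<delta>) \<in> K" using x e d by (auto simp: K_def)
    moreover have "x \<in> cball (fst (x, min e \<delta>)) (snd (x, min e \<delta>))" using e d by simp
    ultimately show "x \<in> (\<Union>i\<in>K. cball (fst i) (snd i))" by blast
  qed
  moreover have "0 < snd i \<and> snd i \<le> \<delta>" if "i \<in> K" for i using that by (auto simp: K_def)
  ultimately obtain C where C: "countable C" "C \<subseteq> K"
     "pairwise (\<lambda>i j. disjnt (cball (fst i) (snd i)) (cball (fst j) (snd j))) C"
     "U \<inter> sphere 0 1 \<subseteq> (\<Union>i\<in>C. cball (fst i) (5 * snd i))"
    by (rule Vitali_covering_lemma_cballs)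
  define J where "J = to_nat_on C ` C"
  define g where "g = from_nat_into C"
  have gC: "g k \<in> C" if "k \<in> J" for k
    using that C(1) by (auto simp: J_def g_def from_nat_into_to_nat_on)
  have gi: "g k = g l \<Longrightarrow> k = l" if "k \<in> J" "l \<in> J" for k l
    using that C(1) by (auto simp: J_def g_def)
  have gs: "C \<subseteq> g ` J" using C(1) by (force simp: J_def g_def)
  show ?thesis
  proof (intro exI[of _ J] exI[of _ "\<lambda>k. fst (g k)"] exI[of _ "\<lambda>k. snd (g k)"] conjI ballI)
    fix k assume "k \<in> J"
    hence "(fst (g k), snd (g k)) \<in> K" using gC C(2) by auto
    thus "norm (fst (g k)) = 1" "0 < snd (g k)" "snd (g k) \<le> \<delta>" "cball (fst (g k)) (snd (g k)) \<subseteq> U"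
      unfolding K_def mem_Collect_eq case_prod_conv by blast+
  next
    show "disjoint_family_on (\<lambda>k. cball (fst (g k)) (snd (g k))) J"
      unfolding disjoint_family_on_def
    proof (intro ballI impI)
      fix k l assume "k \<in> J" "l \<in> J" "k \<noteq> l"
      thus "cball (fst (g k)) (snd (g k)) \<inter> cball (fst (g l)) (snd (g l)) = {}"
        using C(3) gC[of k] gC[of l] gi[of k l] unfolding pairwise_def disjnt_def by metis
    qed
    show "U \<inter> sphere 0 1 \<subseteq> (\<Union>k\<in>J. cball (fst (g k)) (5 * snd (g k)))"
    proof
      fix x assume "x \<in> U \<inter> sphere 0 1"
      then obtain i where "i \<in> C" "x \<in> cball (fst i) (5 * snd i)" using C(4) by blast
      moreover from this(1) obtain k where "k \<in> J" "i = g k" using gs by blast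
      ultimately show "x \<in> (\<Union>k\<in>J. cball (fst (g k)) (5 * snd (g k)))" by blast
    qed
  qed
qed

lemma hausdorff_content_cball:
  fixes a :: "'a::euclidean_space"
  assumes "0 \<le> r"
  shows "hausdorff_content m (cball a r) = ennreal (unit_ball_vol (real m) * r ^ m)"
  using assms by (simp add: hausdorff_content_def diameter_cball)

text \<open>
Disjoint small caps inside \<open>U\<close> whose fivefold enlargements cover: each has almost the largest cone measure
that its diameter permits, and together they carry a fixed fraction of the Hausdorff content of \<open>U\<close>.
\<close>

lemma sphere_vitali_round:
  fixes U :: "'a::euclidean_space set"
  defines "m \<equiv> DIM('a) - 1"
  assumes U: "open U" and d: "0 < \<delta>" "\<delta> \<le> 1"
  defines "\<theta> \<equiv> (1 - \<delta>\<^sup>2 / 2) ^ Suc m"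
  shows "\<exists>(J :: nat set) (a :: nat \<Rightarrow> 'a) r.
    (\<forall>k\<in>J. cball (a k) (r k) \<subseteq> U \<and> 0 < r k \<and> r k \<le> \<delta> \<and>
       ennreal \<theta> * hausdorff_content m (cball (a k) (r k)) \<le> emeasure sphere_measure (cball (a k) (r k))) \<and>
    disjoint_family_on (\<lambda>k. cball (a k) (r k)) J \<and>
    ennreal (\<theta> / 5 ^ m) * hausdorff_pre_measure m (10 * \<delta>) (U \<inter> sphere 0 1) \<le>
       emeasure sphere_measure (\<Union>k\<in>J. cball (a k) (r k))"
proof -
  obtain J :: "nat set" and a :: "nat \<Rightarrow> 'a" and r where
    J0: "\<forall>k\<in>J. norm (a k) = 1 \<and> 0 < r k \<and> r k \<le> \<delta> \<and> cball (a k) (r k) \<subseteq> U"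
    and J2: "disjoint_family_on (\<lambda>k. cball (a k) (r k)) J"
    and J3: "U \<inter> sphere 0 1 \<subseteq> (\<Union>k\<in>J. cball (a k) (5 * r k))"
    using vitali_sphere[OF U d(1)] by (elim exE conjE) blast
  note J = bspec[OF J0] J2 J3
  have d2: "\<delta>\<^sup>2 \<le> 1" using d by (simp add: power_le_one)
  have \<theta>: "0 \<le> \<theta>" using d2 by (simp add: \<theta>_def)
  have cap: "ennreal \<theta> * hausdorff_content m (cball (a k) (r k)) \<le> emeasure sphere_measure (cball (a k) (r k))"
    if k: "k \<in> J" for k
  proof -
    have r2: "(r k)\<^sup>2 \<le> \<delta>\<^sup>2" using J(1)[OF k] by (intro power_mono) auto
    have "\<theta> \<le> (1 - (r k)\<^sup>2 / 2) ^ Suc m"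
      unfolding \<theta>_def using r2 d2 by (intro power_mono) auto
    hence "ennreal (\<theta> * (unit_ball_vol (real m) * r k ^ m)) \<le> ennreal ((1 - (r k)\<^sup>2 / 2) ^ Suc m * (unit_ball_vol (real m) * r k ^ m))"
      using J(1)[OF k] by (intro ennreal_leI mult_right_mono) auto
    also have "\<dots> \<le> emeasure sphere_measure (cball (a k) (r k))"
      unfolding m_def using J(1)[OF k] d by (intro sphere_measure_cap_ge) auto
    finally show ?thesis
      using J(1)[OF k] \<theta> by (simp add: hausdorff_content_cball ennreal_mult')
  qed
  \<comment> \<open>Empty sets fill up the index set to all naturals.\<close>
  define X where "X k = (if k \<in> J then cball (a k) (r k) else {})" for k
  define Y where "Y k = (if k \<in> J then cball (a k) (5 * r k) else {})" for k
  have "ennreal (\<theta> / 5 ^ m) * hausdorff_pre_measure m (10 * \<delta>) (U \<inter> sphere 0 1) \<le>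
      ennreal (\<theta> / 5 ^ m) * (\<Sum>k. hausdorff_content m (Y k))"
  proof (intro mult_left_mono hausdorff_pre_measure_le_cover)
    show "U \<inter> sphere 0 1 \<subseteq> (\<Union>k. Y k)" using J(3) by (force simp: Y_def)
    show "diameter (Y k) \<le> 10 * \<delta>" for k using J(1)[of k] d by (auto simp: Y_def diameter_cball)
  qed (auto simp: Y_def)
  also have "\<dots> = (\<Sum>k. ennreal (\<theta> / 5 ^ m) * hausdorff_content m (Y k))" by simp
  also have "\<dots> \<le> (\<Sum>k. emeasure sphere_measure (X k))"
  proof (intro suminf_le allI)
    fix k
    show "ennreal (\<theta> / 5 ^ m) * hausdorff_content m (Y k) \<le> emeasure sphere_measure (X k)"
    proof (cases "k \<in> J")
      case True
      have "ennreal (\<theta> / 5 ^ m) * hausdorff_content m (Y k) = ennreal \<theta> * hausdorff_content m (X k)"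
        using True J(1)[OF True] \<theta>
        by (simp add: X_def Y_def hausdorff_content_cball ennreal_mult'[symmetric] power_mult_distrib)
      thus ?thesis using cap[OF True] True by (simp add: X_def)
    qed (simp add: Y_def hausdorff_content_def)
  qed auto
  also have "\<dots> = emeasure sphere_measure (\<Union>k. X k)"
  proof (rule suminf_emeasure)
    show "disjoint_family X" using J(2) by (auto simp: disjoint_family_on_def X_def)
  qed (auto simp: X_def)
  also have "(\<Union>k. X k) = (\<Union>k\<in>J. cball (a k) (r k))" by (auto simp: X_def split: if_splits)
  finally have whole: "ennreal (\<theta> / 5 ^ m) * hausdorff_pre_measure m (10 * \<delta>) (U \<inter> sphere 0 1) \<le>
       emeasure sphere_measure (\<Union>k\<in>J. cball (a k) (r k))" .
  show ?thesis
    by (intro exI[of _ J] exI[of _ a] exI[of _ r] conjI ballI J(2) cap whole) (use J(1) in blast)+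
qed

text \<open>
The type argument fixes the space, which no other argument mentions.
\<close>

definition sphere_open_bound :: "'a::euclidean_space itself \<Rightarrow> real \<Rightarrow> bool" where
  "sphere_open_bound _ c \<longleftrightarrow> (\<forall>U :: 'a set. open U \<longrightarrow>
     hausdorff_outer_measure (DIM('a) - 1) (U \<inter> sphere 0 1) \<le> ennreal c * emeasure sphere_measure U)"

text \<open>
The enlarged caps of one Vitali round form a cover of \<open>U\<close> by sets whose total content is at most a constant times the cone
measure of the disjoint caps.
\<close>

lemma sphere_open_bound_crude:
  "\<exists>D\<ge>1. sphere_open_bound TYPE('a::euclidean_space) D"
proof -
  define m where "m = DIM('a) - 1"
  define D where "D = (5 ^ m * 2 ^ Suc m :: real)"
  have D: "D \<ge> (1::real)" 
  proof -
    have "1 * 1 \<le> (5 ^ m * 2 ^ Suc m :: real)"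
      by (intro mult_mono one_le_power) auto
    thus ?thesis by (simp add: D_def)
  qed
  have "hausdorff_outer_measure m (U \<inter> sphere 0 1) \<le> ennreal D * emeasure sphere_measure U"
    if U: "open U" for U :: "'a set"
  proof (rule hausdorff_outer_leI[of 1])
    fix d :: real assume d: "0 < d" "d < 1"
    define \<delta> where "\<delta> = d / 10"
    have \<delta>: "0 < \<delta>" "\<delta> \<le> 1" using d by (auto simp: \<delta>_def)
    obtain J :: "nat set" and a :: "nat \<Rightarrow> 'a" and r where
      J: "\<forall>k\<in>J. cball (a k) (r k) \<subseteq> U"
      and le: "ennreal ((1 - \<delta>\<^sup>2 / 2) ^ Suc m / 5 ^ m) * hausdorff_pre_measure m (10 * \<delta>) (U \<inter> sphere 0 1) \<le>
         emeasure sphere_measure (\<Union>k\<in>J. cball (a k) (r k))"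
      using sphere_vitali_round[OF U \<delta>, folded m_def] by (elim exE conjE) blast
    have "\<delta>\<^sup>2 \<le> 1" using \<delta> by (simp add: power_le_one)
    hence "(1 / 2) ^ Suc m \<le> (1 - \<delta>\<^sup>2 / 2) ^ Suc m" by (intro power_mono) auto
    hence "1 / D \<le> (1 - \<delta>\<^sup>2 / 2) ^ Suc m / 5 ^ m"
      unfolding D_def by (simp add: field_simps power_divide)
    hence "ennreal (1 / D) * hausdorff_pre_measure m d (U \<inter> sphere 0 1) \<le>
        ennreal ((1 - \<delta>\<^sup>2 / 2) ^ Suc m / 5 ^ m) * hausdorff_pre_measure m (10 * \<delta>) (U \<inter> sphere 0 1)"
      by (intro mult_mono ennreal_leI) (auto simp: \<delta>_def)
    also note le
    also have "emeasure sphere_measure (\<Union>k\<in>J. cball (a k) (r k)) \<le> emeasure sphere_measure U"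
      using J U by (intro emeasure_mono) auto
    finally have "ennreal D * (ennreal (1 / D) * hausdorff_pre_measure m d (U \<inter> sphere 0 1)) \<le> ennreal D * emeasure sphere_measure U"
      by (intro mult_left_mono) auto
    thus "hausdorff_pre_measure m d (U \<inter> sphere 0 1) \<le> ennreal D * emeasure sphere_measure U"
      using D by (simp add: mult.assoc[symmetric] ennreal_mult[symmetric])
  qed simp
  thus ?thesis using D by (auto simp: sphere_open_bound_def m_def)
qed

text \<open>
The right-hand side is what \<open>sphere_vitali_round\<close> guarantees for the cone measure of the disjoint caps.  It is at
least a fixed fraction of the cone measure of \<open>U\<close>, because cone measure is bounded by Hausdorff content.
\<close>

lemma sphere_open_bound_fraction:
  obtains \<kappa> :: real where "0 < \<kappa>" "\<kappa> < 1"
    "\<And>(U :: 'a::euclidean_space set) \<delta>. open U \<Longrightarrow> 0 < \<delta> \<Longrightarrow> \<delta> \<le> 1 / 20 \<Longrightarrow>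
       ennreal (2 * \<kappa>) * emeasure sphere_measure U \<le>
       ennreal ((1 - \<delta>\<^sup>2 / 2) ^ DIM('a) / 5 ^ (DIM('a) - 1)) * hausdorff_pre_measure (DIM('a) - 1) (10 * \<delta>) (U \<inter> sphere 0 1)"
proof -
  define m where "m = DIM('a) - 1"
  have Sm: "DIM('a) = Suc m" using DIM_positive[where 'a = 'a] by (simp add: m_def)
  define L :: real where "L = (sqrt (1 + (1 / 2)\<^sup>2) / (1 - (1 / 2)\<^sup>2)) ^ m"
  have sq1: "1 \<le> sqrt (1 + (1 / 2)\<^sup>2)" by simp
  have L: "L \<ge> 1" unfolding L_def
  proof (intro one_le_power)
    have "1 - (1 / 2)\<^sup>2 = (3 / 4 :: real)" by (simp add: power2_eq_square)
    moreover have "1 \<le> x / (3 / 4)" if "1 \<le> x" for x :: real using that by simp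
    note this[OF sq1]
    ultimately show "1 \<le> sqrt (1 + (1 / 2)\<^sup>2) / (1 - (1 / 2)\<^sup>2)" by (simp only:)
  qed
  define \<theta> :: real where "\<theta> = (1 - (1 / 20)\<^sup>2 / 2) ^ Suc m"
  have \<theta>: "0 < \<theta>" "\<theta> \<le> 1" unfolding \<theta>_def by (auto intro!: zero_less_power power_le_one simp: power2_eq_square simp del: power_Suc)
  define \<kappa> where "\<kappa> = \<theta> / 5 ^ m / L / 2"
  have kappa0: "0 < \<kappa>" using \<theta> L by (simp add: \<kappa>_def)
  have "\<theta> / 5 ^ m / L \<le> 1"
  proof -
    have "1 * 1 \<le> 5 ^ m * L" by (intro mult_mono one_le_power L) auto
    hence "\<theta> \<le> 5 ^ m * L" using \<theta> by linarith
    thus ?thesis using L by (simp add: divide_le_eq_1 field_simps)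
  qed
  moreover have "x / 2 < 1" if "x \<le> 1" for x :: real using that by simp
  ultimately have kappa1: "\<kappa> < 1" unfolding \<kappa>_def by blast
  have "ennreal (2 * \<kappa>) * emeasure sphere_measure U \<le>
       ennreal ((1 - \<delta>\<^sup>2 / 2) ^ Suc m / 5 ^ m) * hausdorff_pre_measure m (10 * \<delta>) (U \<inter> sphere 0 1)"
    if U: "open U" and d: "0 < \<delta>" "\<delta> \<le> 1 / 20" for U :: "'a set" and \<delta>
  proof -
    have "emeasure sphere_measure U = emeasure sphere_measure (U \<inter> sphere 0 1)"
      using U by (intro emeasure_sphere_measure_Int_sphere[symmetric]) auto
    also have "\<dots> \<le> ennreal L * hausdorff_pre_measure m (1 / 2) (U \<inter> sphere 0 1)"
      unfolding L_def m_def using U by (intro sphere_measure_le_hausdorff_pre_measure) auto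
    also have "\<dots> \<le> ennreal L * hausdorff_pre_measure m (10 * \<delta>) (U \<inter> sphere 0 1)"
      using d by (intro mult_left_mono hausdorff_pre_measure_antimono) auto
    finally have "ennreal (2 * \<kappa>) * emeasure sphere_measure U \<le>
        ennreal (2 * \<kappa>) * (ennreal L * hausdorff_pre_measure m (10 * \<delta>) (U \<inter> sphere 0 1))"
      by (intro mult_left_mono) auto
    also have "\<dots> = ennreal (\<theta> / 5 ^ m) * hausdorff_pre_measure m (10 * \<delta>) (U \<inter> sphere 0 1)"
      using L kappa0 by (simp add: mult.assoc[symmetric] ennreal_mult[symmetric]) (simp add: \<kappa>_def)
    also have "\<dots> \<le> ennreal ((1 - \<delta>\<^sup>2 / 2) ^ Suc m / 5 ^ m) * hausdorff_pre_measure m (10 * \<delta>) (U \<inter> sphere 0 1)"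
    proof (intro mult_right_mono ennreal_leI divide_right_mono)
      have "\<delta>\<^sup>2 \<le> (1 / 20)\<^sup>2" using d by (intro power_mono) auto
      thus "\<theta> \<le> (1 - \<delta>\<^sup>2 / 2) ^ Suc m" unfolding \<theta>_def by (intro power_mono) (auto simp: power2_eq_square)
    qed auto
    finally show ?thesis .
  qed
  thus ?thesis using that[of \<kappa>] kappa0 kappa1 by (simp add: Sm)
qed

text \<open>
Finitely many disjoint caps fill a fraction \<open>\<kappa>\<close> of \<open>U\<close>.  On them the content exceeds the cone measure by a factor close to
one only, and the rest of \<open>U\<close> is open, so the old constant \<open>c\<close> is needed on a fraction \<open>1 - \<kappa>\<close> of \<open>U\<close> only.
\<close>

lemma sphere_open_bound_improve:
  fixes \<kappa> :: real
  assumes \<kappa>: "0 < \<kappa>" "\<kappa> < 1"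
    and fr: "\<And>(U :: 'a::euclidean_space set) \<delta>. open U \<Longrightarrow> 0 < \<delta> \<Longrightarrow> \<delta> \<le> 1 / 20 \<Longrightarrow>
       ennreal (2 * \<kappa>) * emeasure sphere_measure U \<le>
       ennreal ((1 - \<delta>\<^sup>2 / 2) ^ DIM('a) / 5 ^ (DIM('a) - 1)) * hausdorff_pre_measure (DIM('a) - 1) (10 * \<delta>) (U \<inter> sphere 0 1)"
    and c: "1 \<le> c" and bound: "sphere_open_bound TYPE('a) c"
  shows "sphere_open_bound TYPE('a) (1 + (c - 1) * (1 - \<kappa>))"
  unfolding sphere_open_bound_def
proof (intro allI impI)
  fix U :: "'a set" assume U: "open U"
  define m where "m = DIM('a) - 1"
  have Sm: "DIM('a) = Suc m" using DIM_positive[where 'a = 'a] by (simp add: m_def)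
  let ?\<sigma> = "emeasure (sphere_measure :: 'a measure)"
  define s where "s = enn2real (?\<sigma> U)"
  have s: "?\<sigma> U = ennreal s" "s \<ge> 0" using emeasure_sphere_measure_finite[of U] by (simp_all add: s_def)
  define c' where "c' = 1 + (c - 1) * (1 - \<kappa>)"
  define \<theta> where "\<theta> \<delta> = (1 - \<delta>\<^sup>2 / 2) ^ Suc m" for \<delta> :: real
  have "hausdorff_outer_measure m (U \<inter> sphere 0 1) \<le> ennreal (c' * s)"
  proof (cases "s = 0")
    case True
    thus ?thesis using bound U s by (auto simp: sphere_open_bound_def m_def)
  next
    case False
    hence spos: "s > 0" using s by simp
    have pre: "hausdorff_pre_measure m (2 * \<delta>) (U \<inter> sphere 0 1) \<le> ennreal ((c' + (1 / \<theta> \<delta> - 1)) * s)"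
      if d: "0 < \<delta>" "\<delta> \<le> 1 / 20" for \<delta>
    proof -
      have \<delta>: "0 < \<delta>" "\<delta> \<le> 1" using d by auto
      have "\<delta>\<^sup>2 \<le> 1" using \<delta> by (simp add: power_le_one)
      hence \<theta>: "0 < \<theta> \<delta>" "\<theta> \<delta> \<le> 1" by (auto simp: \<theta>_def intro!: power_le_one simp del: power_Suc)
      obtain J :: "nat set" and a :: "nat \<Rightarrow> 'a" and r where
        J: "\<forall>k\<in>J. cball (a k) (r k) \<subseteq> U \<and> 0 < r k \<and> r k \<le> \<delta> \<and>
            ennreal (\<theta> \<delta>) * hausdorff_content m (cball (a k) (r k)) \<le> ?\<sigma> (cball (a k) (r k))"
        and dis: "disjoint_family_on (\<lambda>k. cball (a k) (r k)) J"
        and le: "ennreal (\<theta> \<delta> / 5 ^ m) * hausdorff_pre_measure m (10 * \<delta>) (U \<inter> sphere 0 1) \<le>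
           ?\<sigma> (\<Union>k\<in>J. cball (a k) (r k))"
        using sphere_vitali_round[OF U \<delta>, folded m_def] unfolding \<theta>_def by (elim exE conjE) blast
      \<comment> \<open>Only finitely many caps are removed, so that what remains of \<open>U\<close> is open.\<close>
      define V where "V N = (\<Union>k\<in>{k\<in>J. k < N}. cball (a k) (r k))" for N :: nat
      have cV: "closed (V N)" for N unfolding V_def by (intro closed_UN) auto
      have VU: "V N \<subseteq> U" for N using J by (auto simp: V_def)
      have fr2: "ennreal (2 * \<kappa>) * ?\<sigma> U \<le>
          ennreal (\<theta> \<delta> / 5 ^ m) * hausdorff_pre_measure m (10 * \<delta>) (U \<inter> sphere 0 1)"
        using fr[OF U d] by (simp only: \<theta>_def Sm diff_Suc_1)
      have "ennreal (\<kappa> * s) < ennreal (2 * \<kappa>) * ?\<sigma> U"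
        using \<kappa> spos by (simp add: s ennreal_mult[symmetric] ennreal_less_iff)
      also have "\<dots> \<le> ?\<sigma> (\<Union>k\<in>J. cball (a k) (r k))"
        by (rule order_trans[OF fr2 le])
      also have "(\<Union>k\<in>J. cball (a k) (r k)) = (\<Union>N. V N)"
        unfolding V_def by (auto intro: lessI)
      also have "?\<sigma> (\<Union>N. V N) = (SUP N. ?\<sigma> (V N))"
        using cV by (intro SUP_emeasure_incseq[symmetric]) (auto simp: V_def incseq_def)
      finally obtain N where N: "ennreal (\<kappa> * s) < ?\<sigma> (V N)" by (auto simp: less_SUP_iff)
      define q where "q = enn2real (?\<sigma> (V N))"
      have q: "?\<sigma> (V N) = ennreal q" "q \<ge> 0" using emeasure_sphere_measure_finite[of "V N"] by (simp_all add: q_def)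
      have ql: "\<kappa> * s \<le> q" using N q by (simp add: ennreal_less_iff[OF mult_nonneg_nonneg] \<kappa> s less_imp_le)
      have "?\<sigma> (V N) \<le> ?\<sigma> U" using VU U by (intro emeasure_mono) auto
      hence qs: "q \<le> s" using q s by simp
      have rest: "?\<sigma> (U - V N) = ennreal (s - q)"
        using VU U cV q s emeasure_sphere_measure_finite[of "V N"]
        by (subst emeasure_Diff) (auto simp: ennreal_minus)
      have fin: "finite {k\<in>J. k < N}" by simp
      have "ennreal (\<theta> \<delta>) * (\<Sum>k\<in>{k\<in>J. k < N}. hausdorff_content m (cball (a k) (r k))) =
          (\<Sum>k\<in>{k\<in>J. k < N}. ennreal (\<theta> \<delta>) * hausdorff_content m (cball (a k) (r k)))"
        by (rule sum_distrib_left)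
      also have "\<dots> \<le> (\<Sum>k\<in>{k\<in>J. k < N}. ?\<sigma> (cball (a k) (r k)))"
        using J by (intro sum_mono) auto
      also have "\<dots> = ?\<sigma> (V N)"
        unfolding V_def using dis by (intro sum_emeasure) (auto simp: disjoint_family_on_def)
      finally have "ennreal (1 / \<theta> \<delta>) * (ennreal (\<theta> \<delta>) * (\<Sum>k\<in>{k\<in>J. k < N}. hausdorff_content m (cball (a k) (r k)))) \<le>
          ennreal (1 / \<theta> \<delta>) * ennreal q" unfolding q(1) by (intro mult_left_mono) auto
      hence cont: "(\<Sum>k\<in>{k\<in>J. k < N}. hausdorff_content m (cball (a k) (r k))) \<le> ennreal (1 / \<theta> \<delta> * q)"
        using \<theta> q by (simp add: mult.assoc[symmetric] ennreal_mult[symmetric])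
      have "hausdorff_pre_measure m (2 * \<delta>) (U \<inter> sphere 0 1) \<le>
          hausdorff_pre_measure m (2 * \<delta>) (V N \<union> ((U - V N) \<inter> sphere 0 1))"
        by (intro hausdorff_pre_measure_mono) auto
      also have "\<dots> \<le> hausdorff_pre_measure m (2 * \<delta>) (V N) + hausdorff_pre_measure m (2 * \<delta>) ((U - V N) \<inter> sphere 0 1)"
        using \<delta> by (intro hausdorff_pre_measure_Un) auto
      also have "hausdorff_pre_measure m (2 * \<delta>) (V N) \<le> (\<Sum>k\<in>{k\<in>J. k < N}. hausdorff_pre_measure m (2 * \<delta>) (cball (a k) (r k)))"
        unfolding V_def using \<delta> by (intro hausdorff_pre_measure_finite_UN) auto
      also have "\<dots> \<le> (\<Sum>k\<in>{k\<in>J. k < N}. hausdorff_content m (cball (a k) (r k)))"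
        using J \<delta> by (intro sum_mono hausdorff_pre_measure_le_content) (auto simp: diameter_cball)
      also note cont
      also have "hausdorff_pre_measure m (2 * \<delta>) ((U - V N) \<inter> sphere 0 1) \<le> hausdorff_outer_measure m ((U - V N) \<inter> sphere 0 1)"
        using \<delta> by (intro hausdorff_pre_le_outer) auto
      also have "\<dots> \<le> ennreal c * ?\<sigma> (U - V N)"
        using bound open_Diff[OF U cV] by (auto simp: sphere_open_bound_def m_def)
      also have "\<dots> = ennreal (c * (s - q))"
        using c qs by (simp add: rest ennreal_mult)
      finally have "hausdorff_pre_measure m (2 * \<delta>) (U \<inter> sphere 0 1) \<le> ennreal (1 / \<theta> \<delta> * q) + ennreal (c * (s - q))"
        by (simp add: add_mono)
      also have "\<dots> = ennreal (1 / \<theta> \<delta> * q + c * (s - q))"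
        using \<theta> q c qs by simp
      also have "1 / \<theta> \<delta> * q + c * (s - q) \<le> (c' + (1 / \<theta> \<delta> - 1)) * s"
      proof -
        have "1 / \<theta> \<delta> * q + c * (s - q) = c * s - (c - 1) * q + (1 / \<theta> \<delta> - 1) * q"
          by (simp add: algebra_simps)
        also have "\<dots> \<le> c * s - (c - 1) * (\<kappa> * s) + (1 / \<theta> \<delta> - 1) * s"
          using ql qs c \<theta> by (intro add_mono diff_mono mult_left_mono) auto
        also have "\<dots> = (c' + (1 / \<theta> \<delta> - 1)) * s" by (simp add: c'_def algebra_simps)
        finally show ?thesis .
      qed
      finally show ?thesis by (simp add: ennreal_leI)
    qed
    show ?thesis
    proof (rule hausdorff_outer_leI[of 1])
      fix d :: real assume d: "0 < d" "d < 1"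
      show "hausdorff_pre_measure m d (U \<inter> sphere 0 1) \<le> ennreal (c' * s)"
      proof (rule tendsto_lowerbound)
        have "((\<lambda>\<delta>. (c' + (1 / \<theta> \<delta> - 1)) * s) \<longlongrightarrow> (c' + (1 / \<theta> 0 - 1)) * s) (at_right 0)"
          unfolding \<theta>_def by (intro tendsto_intros) auto
        thus "((\<lambda>\<delta>. ennreal ((c' + (1 / \<theta> \<delta> - 1)) * s)) \<longlongrightarrow> ennreal (c' * s)) (at_right 0)"
          by (intro tendsto_ennrealI) (simp add: \<theta>_def)
        have "\<forall>\<^sub>F \<delta> in at_right (0::real). \<delta> \<in> {0<..<d / 20}"
          using d by (intro eventually_at_right_real) simp
        thus "\<forall>\<^sub>F \<delta> in at_right 0. hausdorff_pre_measure m d (U \<inter> sphere 0 1) \<le> ennreal ((c' + (1 / \<theta> \<delta> - 1)) * s)"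
        proof eventually_elim
          case (elim \<delta>)
          have "hausdorff_pre_measure m d (U \<inter> sphere 0 1) \<le> hausdorff_pre_measure m (2 * \<delta>) (U \<inter> sphere 0 1)"
            using elim d by (intro hausdorff_pre_measure_antimono) auto
          also have "\<dots> \<le> ennreal ((c' + (1 / \<theta> \<delta> - 1)) * s)" using elim d by (intro pre) auto
          finally show ?case .
        qed
      qed simp
    qed simp
  qed
  also have "ennreal (c' * s) = ennreal c' * ?\<sigma> U"
    using s c \<kappa> by (simp add: ennreal_mult c'_def)
  finally show "hausdorff_outer_measure (DIM('a) - 1) (U \<inter> sphere 0 1) \<le> ennreal (1 + (c - 1) * (1 - \<kappa>)) * ?\<sigma> U"
    by (simp add: m_def c'_def)
qed

text \<open>
Iterating the improvement drives the constant to one.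
\<close>

lemma hausdorff_le_sphere_measure_open:
  fixes U :: "'a::euclidean_space set"
  assumes U: "open U"
  shows "hausdorff_outer_measure (DIM('a) - 1) (U \<inter> sphere 0 1) \<le> emeasure sphere_measure U"
proof -
  obtain D where D: "D \<ge> 1" "sphere_open_bound TYPE('a) D" using sphere_open_bound_crude[where 'a = 'a] by blast
  obtain \<kappa> :: real where \<kappa>: "0 < \<kappa>" "\<kappa> < 1" and
    fr: "\<And>(U :: 'a set) \<delta>. open U \<Longrightarrow> 0 < \<delta> \<Longrightarrow> \<delta> \<le> 1 / 20 \<Longrightarrow>
       ennreal (2 * \<kappa>) * emeasure sphere_measure U \<le>
       ennreal ((1 - \<delta>\<^sup>2 / 2) ^ DIM('a) / 5 ^ (DIM('a) - 1)) * hausdorff_pre_measure (DIM('a) - 1) (10 * \<delta>) (U \<inter> sphere 0 1)"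
    using sphere_open_bound_fraction[where 'a = 'a] by blast
  define s where "s = enn2real (emeasure sphere_measure U)"
  have s: "emeasure sphere_measure U = ennreal s" "s \<ge> 0" using emeasure_sphere_measure_finite[of U] by (simp_all add: s_def)
  have bd: "sphere_open_bound TYPE('a) (1 + (D - 1) * (1 - \<kappa>) ^ k)" for k
  proof (induction k)
    case (Suc k)
    have "1 \<le> 1 + (D - 1) * (1 - \<kappa>) ^ k" using D \<kappa> by simp
    from sphere_open_bound_improve[OF \<kappa> fr this Suc.IH]
    show ?case by (simp add: mult_ac)
  qed (use D in simp)
  have "(\<lambda>k. (1 + (D - 1) * (1 - \<kappa>) ^ k) * s) \<longlonglongrightarrow> (1 + (D - 1) * 0) * s"
    by (intro tendsto_intros LIMSEQ_power_zero) (use \<kappa> in auto)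
  hence "(\<lambda>k. ennreal ((1 + (D - 1) * (1 - \<kappa>) ^ k) * s)) \<longlonglongrightarrow> ennreal s"
    by (intro tendsto_ennrealI) simp
  moreover have "hausdorff_outer_measure (DIM('a) - 1) (U \<inter> sphere 0 1) \<le> ennreal ((1 + (D - 1) * (1 - \<kappa>) ^ k) * s)" for k
  proof -
    have "hausdorff_outer_measure (DIM('a) - 1) (U \<inter> sphere 0 1) \<le>
        ennreal (1 + (D - 1) * (1 - \<kappa>) ^ k) * emeasure sphere_measure U"
      using bd[of k] U unfolding sphere_open_bound_def by blast
    thus ?thesis unfolding s(1) ennreal_mult''[OF s(2), symmetric] .
  qed
  ultimately have "hausdorff_outer_measure (DIM('a) - 1) (U \<inter> sphere 0 1) \<le> ennreal s"
    by (intro tendsto_lowerbound[OF _ always_eventually]) auto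
  thus ?thesis using s by simp
qed

text \<open>
One measure dominates the other on every Borel set, and their finite total masses agree.
\<close>

theorem hausdorff_outer_eq_sphere_measure:
  fixes A :: "'a::euclidean_space set"
  assumes A: "A \<in> sets borel" "A \<subseteq> sphere 0 1"
  shows "hausdorff_outer_measure (DIM('a) - 1) A = emeasure sphere_measure A"
proof -
  let ?H = "hausdorff_outer_measure (DIM('a) - 1) :: 'a set \<Rightarrow> ennreal"
  let ?S = "sphere (0::'a) 1"
  let ?M = "hausdorff_measure (DIM('a) - 1) :: 'a measure"
  have ms: "X \<in> sets ?M" if "X \<in> sets borel" for X using that borel_subset_sets_hausdorff_measure by blast
  have eH: "?H X = emeasure ?M X" if "X \<in> sets borel" for X using emeasure_hausdorff_measure[OF ms[OF that]] by simp
  have B: "?S - A \<in> sets borel" using A by auto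
  have "?H A + ?H (?S - A) = ?H ?S"
    using plus_emeasure[OF ms[OF A(1)] ms[OF B]] A(2)
    unfolding eH[OF A(1)] eH[OF B] eH[OF borel_closed[OF closed_sphere]] by (auto simp: Un_absorb1)
  also have "\<dots> \<le> emeasure sphere_measure ?S"
    using hausdorff_le_sphere_measure_open[of "UNIV :: 'a set"] emeasure_sphere_measure_Int_sphere[of "UNIV :: 'a set"] by simp
  also have "\<dots> = emeasure sphere_measure A + emeasure sphere_measure (?S - A)"
    using A B by (subst plus_emeasure) (auto simp: Un_absorb1)
  finally have le: "?H A + ?H (?S - A) \<le> emeasure sphere_measure A + emeasure sphere_measure (?S - A)" .
  have "emeasure sphere_measure (?S - A) \<le> ?H (?S - A)"
    using B by (intro sphere_measure_le_hausdorff) auto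
  hence "?H A + emeasure sphere_measure (?S - A) \<le> emeasure sphere_measure A + emeasure sphere_measure (?S - A)"
    using le by (meson add_left_mono order_trans)
  hence "?H A \<le> emeasure sphere_measure A"
    using emeasure_sphere_measure_finite[of "?S - A"] by (simp add: add.commute[of _ "emeasure sphere_measure (?S - A)"] ennreal_add_left_cancel_le) (auto simp: less_top)
  thus ?thesis using sphere_measure_le_hausdorff[OF A] by (intro antisym)
qed

lemma integral_sphere_measure:
  fixes f :: "'a::euclidean_space \<Rightarrow> real"
  assumes [measurable]: "f \<in> borel_measurable borel"
  shows "(LINT u|sphere_measure. f u) = real DIM('a) * (LINT x:cball 0 1|lborel. f (sgn x))"
proof -
  have [measurable]: "cball (0::'a) 1 \<in> sets borel" by simp
  have "(LINT u|sphere_measure. f u) = (LINT u|distr (density lborel (indicator (cball (0::'a) 1))) borel sgn. real DIM('a) *\<^sub>R f u)"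
    unfolding sphere_measure_def by (rule integral_density) auto
  also have "\<dots> = real DIM('a) * (LINT u|distr (density lborel (\<lambda>x. ennreal (indicator (cball (0::'a) 1) x))) borel sgn. f u)"
    by (simp add: ennreal_indicator)
  also have "(LINT u|distr (density lborel (\<lambda>x. ennreal (indicator (cball (0::'a) 1) x))) borel sgn. f u) =
      (LINT x|density lborel (\<lambda>x. ennreal (indicator (cball (0::'a) 1) x)). f (sgn x))"
    by (rule integral_distr) auto
  also have "\<dots> = (LINT x:cball 0 1|lborel. f (sgn x))"
    unfolding set_lebesgue_integral_def by (rule integral_density) auto
  finally show ?thesis .
qed

text \<open>
The integrand need only agree with a Borel function outside a null set of directions, by completeness of the
Hausdorff measure.
\<close>

theorem set_integral_sphere_hausdorff:
  fixes f f0 :: "'a::euclidean_space \<Rightarrow> real"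
  assumes R: "R \<in> sets borel" "emeasure sphere_measure (sphere 0 1 - R) = 0"
    and f0 [measurable]: "f0 \<in> borel_measurable borel"
    and eq: "\<And>u. u \<in> sphere 0 1 \<Longrightarrow> u \<in> R \<Longrightarrow> f u = f0 u"
  shows "(LINT u:sphere 0 1|hausdorff_measure (DIM('a) - 1). f u) =
     real DIM('a) * (LINT x:cball 0 1|lborel. f0 (sgn x))"
proof -
  define M where "M = (hausdorff_measure (DIM('a) - 1) :: 'a measure)"
  have sM: "space M = UNIV" by (simp add: M_def)
  have bM: "X \<in> sets M" if "X \<in> sets borel" for X
    using that borel_subset_sets_hausdorff_measure unfolding M_def by blast
  define S where "S = sphere (0::'a) 1"
  have S: "S \<in> sets borel" by (simp add: S_def)
  define N where "N = S - R"
  have N: "N \<in> sets borel" using R S by (simp add: N_def)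
  have HN: "hausdorff_outer_measure (DIM('a) - 1) N = 0"
    using hausdorff_outer_eq_sphere_measure[OF N] R(2) by (auto simp: N_def S_def)
  have subN: "X \<in> sets M" if "X \<subseteq> N" for X
    unfolding M_def by (rule hausdorff_null_measurable[OF HN that])
  have nN: "N \<in> null_sets M"
    using emeasure_hausdorff_measure[of N "DIM('a) - 1"] HN bM[OF N] by (simp add: M_def null_sets_def)
  define g where "g u = indicator S u *\<^sub>R f0 u" for u
  define h where "h u = indicator S u *\<^sub>R f u" for u
  have gh: "h u = g u" if "u \<notin> N" for u
    using that eq by (cases "u \<in> S") (auto simp: g_def h_def N_def S_def)
  have bm: "k \<in> borel_measurable M" if "k \<in> borel_measurable borel" for k :: "'a \<Rightarrow> real"
  proof (rule measurableI)
    fix X :: "real set" assume "X \<in> sets borel"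
    hence "k -` X \<in> sets borel" using measurable_sets[OF that] by simp
    thus "k -` X \<inter> space M \<in> sets M" using bM by (simp add: sM)
  qed simp
  have "g \<in> borel_measurable borel" unfolding g_def[abs_def] using S by measurable
  note gM = bm[OF this]
  have hM: "h \<in> borel_measurable M"
  proof (rule measurableI)
    fix X :: "real set" assume "X \<in> sets borel"
    hence 1: "g -` X \<in> sets M" using measurable_sets[OF gM] by (simp add: sM)
    have "h -` X = (g -` X - N) \<union> (h -` X \<inter> N)" using gh by auto
    also have "\<dots> \<in> sets M" using 1 bM[OF N] subN by (intro sets.Un sets.Diff) auto
    finally show "h -` X \<inter> space M \<in> sets M" by (simp add: sM)
  qed simp
  have "(LINT u|M. h u) = (LINT u|M. g u)"
    by (rule integral_cong_AE[OF hM gM], rule AE_I'[OF nN]) (use gh in auto)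
  also have "\<dots> = (LINT u|density M (\<lambda>u. ennreal (indicator S u)). f0 u)"
    unfolding g_def using bm[OF f0] bM[OF S] by (intro integral_density[symmetric]) auto
  also have "\<dots> = (LINT u|distr (density M (\<lambda>u. ennreal (indicator S u))) borel (\<lambda>u. u). f0 u)"
  proof (rule integral_distr[symmetric])
    show "(\<lambda>u. u) \<in> density M (\<lambda>u. ennreal (indicator S u)) \<rightarrow>\<^sub>M borel"
      using bM by (intro measurableI) (auto simp: sM)
  qed simp
  also have "distr (density M (\<lambda>u. ennreal (indicator S u))) borel (\<lambda>u. u) = sphere_measure"
  proof (rule measure_eqI)
    fix A assume "A \<in> sets (distr (density M (\<lambda>u. ennreal (indicator S u))) borel (\<lambda>u. u))"
    hence A: "A \<in> sets borel" by simp
    have "emeasure (distr (density M (\<lambda>u. ennreal (indicator S u))) borel (\<lambda>u. u)) A =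
        emeasure (density M (\<lambda>u. ennreal (indicator S u))) A"
    proof (subst emeasure_distr)
      show "(\<lambda>u. u) \<in> density M (\<lambda>u. ennreal (indicator S u)) \<rightarrow>\<^sub>M borel"
        using bM by (intro measurableI) (auto simp: sM)
    qed (use A sM in auto)
    also have "\<dots> = (\<integral>\<^sup>+u. ennreal (indicator S u) * indicator A u \<partial>M)"
      using bM[OF A] bM[OF S] by (intro emeasure_density) auto
    also have "\<dots> = (\<integral>\<^sup>+u. indicator (S \<inter> A) u \<partial>M)"
      by (rule nn_integral_cong) (auto simp: indicator_def)
    also have "\<dots> = emeasure M (S \<inter> A)" using bM[OF A] bM[OF S] by simp
    also have "\<dots> = emeasure sphere_measure (A \<inter> S)"
      using emeasure_hausdorff_measure[of "A \<inter> S" "DIM('a) - 1"] bM[of "A \<inter> S"] A S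
        hausdorff_outer_eq_sphere_measure[of "A \<inter> S"]
      by (simp add: M_def S_def Int_commute)
    also have "\<dots> = emeasure sphere_measure A"
      unfolding S_def by (rule emeasure_sphere_measure_Int_sphere[OF A])
    finally show "emeasure (distr (density M (\<lambda>u. ennreal (indicator S u))) borel (\<lambda>u. u)) A = emeasure sphere_measure A" .
  qed simp
  also have "(LINT u|sphere_measure. f0 u) = real DIM('a) * (LINT x:cball 0 1|lborel. f0 (sgn x))"
    by (rule integral_sphere_measure[OF f0])
  finally show ?thesis by (simp add: set_lebesgue_integral_def h_def M_def S_def)
qed

section \<open>Polar coordinates for bodies given by a radial function\<close>

lemma emeasure_lborel_cone_scaled:
  fixes A :: "'a::euclidean_space set"
  assumes A: "A \<in> sets borel" and r: "r > 0"
  shows "emeasure lborel {x. sgn x \<in> A \<and> norm x \<le> r} = ennreal (r ^ DIM('a)) * emeasure lborel (unit_cone A)"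
proof -
  let ?X = "{x. sgn x \<in> A \<and> norm x \<le> r}"
  have "?X = (sgn -` A) \<inter> cball 0 r" by auto
  moreover have "sgn -` A \<in> sets borel" using measurable_sets[OF borel_measurable_sgn_vec A] by simp
  ultimately have X: "?X \<in> sets borel" by simp
  have "{x. r *\<^sub>R x \<in> ?X} = unit_cone A"
    using r by (auto simp: unit_cone_def sgn_scaleR)
  thus ?thesis
    using coord_vol_scale[OF finite_Basis X, of r] r X unit_cone_borel[OF A] by (simp add: coord_vol_Basis)
qed

text \<open>
On the pieces where \<open>\<rho>\<close> varies by a factor of at most \<open>q\<close>, both measures agree with \<open>\<rho>\<^sup>n C\<close> up to a factor \<open>q\<^sup>n\<close>;
countably many such pieces exhaust \<open>A\<close>.
\<close>

lemma measure_le_by_geometric_partition: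
  fixes \<rho> :: "'a::euclidean_space \<Rightarrow> real" and C :: "'a set \<Rightarrow> ennreal"
  assumes M: "sets M = sets borel" and N: "sets N = sets borel"
    and \<rho>: "\<rho> \<in> borel_measurable borel" "\<And>u. a \<le> \<rho> u" "a > 0" and q: "q > 1"
    and up: "\<And>A s. A \<in> sets borel \<Longrightarrow> s > 0 \<Longrightarrow> (\<And>u. u \<in> A \<Longrightarrow> \<rho> u \<le> s) \<Longrightarrow> emeasure M A \<le> ennreal (s ^ n) * C A"
    and lo: "\<And>A r. A \<in> sets borel \<Longrightarrow> r > 0 \<Longrightarrow> (\<And>u. u \<in> A \<Longrightarrow> r \<le> \<rho> u) \<Longrightarrow> ennreal (r ^ n) * C A \<le> emeasure N A"
    and A: "A \<in> sets borel"
  shows "emeasure M A \<le> ennreal (q ^ n) * emeasure N A"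
proof -
  note [measurable] = \<rho>(1) A
  \<comment> \<open>Starting from the lower bound \<open>a\<close> makes natural exponents sufficient.\<close>
  define B where "B k = {u \<in> A. a * q ^ k \<le> \<rho> u \<and> \<rho> u < a * q ^ Suc k}" for k
  have B: "B k \<in> sets borel" for k
  proof -
    have "B k = A \<inter> {u \<in> space borel. a * q ^ k \<le> \<rho> u \<and> \<rho> u < a * q ^ Suc k}" by (auto simp: B_def)
    also have "\<dots> \<in> sets borel" by measurable
    finally show ?thesis .
  qed
  have dis: "disjoint_family B"
    unfolding disjoint_family_on_def
  proof (intro ballI impI)
    fix k l :: nat assume "k \<noteq> l"
    have "B k \<inter> B l = {}" if "k < l" for k l
    proof -
      have "a * q ^ Suc k \<le> a * q ^ l" using that q \<rho>(3) by (intro mult_left_mono power_increasing) auto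
      thus ?thesis by (auto simp: B_def)
    qed
    thus "B k \<inter> B l = {}" using \<open>k \<noteq> l\<close> by (metis Int_commute nat_neq_iff)
  qed
  have un: "(\<Union>k. B k) = A"
  proof
    show "A \<subseteq> (\<Union>k. B k)"
    proof
      fix u assume u: "u \<in> A"
      have "\<exists>k. \<rho> u / a < q ^ k" by (rule real_arch_pow[OF q])
      then obtain k0 where "\<rho> u < a * q ^ k0" using \<rho>(3) by (auto simp: field_simps)
      define k where "k = (LEAST k. \<rho> u < a * q ^ k)"
      have k: "\<rho> u < a * q ^ k" unfolding k_def by (rule LeastI) fact
      have "k \<noteq> 0" using k \<rho>(2)[of u] by (intro notI) auto
      then obtain j where j: "k = Suc j" by (cases k) auto
      have "\<not> \<rho> u < a * q ^ j" using not_less_Least[of j "\<lambda>k. \<rho> u < a * q ^ k"] j unfolding k_def by auto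
      hence "u \<in> B j" using u k j by (simp add: B_def)
      thus "u \<in> (\<Union>k. B k)" by blast
    qed
  qed (auto simp: B_def)
  have le: "emeasure M (B k) \<le> ennreal (q ^ n) * emeasure N (B k)" for k
  proof -
    have "emeasure M (B k) \<le> ennreal ((a * q ^ Suc k) ^ n) * C (B k)"
      using q \<rho>(3) by (intro up B) (auto simp: B_def)
    also have "\<dots> = ennreal (q ^ n) * (ennreal ((a * q ^ k) ^ n) * C (B k))"
      using q \<rho>(3) by (simp add: mult.assoc[symmetric] ennreal_mult[symmetric] power_mult_distrib) (simp add: mult_ac)
    also have "\<dots> \<le> ennreal (q ^ n) * emeasure N (B k)"
      using q \<rho>(3) by (intro mult_left_mono lo B) (auto simp: B_def)
    finally show ?thesis .
  qed
  have "emeasure M A = (\<Sum>k. emeasure M (B k))"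
    using suminf_emeasure[of B M] B dis M un by (auto simp: image_subset_iff)
  also have "\<dots> \<le> (\<Sum>k. ennreal (q ^ n) * emeasure N (B k))"
    by (intro suminf_le le) auto
  also have "\<dots> = ennreal (q ^ n) * emeasure N A"
    using suminf_emeasure[of B N] B dis N un by (auto simp: image_subset_iff)
  finally show ?thesis .
qed

lemma ennreal_le_of_factor_gt_1:
  fixes x y :: ennreal
  assumes "\<And>q::real. q > 1 \<Longrightarrow> x \<le> ennreal (q ^ n) * y"
  shows "x \<le> y"
proof (cases "y = top")
  case False
  have "((\<lambda>q. y * ennreal (q ^ n)) \<longlongrightarrow> y * ennreal (1 ^ n)) (at_right 1)"
    using False by (intro ennreal_tendsto_cmult tendsto_ennrealI tendsto_intros) (auto simp: less_top)
  moreover have "\<forall>\<^sub>F q in at_right (1::real). x \<le> y * ennreal (q ^ n)"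
    using eventually_at_right_less[of "1::real"]
    by eventually_elim (use assms in \<open>simp add: mult.commute\<close>)
  ultimately have "x \<le> y * ennreal (1 ^ n)" by (rule tendsto_lowerbound) simp
  thus ?thesis by simp
qed simp

lemma borel_measurable_sgn_comp:
  fixes f :: "'a::euclidean_space \<Rightarrow> real"
  assumes [measurable]: "f \<in> borel_measurable borel"
  shows "(\<lambda>x. f (sgn x)) \<in> borel_measurable borel"
  by measurable

text \<open>
Integration in polar coordinates: where \<open>\<rho>\<close> is constant, both sides are the volume of a dilated cone, and the general case
follows by partition.
\<close>

theorem radial_body_measure_eq:
  fixes \<rho> :: "'a::euclidean_space \<Rightarrow> real"
  assumes \<rho>: "\<rho> \<in> borel_measurable borel" "\<And>u. a \<le> \<rho> u" "a > 0"
  shows "distr (density lborel (\<lambda>x. ennreal (indicator {x. norm x \<le> \<rho> (sgn x)} x))) borel sgn =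
    distr (density lborel (\<lambda>x. ennreal (indicator (cball 0 1) x * \<rho> (sgn x) ^ DIM('a)))) borel sgn" (is "?M = ?N")
proof -
  note [measurable] = \<rho>(1)
  let ?W = "{x. norm x \<le> \<rho> (sgn x)}"
  have W: "?W \<in> sets borel" by measurable
  have [measurable]: "cball (0::'a) 1 \<in> sets borel" by simp
  have pre: "sgn -` A \<in> sets borel" if "A \<in> sets borel" for A :: "'a set"
    using measurable_sets[OF borel_measurable_sgn_vec that] by simp
  have pos: "\<rho> u > 0" for u using \<rho>(2)[of u] \<rho>(3) by linarith
  have eM: "emeasure ?M A = emeasure lborel (?W \<inter> sgn -` A)" if A: "A \<in> sets borel" for A
  proof -
    have "emeasure ?M A = emeasure (density lborel (\<lambda>x. ennreal (indicator ?W x))) (sgn -` A)"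
      using A W by (subst emeasure_distr) auto
    also have "\<dots> = (\<integral>\<^sup>+x. ennreal (indicator ?W x) * indicator (sgn -` A) x \<partial>lborel)"
      using W pre[OF A] by (intro emeasure_density) auto
    also have "\<dots> = (\<integral>\<^sup>+x. indicator (?W \<inter> sgn -` A) x \<partial>lborel)"
      by (rule nn_integral_cong) (auto simp: indicator_def)
    finally show ?thesis using W pre[OF A] by simp
  qed
  have eN: "emeasure ?N A = (\<integral>\<^sup>+x. ennreal (\<rho> (sgn x) ^ DIM('a)) * indicator (unit_cone A) x \<partial>lborel)" if A: "A \<in> sets borel" for A
  proof -
    have "emeasure ?N A = emeasure (density lborel (\<lambda>x. ennreal (indicator (cball 0 1) x * \<rho> (sgn x) ^ DIM('a)))) (sgn -` A)"
      using A by (subst emeasure_distr) auto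
    also have "\<dots> = (\<integral>\<^sup>+x. ennreal (indicator (cball 0 1) x * \<rho> (sgn x) ^ DIM('a)) * indicator (sgn -` A) x \<partial>lborel)"
      using pre[OF A] by (intro emeasure_density) auto
    also have "\<dots> = (\<integral>\<^sup>+x. ennreal (\<rho> (sgn x) ^ DIM('a)) * indicator (unit_cone A) x \<partial>lborel)"
      by (rule nn_integral_cong) (auto simp: indicator_def unit_cone_def)
    finally show ?thesis .
  qed
  let ?C = "\<lambda>A. emeasure lborel (unit_cone A)"
  have Mup: "emeasure ?M A \<le> ennreal (s ^ DIM('a)) * ?C A"
    if A: "A \<in> sets borel" and s: "s > 0" "\<And>u. u \<in> A \<Longrightarrow> \<rho> u \<le> s" for A s
  proof -
    have X: "{x. sgn x \<in> A \<and> norm x \<le> s} \<in> sets borel" using A by measurable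
    have "emeasure ?M A \<le> emeasure lborel {x. sgn x \<in> A \<and> norm x \<le> s}"
      unfolding eM[OF A] using X s by (intro emeasure_mono) (auto intro: order_trans)
    thus ?thesis using emeasure_lborel_cone_scaled[OF A s(1)] by simp
  qed
  have Mlo: "ennreal (r ^ DIM('a)) * ?C A \<le> emeasure ?M A"
    if A: "A \<in> sets borel" and r: "r > 0" "\<And>u. u \<in> A \<Longrightarrow> r \<le> \<rho> u" for A r
  proof -
    have "emeasure lborel {x. sgn x \<in> A \<and> norm x \<le> r} \<le> emeasure ?M A"
      unfolding eM[OF A] using W pre[OF A] r by (intro emeasure_mono) (auto intro: order_trans)
    thus ?thesis using emeasure_lborel_cone_scaled[OF A r(1)] by simp
  qed
  have ind: "ennreal c * ?C A = (\<integral>\<^sup>+x. ennreal c * indicator (unit_cone A) x \<partial>lborel)" if "A \<in> sets borel" for A c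
    using unit_cone_borel[OF that] by (simp add: nn_integral_cmult)
  have Nup: "emeasure ?N A \<le> ennreal (s ^ DIM('a)) * ?C A"
    if A: "A \<in> sets borel" and s: "s > 0" "\<And>u. u \<in> A \<Longrightarrow> \<rho> u \<le> s" for A s
    unfolding eN[OF A] ind[OF A]
  proof (rule nn_integral_mono)
    fix x
    show "ennreal (\<rho> (sgn x) ^ DIM('a)) * indicator (unit_cone A) x \<le> ennreal (s ^ DIM('a)) * indicator (unit_cone A) x"
      using s pos[of "sgn x"] by (auto simp: indicator_def unit_cone_def intro!: ennreal_leI power_mono)
  qed
  have Nlo: "ennreal (r ^ DIM('a)) * ?C A \<le> emeasure ?N A"
    if A: "A \<in> sets borel" and r: "r > 0" "\<And>u. u \<in> A \<Longrightarrow> r \<le> \<rho> u" for A r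
    unfolding eN[OF A] ind[OF A]
  proof (rule nn_integral_mono)
    fix x
    show "ennreal (r ^ DIM('a)) * indicator (unit_cone A) x \<le> ennreal (\<rho> (sgn x) ^ DIM('a)) * indicator (unit_cone A) x"
      using r pos[of "sgn x"] by (auto simp: indicator_def unit_cone_def intro!: ennreal_leI power_mono)
  qed
  show ?thesis
  proof (rule measure_eqI)
    fix A assume "A \<in> sets ?M"
    hence A: "A \<in> sets borel" by simp
    show "emeasure ?M A = emeasure ?N A"
    proof (rule antisym)
      show "emeasure ?M A \<le> emeasure ?N A"
        by (rule ennreal_le_of_factor_gt_1, rule measure_le_by_geometric_partition[OF _ _ \<rho> _ Mup Nlo A]) auto
      show "emeasure ?N A \<le> emeasure ?M A"
        by (rule ennreal_le_of_factor_gt_1, rule measure_le_by_geometric_partition[OF _ _ \<rho> _ Nup Mlo A]) auto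
    qed
  qed simp
qed

theorem set_integral_radial_body:
  fixes \<rho> G :: "'a::euclidean_space \<Rightarrow> real"
  assumes \<rho>: "\<rho> \<in> borel_measurable borel" "\<And>u. a \<le> \<rho> u" "a > 0" and G: "G \<in> borel_measurable borel"
  shows "(LINT x:{x. norm x \<le> \<rho> (sgn x)}|lborel. G (sgn x)) = (LINT x:cball 0 1|lborel. \<rho> (sgn x) ^ DIM('a) * G (sgn x))"
proof -
  note [measurable] = \<rho>(1) G
  let ?W = "{x. norm x \<le> \<rho> (sgn x)}"
  have W [measurable]: "?W \<in> sets borel" by measurable
  have C [measurable]: "cball (0::'a) 1 \<in> sets borel" by simp
  have pos: "\<rho> u > 0" for u using \<rho>(2)[of u] \<rho>(3) by linarith
  have "(LINT x:?W|lborel. G (sgn x)) = (LINT x|density lborel (\<lambda>x. ennreal (indicator ?W x)). G (sgn x))"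
    unfolding set_lebesgue_integral_def by (rule integral_density[symmetric]) auto
  also have "\<dots> = (LINT u|distr (density lborel (\<lambda>x. ennreal (indicator ?W x))) borel sgn. G u)"
    by (rule integral_distr[symmetric]) auto
  also have "\<dots> = (LINT u|distr (density lborel (\<lambda>x. ennreal (indicator (cball 0 1) x * \<rho> (sgn x) ^ DIM('a)))) borel sgn. G u)"
    by (simp only: radial_body_measure_eq[OF \<rho>])
  also have "\<dots> = (LINT x|density lborel (\<lambda>x. ennreal (indicator (cball 0 1) x * \<rho> (sgn x) ^ DIM('a))). G (sgn x))"
    by (rule integral_distr) auto
  also have "\<dots> = (LINT x|lborel. (indicator (cball 0 1) x * \<rho> (sgn x) ^ DIM('a)) *\<^sub>R G (sgn x))"
    by (rule integral_density) (auto intro!: AE_I2 mult_nonneg_nonneg zero_le_power less_imp_le[OF pos])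
  also have "\<dots> = (LINT x:cball 0 1|lborel. \<rho> (sgn x) ^ DIM('a) * G (sgn x))"
    unfolding set_lebesgue_integral_def by (simp add: mult_ac)
  finally show ?thesis .
qed

section \<open>Support functions and radial functions\<close>

lemma support_function_upper:
  assumes "bounded C" "x \<in> C"
  shows "u \<bullet> x \<le> support_function C u"
proof -
  obtain R where R: "\<And>x. x \<in> C \<Longrightarrow> norm x \<le> R" using assms(1) by (auto simp: bounded_iff)
  have "bdd_above ((\<lambda>x. u \<bullet> x) ` C)"
  proof (rule bdd_aboveI2)
    fix x assume "x \<in> C"
    have "u \<bullet> x \<le> norm u * norm x" by (rule norm_cauchy_schwarz)
    also have "\<dots> \<le> norm u * R" using R[OF \<open>x \<in> C\<close>] by (simp add: mult_left_mono)
    finally show "u \<bullet> x \<le> norm u * R" .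
  qed
  thus ?thesis unfolding support_function_def using assms(2) by (intro cSUP_upper)
qed

lemma support_function_least:
  assumes "C \<noteq> {}" "\<And>x. x \<in> C \<Longrightarrow> u \<bullet> x \<le> c"
  shows "support_function C u \<le> c"
  unfolding support_function_def using assms by (intro cSUP_least)

lemma support_function_attained:
  assumes "compact C" "C \<noteq> {}"
  obtains x where "x \<in> C" "support_function C u = u \<bullet> x"
proof -
  have "continuous_on C (\<lambda>x. u \<bullet> x)" by (intro continuous_intros)
  then obtain x where x: "x \<in> C" "\<And>y. y \<in> C \<Longrightarrow> u \<bullet> y \<le> u \<bullet> x"
    using continuous_attains_sup[OF assms] by blast
  have "support_function C u = u \<bullet> x"
    using support_function_upper[OF compact_imp_bounded[OF assms(1)] x(1)] support_function_least[OF assms(2) x(2)]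
    by (rule antisym[rotated])
  thus ?thesis using x that by blast
qed

lemma support_function_add_le:
  assumes "bounded C" "C \<noteq> {}"
  shows "support_function C (u + v) \<le> support_function C u + support_function C v"
  by (rule support_function_least[OF assms(2)])
     (auto simp: inner_add_left intro!: add_mono support_function_upper[OF assms(1)])

lemma support_function_scale:
  assumes "bounded C" "C \<noteq> {}" "c > 0"
  shows "support_function C (c *\<^sub>R u) = c * support_function C u"
proof (rule antisym)
  show "support_function C (c *\<^sub>R u) \<le> c * support_function C u"
    using assms by (intro support_function_least) (auto intro!: support_function_upper)
  have "support_function C u \<le> support_function C (c *\<^sub>R u) / c"
  proof (rule support_function_least[OF assms(2)])
    fix x assume "x \<in> C"
    thus "u \<bullet> x \<le> support_function C (c *\<^sub>R u) / c"
      using support_function_upper[OF assms(1), of x "c *\<^sub>R u"] assms(3) by (simp add: field_simps)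
  qed
  thus "c * support_function C u \<le> support_function C (c *\<^sub>R u)"
    using assms(3) by (simp add: field_simps)
qed

lemma support_function_le_norm:
  assumes "C \<noteq> {}" "C \<subseteq> cball 0 R"
  shows "support_function C u \<le> R * norm u"
proof (rule support_function_least[OF assms(1)])
  fix x assume "x \<in> C"
  hence "norm x \<le> R" using assms(2) by auto
  have "u \<bullet> x \<le> norm u * norm x" by (rule norm_cauchy_schwarz)
  also have "\<dots> \<le> norm u * R" using \<open>norm x \<le> R\<close> by (simp add: mult_left_mono)
  finally show "u \<bullet> x \<le> R * norm u" by (simp add: mult.commute)
qed

lemma support_function_ge_norm:
  assumes "bounded C" "cball 0 r \<subseteq> C" "r \<ge> 0"
  shows "r * norm u \<le> support_function C u"
proof (cases "u = 0")
  case False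
  have "r *\<^sub>R sgn u \<in> C" using assms(2,3) by (auto intro!: subsetD[OF assms(2)] simp: norm_sgn)
  hence "u \<bullet> (r *\<^sub>R sgn u) \<le> support_function C u" by (rule support_function_upper[OF assms(1)])
  also have "u \<bullet> (r *\<^sub>R sgn u) = r * norm u"
    using False by (simp add: sgn_div_norm dot_square_norm power2_eq_square)
  finally show ?thesis .
next
  case True
  have "0 \<in> C" using assms by auto
  thus ?thesis using True support_function_upper[OF assms(1), of 0 u] by simp
qed

lemma support_function_lipschitz:
  assumes "C \<noteq> {}" "C \<subseteq> cball 0 R"
  shows "\<bar>support_function C u - support_function C v\<bar> \<le> R * norm (u - v)"
proof -
  have b: "bounded C" using assms(2) bounded_cball bounded_subset by blast
  have "support_function C u \<le> support_function C v + R * norm (u - v)" for u v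
    using support_function_add_le[OF b assms(1), of v "u - v"] support_function_le_norm[OF assms, of "u - v"] by simp
  from this[of u v] this[of v u] show ?thesis by (simp add: norm_minus_commute)
qed

lemma continuous_on_support_function:
  assumes "bounded C" "C \<noteq> {}"
  shows "continuous_on X (support_function C)"
proof -
  obtain R where R: "R > 0" "C \<subseteq> cball 0 R" using assms(1) unfolding bounded_pos by (auto simp: subset_iff)
  have "R-lipschitz_on UNIV (support_function C)"
    using support_function_lipschitz[OF assms(2) R(2)] R(1) by (intro lipschitz_onI) (auto simp: dist_norm)
  thus ?thesis using lipschitz_on_continuous_on continuous_on_subset by blast
qed

text \<open>
The supremum in the definition of the radial function is attained because the body is compact.
\<close>

lemma star_body_iff:
  fixes Q :: "'a::euclidean_space set"
  assumes "Q \<in> star_bodies" "x \<noteq> 0"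
  shows "x \<in> Q \<longleftrightarrow> norm x \<le> radial_function Q (sgn x)"
proof -
  have Q: "compact Q" "0 \<in> Q" "\<And>x. x \<in> Q \<Longrightarrow> closed_segment 0 x \<subseteq> Q"
    "\<And>u. norm u = 1 \<Longrightarrow> 0 < radial_function Q u"
    using assms(1) by (auto simp: star_bodies_def)
  define u where "u = sgn x"
  have u: "norm u = 1" "norm x *\<^sub>R u = x" using assms(2) by (simp_all add: u_def norm_sgn sgn_div_norm)
  define T where "T = insert 0 {t. 0 < t \<and> t *\<^sub>R u \<in> Q}"
  have T: "T = {t. 0 \<le> t \<and> t *\<^sub>R u \<in> Q}" using Q(2) by (auto simp: T_def less_le)
  obtain R where R: "\<And>x. x \<in> Q \<Longrightarrow> norm x \<le> R" using compact_imp_bounded[OF Q(1)] by (auto simp: bounded_iff)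
  have bdd: "bdd_above T" using R u unfolding T by (intro bdd_aboveI[of _ R]) force
  have "closed T"
  proof -
    have "T = {0..} \<inter> (\<lambda>t. t *\<^sub>R u) -` Q" by (auto simp: T)
    moreover have "closed ((\<lambda>t. t *\<^sub>R u) -` Q)"
      using compact_imp_closed[OF Q(1)] by (intro closed_vimage continuous_intros)
    ultimately show ?thesis by (simp add: closed_Int)
  qed
  hence "Sup T \<in> T" using bdd by (intro closed_contains_Sup) (auto simp: T_def)
  moreover have rho: "radial_function Q u = Sup T" by (simp add: radial_function_def T_def)
  ultimately have top: "radial_function Q u *\<^sub>R u \<in> Q" by (simp add: T)
  show ?thesis
  proof
    assume "x \<in> Q"
    hence "norm x \<in> T" using u by (simp add: T)
    thus "norm x \<le> radial_function Q (sgn x)" using rho bdd by (simp add: u_def[symmetric] cSup_upper)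
  next
    assume le: "norm x \<le> radial_function Q (sgn x)"
    let ?r = "radial_function Q u"
    have "?r > 0" using Q(4) u by blast
    have "x \<in> closed_segment 0 (?r *\<^sub>R u)"
      unfolding closed_segment_def
    proof (clarify, intro exI conjI)
      show "x = (1 - norm x / ?r) *\<^sub>R 0 + (norm x / ?r) *\<^sub>R ?r *\<^sub>R u" using u \<open>?r > 0\<close> by simp
    qed (use le \<open>?r > 0\<close> in \<open>auto simp: u_def[symmetric]\<close>)
    thus "x \<in> Q" using Q(3)[OF top] by blast
  qed
qed

text \<open>
With the value 1 at the origin, a star body is exactly the set of all \<open>x\<close> with \<open>norm x \<le> radial_ext Q (sgn x)\<close>,
since \<open>sgn 0 = 0\<close>; away from the sphere the function remains bounded and bounded away from zero.
\<close>

definition radial_ext :: "'a::euclidean_space set \<Rightarrow> 'a \<Rightarrow> real" where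
  "radial_ext Q u = (if norm u = 1 then radial_function Q u else 1)"

lemma star_body_eq:
  assumes "Q \<in> star_bodies"
  shows "Q = {x. norm x \<le> radial_ext Q (sgn x)}"
proof -
  have 0: "0 \<in> Q" using assms by (simp add: star_bodies_def)
  have "x \<in> Q \<longleftrightarrow> norm x \<le> radial_ext Q (sgn x)" for x
  proof (cases "x = 0")
    case True
    thus ?thesis using 0 by (simp add: radial_ext_def)
  next
    case False
    thus ?thesis using star_body_iff[OF assms False] by (simp add: radial_ext_def norm_sgn)
  qed
  thus ?thesis by blast
qed

lemma radial_ext_props:
  fixes Q :: "'a::euclidean_space set"
  assumes "Q \<in> star_bodies"
  shows "radial_ext Q \<in> borel_measurable borel"
    and "\<exists>a>0. \<exists>b. \<forall>u. a \<le> radial_ext Q u \<and> radial_ext Q u \<le> b"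
proof -
  have c: "continuous_on (sphere 0 1) (radial_function Q)" and pos: "\<And>u. u \<in> sphere 0 1 \<Longrightarrow> 0 < radial_function Q u"
    using assms by (auto simp: star_bodies_def)
  have S: "sphere (0::'a) 1 \<in> sets borel" by simp
  have [measurable]: "(\<lambda>u. indicator (sphere 0 1) u *\<^sub>R radial_function Q u) \<in> borel_measurable borel"
    by (rule borel_measurable_continuous_on_indicator[OF S c])
  have "radial_ext Q = (\<lambda>u. indicator (sphere 0 1) u *\<^sub>R radial_function Q u + indicator (- sphere 0 1) u)"
    by (auto simp: radial_ext_def indicator_def)
  also have "\<dots> \<in> borel_measurable borel" by measurable
  finally show "radial_ext Q \<in> borel_measurable borel" .
  have ne: "sphere (0::'a) 1 \<noteq> {}" by simp
  obtain v where v: "v \<in> sphere 0 1" "\<And>u. u \<in> sphere 0 1 \<Longrightarrow> radial_function Q v \<le> radial_function Q u"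
    using continuous_attains_inf[OF compact_sphere ne c] by blast
  obtain w where w: "w \<in> sphere 0 1" "\<And>u. u \<in> sphere 0 1 \<Longrightarrow> radial_function Q u \<le> radial_function Q w"
    using continuous_attains_sup[OF compact_sphere ne c] by blast
  show "\<exists>a>0. \<exists>b. \<forall>u. a \<le> radial_ext Q u \<and> radial_ext Q u \<le> b"
  proof (intro exI conjI allI)
    show "min 1 (radial_function Q v) > 0" using pos[OF v(1)] by simp
    fix u
    show "min 1 (radial_function Q v) \<le> radial_ext Q u" using v(2)[of u] by (auto simp: radial_ext_def)
    show "radial_ext Q u \<le> max 1 (radial_function Q w)" using w(2)[of u] by (auto simp: radial_ext_def)
  qed
qed

section \<open>Directional derivatives almost everywhere\<close>

lemma measure_cball_annulus_tendsto:
  "((\<lambda>t. measure lborel (cball (0::'a::euclidean_space) (M + t)) - measure lborel (cball (0::'a) (M - t))) \<longlongrightarrow> 0) (at_right 0)"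
  if "M > 0" for M :: real
proof -
  let ?u = "unit_ball_vol (real DIM('a))"
  have "((\<lambda>t. ?u * (M + t) ^ DIM('a) - ?u * (M - t) ^ DIM('a)) \<longlongrightarrow> ?u * (M + 0) ^ DIM('a) - ?u * (M - 0) ^ DIM('a)) (at_right 0)"
    by (intro tendsto_intros)
  moreover have "\<forall>\<^sub>F t in at_right (0::real). t \<in> {0<..<M}"
    using that by (intro eventually_at_right_real)
  hence "\<forall>\<^sub>F t in at_right (0::real). ?u * (M + t) ^ DIM('a) - ?u * (M - t) ^ DIM('a) =
     measure lborel (cball (0::'a) (M + t)) - measure lborel (cball (0::'a) (M - t))"
    by eventually_elim (simp add: content_cball)
  ultimately show ?thesis using tendsto_cong by fastforce
qed

text \<open>
For a convex function \<open>g\<close> the quotient of the second difference by \<open>t\<close> decreases with \<open>t\<close> to the difference of the two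
one-sided derivatives in direction \<open>b\<close>, so these are the points where the derivative in that direction exists.
Asking for some \<open>t\<close> instead of a limit exhibits the set as a countable intersection of open sets and makes it
invariant under dilations if \<open>g\<close> is homogeneous.
\<close>

definition symmetric_derivative_set :: "('a::euclidean_space \<Rightarrow> real) \<Rightarrow> 'a \<Rightarrow> 'a set" where
  "symmetric_derivative_set g b = {x. \<forall>e>0. \<exists>t>0. g (x + t *\<^sub>R b) + g (x - t *\<^sub>R b) - 2 * g x < e * t}"

lemma symmetric_derivative_set_borel:
  assumes "continuous_on UNIV g"
  shows "symmetric_derivative_set g b \<in> sets borel"
proof -
  have "symmetric_derivative_set g b =
      (\<Inter>k::nat. \<Union>t\<in>{0<..}. {x. g (x + t *\<^sub>R b) + g (x - t *\<^sub>R b) - 2 * g x < 1 / real (Suc k) * t})"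
  proof (intro equalityI subsetI)
    fix x assume x: "x \<in> (\<Inter>k::nat. \<Union>t\<in>{0<..}. {x. g (x + t *\<^sub>R b) + g (x - t *\<^sub>R b) - 2 * g x < 1 / real (Suc k) * t})"
    show "x \<in> symmetric_derivative_set g b"
      unfolding symmetric_derivative_set_def
    proof (clarify)
      fix e :: real assume "e > 0"
      then obtain k where k: "inverse (real (Suc k)) < e" using reals_Archimedean by blast
      obtain t where t: "t > 0" "g (x + t *\<^sub>R b) + g (x - t *\<^sub>R b) - 2 * g x < 1 / real (Suc k) * t"
        using x by blast
      have "1 / real (Suc k) * t \<le> e * t" using k t by (intro mult_right_mono) (auto simp: inverse_eq_divide)
      thus "\<exists>t>0. g (x + t *\<^sub>R b) + g (x - t *\<^sub>R b) - 2 * g x < e * t" using t by force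
    qed
  next
    fix x assume "x \<in> symmetric_derivative_set g b"
    hence *: "\<exists>t>0. g (x + t *\<^sub>R b) + g (x - t *\<^sub>R b) - 2 * g x < e * t" if "e > 0" for e
      using that by (auto simp: symmetric_derivative_set_def)
    show "x \<in> (\<Inter>k::nat. \<Union>t\<in>{0<..}. {x. g (x + t *\<^sub>R b) + g (x - t *\<^sub>R b) - 2 * g x < 1 / real (Suc k) * t})"
      using *[of "1 / real (Suc _)"] by fastforce
  qed
  also have "\<dots> \<in> sets borel"
  proof (rule sets.countable_INT)
    have o: "open (\<Union>t\<in>{0<..}. {x. g (x + t *\<^sub>R b) + g (x - t *\<^sub>R b) - 2 * g x < 1 / real (Suc k) * t})" for k
      by (intro open_UN ballI open_Collect_less continuous_intros continuous_on_compose2[OF assms]) auto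
    show "range (\<lambda>k. \<Union>t\<in>{0<..}. {x. g (x + t *\<^sub>R b) + g (x - t *\<^sub>R b) - 2 * g x < 1 / real (Suc k) * t}) \<subseteq> sets borel"
      by (intro image_subsetI borel_open o)
  qed simp
  finally show ?thesis .
qed

text \<open>
The second difference of \<open>g\<close> with step \<open>t\<close> is the difference of the first difference \<open>D\<close> and a translate of \<open>D\<close>.  Its
integral over a ball is therefore an integral of \<open>D\<close>, which is at most \<open>L t\<close> in absolute value, over the
difference of two translated balls; that is \<open>o(t)\<close>.  On a bad set of positive measure the integral would be at least of order \<open>t\<close>.
\<close>

lemma symmetric_derivative_set_null:
  fixes g :: "'a::euclidean_space \<Rightarrow> real"
  assumes lip: "\<And>x y. \<bar>g x - g y\<bar> \<le> L * norm (x - y)" and L: "L \<ge> 0"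
    and conv: "\<And>x y. 0 \<le> g (x + y) + g (x - y) - 2 * g x" and b: "norm b = 1"
  shows "- symmetric_derivative_set g b \<in> null_sets lborel"
proof -
  have "L-lipschitz_on UNIV g" using lip L by (intro lipschitz_onI) (auto simp: dist_norm)
  hence cont: "continuous_on UNIV g" by (rule lipschitz_on_continuous_on)
  note cc = continuous_on_compose2[OF cont]
  have [measurable]: "g \<in> borel_measurable borel" by (rule borel_measurable_continuous_onI[OF cont])
  define s where "s t x = g (x + t *\<^sub>R b) + g (x - t *\<^sub>R b) - 2 * g x" for t x
  have s0: "0 \<le> s t x" for t x unfolding s_def by (rule conv)
  have null: "{x \<in> cball 0 M. \<forall>t>0. e * t \<le> s t x} \<in> null_sets lborel" if M: "M > 0" and e: "e > 0" for M e
  proof -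
    let ?E = "{x \<in> cball 0 M. \<forall>t>0. e * t \<le> s t x}"
    let ?B = "cball (0::'a) M"
    have "?E = cball 0 M \<inter> (\<Inter>t\<in>{0<..}. {x. e * t \<le> s t x})" by auto
    moreover have "closed {x. e * t \<le> s t x}" for t unfolding s_def
      by (intro closed_Collect_le continuous_intros cc) auto
    ultimately have "closed ?E" by (simp add: closed_Int closed_INT)
    hence Eb: "?E \<in> sets borel" by simp
    have fin: "emeasure lborel ?E < top"
    proof -
      have "emeasure lborel ?E \<le> emeasure lborel ?B" by (rule emeasure_mono) auto
      also have "\<dots> < top" using M by (simp add: emeasure_cball)
      finally show ?thesis .
    qed
    have bd: "e * measure lborel ?E \<le> L * (measure lborel (cball (0::'a) (M + t)) - measure lborel (cball (0::'a) (M - t)))"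
      if t: "0 < t" "t < M" for t
    proof -
      define D where "D x = g (x + t *\<^sub>R b) - g x" for x
      define B' where "B' = {x. x + t *\<^sub>R b \<in> ?B}"
      have D: "\<bar>D x\<bar> \<le> L * t" for x using lip[of "x + t *\<^sub>R b" x] b t by (simp add: D_def)
      have [measurable]: "D \<in> borel_measurable borel" unfolding D_def[abs_def] by measurable
      have sD: "s t x = D x - D (x - t *\<^sub>R b)" for x by (simp add: s_def D_def)
      have B'b [measurable]: "B' \<in> sets borel"
        using borel_translate_scale[of ?B 1 "t *\<^sub>R b"] by (simp add: B'_def)
      have Bb [measurable]: "?B \<in> sets borel" by simp
      have inner: "cball 0 (M - t) \<subseteq> ?B \<inter> B'"
      proof
        fix x :: 'a assume "x \<in> cball 0 (M - t)"
        thus "x \<in> ?B \<inter> B'" using t b norm_triangle_ineq[of x "t *\<^sub>R b"] by (auto simp: B'_def)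
      qed
      have outer: "?B \<union> B' \<subseteq> cball 0 (M + t)"
      proof
        fix x :: 'a assume "x \<in> ?B \<union> B'"
        thus "x \<in> cball 0 (M + t)" using t b norm_triangle_ineq4[of "x + t *\<^sub>R b" "t *\<^sub>R b"] by (auto simp: B'_def)
      qed
      have finI: "emeasure lborel X < top" if "X \<subseteq> cball 0 (M + t)" "X \<in> sets borel" for X :: "'a set"
      proof -
        have "emeasure lborel X \<le> emeasure lborel (cball (0::'a) (M + t))" using that by (intro emeasure_mono) auto
        also have "\<dots> < top" using M t by (simp add: emeasure_cball)
        finally show ?thesis .
      qed
      have intX: "set_integrable lborel X D" if X: "X \<subseteq> cball 0 (M + t)" "X \<in> sets borel" for X
        unfolding set_integrable_def
      proof (rule integrableI_bounded_set_indicator[where B = "L * t"])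
        show "emeasure lborel X < \<infinity>" using finI[OF X] by simp
      qed (use X D in auto)
      have sub: "?B \<subseteq> cball 0 (M + t)" "B' \<subseteq> cball 0 (M + t)" using outer by auto
      have tr: "(LINT x:?B|lborel. D (x - t *\<^sub>R b)) = (LINT x:B'|lborel. D x)"
      proof -
        have eq: "(lborel :: 'a measure) = distr lborel borel (\<lambda>y. t *\<^sub>R b + y)"
          using lborel_affine[of 1 "t *\<^sub>R b"] by (simp add: density_1)
        have "(LINT x:?B|lborel. D (x - t *\<^sub>R b)) = (LINT x|distr lborel borel (\<lambda>y. t *\<^sub>R b + y). indicator ?B x *\<^sub>R D (x - t *\<^sub>R b))"
          unfolding set_lebesgue_integral_def by (subst eq) simp
        also have "\<dots> = (LINT x|lborel. indicator ?B (t *\<^sub>R b + x) *\<^sub>R D (t *\<^sub>R b + x - t *\<^sub>R b))"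
          by (rule integral_distr) auto
        also have "\<dots> = (LINT x:B'|lborel. D x)"
          unfolding set_lebesgue_integral_def by (intro Bochner_Integration.integral_cong) (auto simp: B'_def indicator_def add.commute)
        finally show ?thesis .
      qed
      have intT: "set_integrable lborel ?B (\<lambda>x. D (x - t *\<^sub>R b))"
        unfolding set_integrable_def
      proof (rule integrableI_bounded_set_indicator[where B = "L * t"])
        show "emeasure lborel ?B < \<infinity>" using finI[OF sub(1)] by simp
      qed (use D in auto)
      have "(e * t) * measure lborel ?E = (LINT x:?E|lborel. e * t)"
        using Eb fin by (simp add: set_lebesgue_integral_def less_top mult.commute)
      also have "\<dots> \<le> (LINT x:?B|lborel. s t x)"
        unfolding set_lebesgue_integral_def
      proof (rule integral_mono)
        show "integrable lborel (\<lambda>x. indicator ?E x *\<^sub>R (e * t))" using Eb fin by (simp add: less_top)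
        show "integrable lborel (\<lambda>x. indicator ?B x *\<^sub>R s t x)"
          using set_integral_diff(1)[OF intX[OF sub(1) Bb] intT] unfolding sD set_integrable_def .
        fix x show "indicator ?E x *\<^sub>R (e * t) \<le> indicator ?B x *\<^sub>R s t x"
          using t s0[of t x] by (auto simp: indicator_def)
      qed
      also have "\<dots> = (LINT x:?B|lborel. D x) - (LINT x:B'|lborel. D x)"
        unfolding sD tr[symmetric] by (rule set_integral_diff(2)[OF intX[OF sub(1) Bb] intT])
      also have "\<dots> = (LINT x|lborel. (indicator ?B x - indicator B' x) *\<^sub>R D x)"
        using intX[OF sub(1) Bb] intX[OF sub(2) B'b] unfolding set_lebesgue_integral_def set_integrable_def
        by (simp add: left_diff_distrib)
      also have "\<dots> \<le> (LINT x|lborel. (indicator (cball (0::'a) (M + t)) x - indicator (cball 0 (M - t)) x) *\<^sub>R (L * t))"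
      proof (rule integral_mono)
        show "integrable lborel (\<lambda>x. (indicator ?B x - indicator B' x) *\<^sub>R D x)"
          using intX[OF sub(1) Bb] intX[OF sub(2) B'b] unfolding set_integrable_def
          by (simp add: left_diff_distrib)
        show "integrable lborel (\<lambda>x::'a. (indicator (cball 0 (M + t)) x - indicator (cball 0 (M - t)) x) *\<^sub>R (L * t))"
          using M t by (intro integrable_scaleR_left Bochner_Integration.integrable_diff integrable_real_indicator) (auto simp: emeasure_cball)
        fix x show "(indicator ?B x - indicator B' x) *\<^sub>R D x \<le> (indicator (cball 0 (M + t)) x - indicator (cball 0 (M - t)) x) *\<^sub>R (L * t)"
          using D[of x] inner outer t L
          by (cases "x \<in> ?B"; cases "x \<in> B'"; cases "x \<in> cball 0 (M + t)"; cases "x \<in> cball 0 (M - t)")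
             (auto simp: subset_iff)
      qed
      also have "\<dots> = (measure lborel (cball (0::'a) (M + t)) - measure lborel (cball (0::'a) (M - t))) * (L * t)"
        using M t by (simp add: emeasure_cball)
      finally have "t * (e * measure lborel ?E) \<le> t * (L * (measure lborel (cball (0::'a) (M + t)) - measure lborel (cball (0::'a) (M - t))))"
        by (simp only: mult_ac)
      thus ?thesis using t by simp
    qed
    have "e * measure lborel ?E \<le> L * 0"
    proof (rule tendsto_lowerbound)
      show "((\<lambda>t. L * (measure lborel (cball (0::'a) (M + t)) - measure lborel (cball (0::'a) (M - t)))) \<longlongrightarrow> L * 0) (at_right 0)"
        by (intro tendsto_mult_left measure_cball_annulus_tendsto M)
      have "\<forall>\<^sub>F t in at_right (0::real). t \<in> {0<..<M}" using M by (intro eventually_at_right_real)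
      thus "\<forall>\<^sub>F t in at_right 0. e * measure lborel ?E \<le> L * (measure lborel (cball (0::'a) (M + t)) - measure lborel (cball (0::'a) (M - t)))"
        by eventually_elim (use bd in auto)
    qed simp
    hence "measure lborel ?E \<le> 0" using e by (simp add: mult_le_0_iff)
    hence "measure lborel ?E = 0" by (rule antisym) simp
    hence "emeasure lborel ?E = 0" using fin by (auto simp: measure_def enn2real_eq_0_iff)
    thus ?thesis using Eb by auto
  qed
  have "- symmetric_derivative_set g b \<subseteq> (\<Union>i::nat. \<Union>k::nat. {x \<in> cball 0 (real (Suc i)). \<forall>t>0. 1 / real (Suc k) * t \<le> s t x})"
  proof
    fix x assume "x \<in> - symmetric_derivative_set g b"
    then obtain e where e0: "e > 0" and no: "\<not> (\<exists>t>0. g (x + t *\<^sub>R b) + g (x - t *\<^sub>R b) - 2 * g x < e * t)"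
      unfolding symmetric_derivative_set_def by blast
    have "e * t \<le> s t x" if "t > 0" for t
    proof -
      have "\<not> g (x + t *\<^sub>R b) + g (x - t *\<^sub>R b) - 2 * g x < e * t" using no that by blast
      thus ?thesis by (simp add: s_def)
    qed
    note e = e0 this
    obtain k where k: "inverse (real (Suc k)) < e" using reals_Archimedean[OF e(1)] by blast
    obtain i where i: "norm x < real i" using reals_Archimedean2 by blast
    have "1 / real (Suc k) * t \<le> s t x" if "t > 0" for t
      using e(2)[OF that] mult_right_mono[of "inverse (real (Suc k))" e t] k that by (simp add: inverse_eq_divide)
    moreover have "x \<in> cball 0 (real (Suc i))" using i by simp
    ultimately show "x \<in> (\<Union>i::nat. \<Union>k::nat. {x \<in> cball 0 (real (Suc i)). \<forall>t>0. 1 / real (Suc k) * t \<le> s t x})"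
      by blast
  qed
  moreover have "(\<Union>i::nat. \<Union>k::nat. {x \<in> cball 0 (real (Suc i)). \<forall>t>0. 1 / real (Suc k) * t \<le> s t x}) \<in> null_sets lborel"
    by (intro null_sets_UN null) auto
  moreover have "- symmetric_derivative_set g b \<in> sets lborel"
    using borel_comp[OF symmetric_derivative_set_borel[OF cont, of b]] by simp
  ultimately show ?thesis by (blast intro: null_sets_subset)
qed

section \<open>Gauge functions and normals of convex bodies\<close>

definition polar_body :: "'a::euclidean_space set \<Rightarrow> 'a set" where
  "polar_body K = {p. \<forall>y\<in>K. p \<bullet> y \<le> 1}"

text \<open>
The support function of the polar body is the Minkowski functional of \<open>K\<close>: see \<open>mem_convex_body_iff_gauge\<close>.
\<close>

definition gauge_function :: "'a::euclidean_space set \<Rightarrow> 'a \<Rightarrow> real" where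
  "gauge_function K = support_function (polar_body K)"

lemma convex_body_radii:
  assumes "K \<in> convex_bodies_o"
  obtains r R where "0 < r" "0 < R" "cball 0 r \<subseteq> K" "K \<subseteq> cball 0 R"
proof -
  have K: "compact K" "0 \<in> interior K" using assms by (auto simp: convex_bodies_o_def)
  obtain r where r: "r > 0" "cball 0 r \<subseteq> K" using K(2) mem_interior_cball by blast
  obtain R where R: "R > 0" "K \<subseteq> cball 0 R"
    using compact_imp_bounded[OF K(1)] unfolding bounded_pos by (auto simp: subset_iff)
  show ?thesis using that r R by blast
qed

lemma polar_body_bounds:
  assumes "0 < r" "0 < R" "cball 0 r \<subseteq> K" "K \<subseteq> cball 0 R"
  shows "polar_body K \<subseteq> cball 0 (1 / r)" "cball 0 (1 / R) \<subseteq> polar_body K"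
proof -
  show "polar_body K \<subseteq> cball 0 (1 / r)"
  proof
    fix p assume p: "p \<in> polar_body K"
    have "r *\<^sub>R sgn p \<in> K" using assms by (auto intro!: subsetD[OF assms(3)] simp: norm_sgn)
    hence "p \<bullet> (r *\<^sub>R sgn p) \<le> 1" using p by (auto simp: polar_body_def)
    moreover have "p \<bullet> (r *\<^sub>R sgn p) = r * norm p"
      by (cases "p = 0") (simp_all add: sgn_div_norm dot_square_norm power2_eq_square)
    ultimately show "p \<in> cball 0 (1 / r)" using assms(1) by (simp add: field_simps)
  qed
  show "cball 0 (1 / R) \<subseteq> polar_body K"
  proof
    fix p :: 'a assume p: "p \<in> cball 0 (1 / R)"
    have "p \<bullet> y \<le> 1" if "y \<in> K" for y
    proof -
      have "p \<bullet> y \<le> norm p * norm y" by (rule norm_cauchy_schwarz)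
      also have "\<dots> \<le> (1 / R) * R" using p that assms by (intro mult_mono) auto
      finally show ?thesis using assms(2) by simp
    qed
    thus "p \<in> polar_body K" by (simp add: polar_body_def)
  qed
qed

lemma compact_polar_body:
  assumes "K \<in> convex_bodies_o"
  shows "compact (polar_body K)" "polar_body K \<noteq> {}"
proof -
  obtain r R where rR: "0 < r" "0 < R" "cball 0 r \<subseteq> K" "K \<subseteq> cball 0 R"
    using convex_body_radii[OF assms] .
  have "polar_body K = (\<Inter>y\<in>K. {p. p \<bullet> y \<le> 1})" by (auto simp: polar_body_def)
  moreover have "closed (\<Inter>y\<in>K. {p. p \<bullet> y \<le> 1})"
    by (intro closed_INT ballI closed_Collect_le continuous_intros)
  ultimately have "closed (polar_body K)" by simp
  moreover have "bounded (polar_body K)"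
    using polar_body_bounds(1)[OF rR] bounded_cball bounded_subset by blast
  ultimately show "compact (polar_body K)" by (simp add: compact_eq_bounded_closed)
  have "0 \<in> polar_body K" by (simp add: polar_body_def)
  thus "polar_body K \<noteq> {}" by blast
qed

lemma gauge_function_bounds:
  assumes "0 < r" "0 < R" "cball 0 r \<subseteq> K" "K \<subseteq> cball 0 R"
  shows "norm x / R \<le> gauge_function K x" "gauge_function K x \<le> norm x / r"
proof -
  note pb = polar_body_bounds[OF assms]
  have b: "bounded (polar_body K)" using pb(1) bounded_cball bounded_subset by blast
  have ne: "polar_body K \<noteq> {}" using pb(2) assms(2) by auto
  show "norm x / R \<le> gauge_function K x"
    using support_function_ge_norm[OF b pb(2), of x] assms(2) by (simp add: gauge_function_def)
  show "gauge_function K x \<le> norm x / r"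
    using support_function_le_norm[OF ne pb(1), of x] by (simp add: gauge_function_def)
qed

lemma gauge_function_pos:
  assumes "K \<in> convex_bodies_o" "x \<noteq> 0"
  shows "gauge_function K x > 0"
proof -
  obtain r R where rR: "0 < r" "0 < R" "cball 0 r \<subseteq> K" "K \<subseteq> cball 0 R"
    using convex_body_radii[OF assms(1)] .
  have "0 < norm x / R" using assms(2) rR by simp
  also have "\<dots> \<le> gauge_function K x" by (rule gauge_function_bounds(1)[OF rR])
  finally show ?thesis .
qed

lemma gauge_function_scale:
  assumes "K \<in> convex_bodies_o" "c > 0"
  shows "gauge_function K (c *\<^sub>R x) = c * gauge_function K x"
  unfolding gauge_function_def
  using compact_polar_body[OF assms(1)] assms(2) by (intro support_function_scale compact_imp_bounded)

lemma continuous_on_gauge_function: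
  assumes "K \<in> convex_bodies_o"
  shows "continuous_on X (gauge_function K)"
  unfolding gauge_function_def
  using compact_polar_body[OF assms] by (intro continuous_on_support_function compact_imp_bounded)

text \<open>
A point outside \<open>K\<close> is separated from \<open>K\<close> by a hyperplane, which misses the origin and so can be normalised to a
point of the polar body.
\<close>

lemma mem_convex_body_iff_gauge:
  fixes K :: "'a::euclidean_space set"
  assumes "K \<in> convex_bodies_o"
  shows "x \<in> K \<longleftrightarrow> gauge_function K x \<le> 1"
proof
  assume "x \<in> K"
  thus "gauge_function K x \<le> 1"
    unfolding gauge_function_def using compact_polar_body[OF assms]
    by (intro support_function_least) (auto simp: polar_body_def inner_commute)
next
  assume le: "gauge_function K x \<le> 1"
  have K: "compact K" "convex K" "0 \<in> K" using assms interior_subset by (auto simp: convex_bodies_o_def)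
  show "x \<in> K"
  proof (rule ccontr)
    assume "x \<notin> K"
    then obtain a b where ab: "a \<bullet> x < b" "\<forall>y\<in>K. b < a \<bullet> y"
      using separating_hyperplane_closed_point[OF K(2) compact_imp_closed[OF K(1)]] by blast
    have b: "b < 0" using ab(2) K(3) by force
    define p where "p = (1 / b) *\<^sub>R a"
    have "p \<in> polar_body K"
      unfolding polar_body_def p_def using ab(2) b by (auto simp: field_simps less_imp_le)
    hence "x \<bullet> p \<le> gauge_function K x"
      unfolding gauge_function_def by (intro support_function_upper compact_imp_bounded compact_polar_body assms)
    moreover have "x \<bullet> p > 1" using ab(1) b by (simp add: p_def field_simps inner_commute)
    ultimately show False using le by simp
  qed
qed

lemma radial_function_convex_body:
  fixes K :: "'a::euclidean_space set"
  assumes K: "K \<in> convex_bodies_o" and u: "u \<noteq> 0"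
  shows "radial_function K u = 1 / gauge_function K u"
proof -
  note g = gauge_function_pos[OF K u]
  have "insert 0 {t. 0 < t \<and> t *\<^sub>R u \<in> K} = {0..1 / gauge_function K u}"
  proof (intro set_eqI)
    fix t
    show "t \<in> insert 0 {t. 0 < t \<and> t *\<^sub>R u \<in> K} \<longleftrightarrow> t \<in> {0..1 / gauge_function K u}"
    proof (cases "t > 0")
      case True
      thus ?thesis using g by (simp add: mem_convex_body_iff_gauge[OF K] gauge_function_scale[OF K] field_simps)
    next
      case False
      thus ?thesis using g by auto
    qed
  qed
  thus ?thesis using g by (simp add: radial_function_def)
qed

lemma convex_body_is_star_body:
  fixes K :: "'a::euclidean_space set"
  assumes K: "K \<in> convex_bodies_o"
  shows "K \<in> star_bodies"
proof -
  have K': "compact K" "convex K" "0 \<in> K" using K interior_subset by (auto simp: convex_bodies_o_def)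
  have "continuous_on (sphere 0 1) (radial_function K)"
  proof -
    have "continuous_on (sphere 0 1) (\<lambda>u. 1 / gauge_function K u)"
    proof (intro continuous_intros continuous_on_gauge_function[OF K] ballI)
      fix u :: 'a assume "u \<in> sphere 0 1"
      hence "u \<noteq> 0" by auto
      from gauge_function_pos[OF K this] show "gauge_function K u \<noteq> 0" by simp
    qed
    thus ?thesis
    proof (rule continuous_on_eq)
      fix u :: 'a assume "u \<in> sphere 0 1"
      hence "u \<noteq> 0" by auto
      from radial_function_convex_body[OF K this] show "1 / gauge_function K u = radial_function K u" by simp
    qed
  qed
  moreover have "0 < radial_function K u" if "u \<in> sphere 0 1" for u
  proof -
    have "u \<noteq> 0" using that by auto
    thus ?thesis using radial_function_convex_body[OF K] gauge_function_pos[OF K] by simp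
  qed
  ultimately show ?thesis
    using K' by (simp add: star_bodies_def closed_segment_subset)
qed

text \<open>
The subdifferential at \<open>u\<close> of the gauge of \<open>K\<close>.  Its points are the outer normals of \<open>K\<close> at the boundary point in direction \<open>u\<close>,
normalised to have support value 1.
\<close>

definition contact_set :: "'a::euclidean_space set \<Rightarrow> 'a \<Rightarrow> 'a set" where
  "contact_set K u = {p \<in> polar_body K. u \<bullet> p = gauge_function K u}"

lemma contact_set_nonempty:
  assumes "K \<in> convex_bodies_o"
  shows "contact_set K u \<noteq> {}"
proof -
  obtain p where "p \<in> polar_body K" "support_function (polar_body K) u = u \<bullet> p"
    using support_function_attained[OF compact_polar_body[OF assms]] by blast
  hence "p \<in> contact_set K u" by (simp add: contact_set_def gauge_function_def)
  thus ?thesis by blast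
qed

lemma contact_set_scale:
  assumes "K \<in> convex_bodies_o" "c > 0"
  shows "contact_set K (c *\<^sub>R u) = contact_set K u"
  using assms by (auto simp: contact_set_def gauge_function_scale)

lemma support_function_contact:
  assumes K: "K \<in> convex_bodies_o" and p: "p \<in> contact_set K u" and u: "u \<noteq> 0"
  shows "support_function K p = 1"
proof (rule antisym)
  have K': "compact K" "0 \<in> K" using K interior_subset by (auto simp: convex_bodies_o_def)
  note g = gauge_function_pos[OF K u]
  show "support_function K p \<le> 1"
    using p K' by (intro support_function_least) (auto simp: contact_set_def polar_body_def)
  have "(1 / gauge_function K u) *\<^sub>R u \<in> K"
    using g by (simp add: mem_convex_body_iff_gauge[OF K] gauge_function_scale[OF K])
  hence "p \<bullet> ((1 / gauge_function K u) *\<^sub>R u) \<le> support_function K p"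
    by (rule support_function_upper[OF compact_imp_bounded[OF K'(1)]])
  thus "1 \<le> support_function K p" using p g by (simp add: contact_set_def inner_commute)
qed

text \<open>
Outer unit normals at the boundary point \<open>x\<close> in direction \<open>u\<close> and contact points determine each other through
\<open>p = v / (x \<bullet> v)\<close> and \<open>v = sgn p\<close>.
\<close>

lemma radial_gauss_map_unique_contact:
  fixes K :: "'a::euclidean_space set"
  assumes K: "K \<in> convex_bodies_o" and u: "u \<noteq> 0" and p: "contact_set K u = {p}"
  shows "radial_gauss_map K u = sgn p"
proof -
  have K': "compact K" "0 \<in> K" "0 \<in> interior K" using K interior_subset by (auto simp: convex_bodies_o_def)
  note g = gauge_function_pos[OF K u]
  define x where "x = radial_function K u *\<^sub>R u"
  have x: "x = (1 / gauge_function K u) *\<^sub>R u" by (simp add: x_def radial_function_convex_body[OF K u])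
  have gx: "gauge_function K x = 1" unfolding x using g by (simp add: gauge_function_scale[OF K])
  have xK: "x \<in> K" using gx by (simp add: mem_convex_body_iff_gauge[OF K])
  have pp: "p \<in> polar_body K" "u \<bullet> p = gauge_function K u" using p by (auto simp: contact_set_def)
  have xp: "x \<bullet> p = 1" using pp g by (simp add: x)
  hence p0: "p \<noteq> 0" by auto
  have fr: "x \<in> frontier K"
  proof -
    have "x \<notin> interior K"
    proof
      assume "x \<in> interior K"
      then obtain e where e: "e > 0" "cball x e \<subseteq> K" using mem_interior_cball by blast
      have "x + e *\<^sub>R sgn p \<in> K" using e by (intro subsetD[OF e(2)]) (auto simp: dist_norm norm_sgn)
      hence "p \<bullet> (x + e *\<^sub>R sgn p) \<le> 1" using pp(1) by (auto simp: polar_body_def)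
      moreover have "p \<bullet> sgn p > 0" using p0 by (simp add: sgn_div_norm dot_square_norm)
      ultimately show False using xp e by (simp add: inner_add_right inner_commute[of p x])
          (metis mult_pos_pos not_less)
    qed
    thus ?thesis using xK compact_imp_closed[OF K'(1)] by (simp add: frontier_def)
  qed
  show ?thesis
    unfolding radial_gauss_map_def x_def[symmetric]
  proof (rule the_equality)
    show "outer_unit_normal K x (sgn p)"
      unfolding outer_unit_normal_def
    proof (intro conjI ballI fr)
      show "norm (sgn p) = 1" using p0 by (simp add: norm_sgn)
      fix y assume "y \<in> K"
      hence "y \<bullet> p \<le> 1" using pp(1) by (auto simp: polar_body_def inner_commute)
      hence "inverse (norm p) * (y \<bullet> p) \<le> inverse (norm p) * 1" by (intro mult_left_mono) simp_all
      thus "y \<bullet> sgn p \<le> x \<bullet> sgn p" using xp by (simp add: sgn_div_norm)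
    qed
  next
    fix v assume v: "outer_unit_normal K x v"
    hence n: "norm v = 1" and le: "\<And>y. y \<in> K \<Longrightarrow> y \<bullet> v \<le> x \<bullet> v" by (auto simp: outer_unit_normal_def)
    obtain r where r: "r > 0" "cball 0 r \<subseteq> K" using K'(3) mem_interior_cball by blast
    have "r *\<^sub>R v \<in> K" using r n by (intro subsetD[OF r(2)]) auto
    from le[OF this] have xv: "x \<bullet> v > 0" using r n by (simp add: dot_square_norm)
    have "(1 / (x \<bullet> v)) *\<^sub>R v \<in> contact_set K u"
    proof -
      have "(1 / (x \<bullet> v)) *\<^sub>R v \<in> polar_body K"
        using le xv by (auto simp: polar_body_def inner_commute)
      moreover have "u = gauge_function K u *\<^sub>R x" using g by (simp add: x)
      hence "u \<bullet> v = gauge_function K u * (x \<bullet> v)" by (metis inner_scaleR_left)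
      ultimately show ?thesis using xv by (simp add: contact_set_def)
    qed
    hence "p = (1 / (x \<bullet> v)) *\<^sub>R v" using p by simp
    thus "v = sgn p" using xv n by (simp add: sgn_scaleR sgn_div_norm)
  qed
qed

definition smooth_points :: "'a::euclidean_space set \<Rightarrow> 'a set" where
  "smooth_points K = (\<Inter>b\<in>Basis. symmetric_derivative_set (gauge_function K) b)"

lemma smooth_points_borel: "K \<in> convex_bodies_o \<Longrightarrow> smooth_points K \<in> sets borel"
  unfolding smooth_points_def
  by (intro sets.finite_INT symmetric_derivative_set_borel continuous_on_gauge_function) auto

lemma smooth_points_null:
  assumes K: "K \<in> convex_bodies_o"
  shows "- smooth_points K \<in> null_sets lborel"
proof -
  note pc = compact_polar_body[OF K]
  obtain r R where rR: "0 < r" "0 < R" "cball 0 r \<subseteq> K" "K \<subseteq> cball 0 R"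
    using convex_body_radii[OF K] .
  have "- symmetric_derivative_set (gauge_function K) b \<in> null_sets lborel" if "b \<in> Basis" for b
  proof (rule symmetric_derivative_set_null)
    show "\<bar>gauge_function K x - gauge_function K y\<bar> \<le> (1 / r) * norm (x - y)" for x y
      unfolding gauge_function_def by (rule support_function_lipschitz[OF pc(2) polar_body_bounds(1)[OF rR]])
    show "0 \<le> gauge_function K (x + y) + gauge_function K (x - y) - 2 * gauge_function K x" for x y
      using support_function_add_le[OF compact_imp_bounded[OF pc(1)] pc(2), of "x + y" "x - y"]
        gauge_function_scale[OF K, of 2 x]
      by (simp add: gauge_function_def scaleR_2)
  qed (use that rR in auto)
  moreover have "- smooth_points K = (\<Union>b\<in>Basis. - symmetric_derivative_set (gauge_function K) b)"
    by (auto simp: smooth_points_def)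
  ultimately show ?thesis
    by (auto intro!: null_sets_UN' countable_finite)
qed

lemma smooth_points_scale:
  assumes K: "K \<in> convex_bodies_o" and x: "x \<in> smooth_points K" and c: "c > 0"
  shows "c *\<^sub>R x \<in> smooth_points K"
  unfolding smooth_points_def symmetric_derivative_set_def
proof (clarify)
  fix b :: 'a and e :: real assume "b \<in> Basis" "e > 0"
  then obtain t where t: "t > 0" "gauge_function K (x + t *\<^sub>R b) + gauge_function K (x - t *\<^sub>R b) - 2 * gauge_function K x < e * t"
    using x by (auto simp: smooth_points_def symmetric_derivative_set_def)
  have eq: "c *\<^sub>R x + (c * t) *\<^sub>R b = c *\<^sub>R (x + t *\<^sub>R b)" "c *\<^sub>R x - (c * t) *\<^sub>R b = c *\<^sub>R (x - t *\<^sub>R b)"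
    by (simp_all add: scaleR_add_right scaleR_diff_right)
  have "c * (gauge_function K (x + t *\<^sub>R b) + gauge_function K (x - t *\<^sub>R b) - 2 * gauge_function K x) < c * (e * t)"
    using t c by simp
  hence "gauge_function K (c *\<^sub>R x + (c * t) *\<^sub>R b) + gauge_function K (c *\<^sub>R x - (c * t) *\<^sub>R b)
      - 2 * gauge_function K (c *\<^sub>R x) < e * (c * t)"
    unfolding eq gauge_function_scale[OF K c] by (simp add: algebra_simps)
  thus "\<exists>t>0. gauge_function K (c *\<^sub>R x + t *\<^sub>R b) + gauge_function K (c *\<^sub>R x - t *\<^sub>R b)
      - 2 * gauge_function K (c *\<^sub>R x) < e * t"
    using t c by (intro exI[of _ "c * t"]) auto
qed

lemma smooth_points_nonzero:
  assumes K: "K \<in> convex_bodies_o" and x: "x \<in> smooth_points K"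
  shows "x \<noteq> 0"
proof
  assume x0: "x = 0"
  obtain b :: 'a where b: "b \<in> Basis" using nonempty_Basis by blast
  have nb: "b \<noteq> 0" using b by auto
  let ?e = "gauge_function K b"
  have g: "?e > 0" "gauge_function K (- b) > 0" using gauge_function_pos[OF K] nb by auto
  have g0: "gauge_function K 0 = 0"
    using gauge_function_scale[OF K, of 2 0] by simp
  obtain t where t: "t > 0" "gauge_function K (x + t *\<^sub>R b) + gauge_function K (x - t *\<^sub>R b) - 2 * gauge_function K x < ?e * t"
    using x b g(1) by (auto simp: smooth_points_def symmetric_derivative_set_def)
  have "gauge_function K (t *\<^sub>R b) = t * ?e" "gauge_function K (t *\<^sub>R (- b)) = t * gauge_function K (- b)"
    using t by (simp_all only: gauge_function_scale[OF K])
  thus False using t g x0 g0 by (simp add: mult.commute) (metis mult_pos_pos not_less_iff_gr_or_eq)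
qed

text \<open>
Two subgradients at \<open>x\<close> differ in direction \<open>b\<close> by at most the second difference of the gauge divided by the step.
\<close>

lemma contact_set_smooth_unique:
  assumes K: "K \<in> convex_bodies_o" and x: "x \<in> smooth_points K"
    and pq: "p \<in> contact_set K x" "q \<in> contact_set K x"
  shows "p = q"
proof -
  have up: "y \<bullet> r \<le> gauge_function K y" if "r \<in> contact_set K x" for y r
    unfolding gauge_function_def using that compact_polar_body[OF K]
    by (intro support_function_upper compact_imp_bounded) (auto simp: contact_set_def)
  have le: "b \<bullet> p - b \<bullet> q \<le> 0" if b: "b \<in> Basis" and pq: "p \<in> contact_set K x" "q \<in> contact_set K x" for b p q
  proof (rule field_le_epsilon)
    fix e :: real assume "e > 0"
    then obtain t where t: "t > 0" "gauge_function K (x + t *\<^sub>R b) + gauge_function K (x - t *\<^sub>R b) - 2 * gauge_function K x < e * t"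
      using x b by (auto simp: smooth_points_def symmetric_derivative_set_def)
    have "x \<bullet> p = gauge_function K x" "x \<bullet> q = gauge_function K x" using pq by (auto simp: contact_set_def)
    hence "t * (b \<bullet> p - b \<bullet> q) < t * e"
      using up[OF pq(1), of "x + t *\<^sub>R b"] up[OF pq(2), of "x - t *\<^sub>R b"] t(2)
      by (simp add: inner_add_left inner_diff_left algebra_simps)
    thus "b \<bullet> p - b \<bullet> q \<le> 0 + e" using t by simp
  qed
  show ?thesis
  proof (rule euclidean_eqI)
    fix b :: 'a assume b: "b \<in> Basis"
    show "p \<bullet> b = q \<bullet> b" using le[OF b pq] le[OF b pq(2,1)] by (simp add: inner_commute)
  qed
qed

definition contact_point :: "'a::euclidean_space set \<Rightarrow> 'a \<Rightarrow> 'a" where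
  "contact_point K u = (SOME p. p \<in> contact_set K u)"

lemma contact_point_in: "K \<in> convex_bodies_o \<Longrightarrow> contact_point K u \<in> contact_set K u"
  unfolding contact_point_def using contact_set_nonempty by (metis ex_in_conv someI_ex)

text \<open>
The graph is closed, because the contact condition is closed and has only one solution at a smooth point, and the values lie in the
compact polar body.
\<close>

lemma continuous_on_contact_point:
  assumes K: "K \<in> convex_bodies_o"
  shows "continuous_on (smooth_points K) (contact_point K)"
proof -
  let ?S = "smooth_points K" and ?T = "polar_body K"
  have im: "contact_point K \<in> ?S \<rightarrow> ?T" using contact_point_in[OF K] by (auto simp: contact_set_def)
  have "(\<lambda>x. (x, contact_point K x)) ` ?S = (?S \<times> ?T) \<inter> {z. fst z \<bullet> snd z = gauge_function K (fst z)}"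
  proof (intro set_eqI iffI)
    fix z assume "z \<in> (\<lambda>x. (x, contact_point K x)) ` ?S"
    thus "z \<in> (?S \<times> ?T) \<inter> {z. fst z \<bullet> snd z = gauge_function K (fst z)}"
      using contact_point_in[OF K] by (auto simp: contact_set_def)
  next
    fix z assume z: "z \<in> (?S \<times> ?T) \<inter> {z. fst z \<bullet> snd z = gauge_function K (fst z)}"
    hence "snd z \<in> contact_set K (fst z)" "fst z \<in> ?S" by (auto simp: contact_set_def)
    hence "snd z = contact_point K (fst z)"
      using contact_set_smooth_unique[OF K] contact_point_in[OF K] by blast
    hence "z = (fst z, contact_point K (fst z))" by (simp add: prod_eq_iff)
    thus "z \<in> (\<lambda>x. (x, contact_point K x)) ` ?S"
      using \<open>fst z \<in> ?S\<close> by (rule image_eqI)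
  qed
  moreover have "closed {z. fst z \<bullet> snd z = gauge_function K (fst z)}"
    by (intro closed_Collect_eq continuous_intros continuous_on_compose2[OF continuous_on_gauge_function[OF K, of UNIV]]) auto
  ultimately have "closedin (top_of_set (?S \<times> ?T)) ((\<lambda>x. (x, contact_point K x)) ` ?S)"
    by (simp add: closedin_closed_Int)
  thus ?thesis
    using continuous_closed_graph_eq[OF compact_polar_body(1)[OF K] im] by blast
qed

text \<open>
By \<open>support_ratio_gauss_map\<close> this is \<open>h\<^sub>L / h\<^sub>K\<close> at the normal in direction \<open>u\<close> if that normal is unique.  The value 1
elsewhere makes it a Borel function between positive bounds.
\<close>

definition support_ratio :: "'a::euclidean_space set \<Rightarrow> 'a set \<Rightarrow> 'a \<Rightarrow> real" where
  "support_ratio K L u = (if u \<in> smooth_points K then support_function L (contact_point K u) else 1)"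

lemma support_ratio_gauss_map:
  assumes K: "K \<in> convex_bodies_o" and L: "L \<in> convex_bodies_o" and u: "u \<in> smooth_points K"
  shows "support_function L (radial_gauss_map K u) / support_function K (radial_gauss_map K u) = support_ratio K L u"
proof -
  let ?p = "contact_point K u"
  have p: "?p \<in> contact_set K u" by (rule contact_point_in[OF K])
  have "contact_set K u = {?p}" using contact_set_smooth_unique[OF K u] p by blast
  note gm = radial_gauss_map_unique_contact[OF K smooth_points_nonzero[OF K u] this]
  have hK: "support_function K ?p = 1" by (rule support_function_contact[OF K p smooth_points_nonzero[OF K u]])
  have bK: "bounded K" "K \<noteq> {}" and bL: "bounded L" "L \<noteq> {}"
    using K L compact_imp_bounded by (auto simp: convex_bodies_o_def)
  have "?p \<noteq> 0"
    using hK support_function_le_norm[OF bK(2), of _ 0] bK(1) by (auto simp: support_function_def bK(2))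
  hence n: "1 / norm ?p > 0" by simp
  have "sgn ?p = (1 / norm ?p) *\<^sub>R ?p" by (simp add: sgn_div_norm inverse_eq_divide)
  hence "support_function L (sgn ?p) = (1 / norm ?p) * support_function L ?p"
      "support_function K (sgn ?p) = (1 / norm ?p) * support_function K ?p"
    using support_function_scale[OF bK n] support_function_scale[OF bL n] by simp_all
  thus ?thesis using n u hK by (simp add: gm support_ratio_def)
qed

lemma support_ratio_borel:
  assumes K: "K \<in> convex_bodies_o" and L: "L \<in> convex_bodies_o"
  shows "support_ratio K L \<in> borel_measurable borel"
proof -
  have L': "bounded L" "L \<noteq> {}" using L compact_imp_bounded by (auto simp: convex_bodies_o_def)
  note S [measurable] = smooth_points_borel[OF K]
  have "continuous_on (smooth_points K) (\<lambda>u. support_function L (contact_point K u))"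
    by (rule continuous_on_compose2[OF continuous_on_support_function[OF L', of UNIV] continuous_on_contact_point[OF K]]) simp
  from borel_measurable_continuous_on_indicator[OF S this]
  have [measurable]: "(\<lambda>u. indicator (smooth_points K) u *\<^sub>R support_function L (contact_point K u)) \<in> borel_measurable borel" .
  have "support_ratio K L = (\<lambda>u. indicator (smooth_points K) u *\<^sub>R support_function L (contact_point K u) + indicator (- smooth_points K) u)"
    by (auto simp: support_ratio_def indicator_def)
  also have "\<dots> \<in> borel_measurable borel" by measurable
  finally show ?thesis .
qed

lemma support_ratio_bounds:
  assumes K: "K \<in> convex_bodies_o" and L: "L \<in> convex_bodies_o"
  shows "\<exists>a>0. \<exists>b. \<forall>u. a \<le> support_ratio K L u \<and> support_ratio K L u \<le> b"
proof -
  obtain r R where rR: "0 < r" "0 < R" "cball 0 r \<subseteq> K" "K \<subseteq> cball 0 R" using convex_body_radii[OF K] .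
  obtain s T where sT: "0 < s" "0 < T" "cball 0 s \<subseteq> L" "L \<subseteq> cball 0 T" using convex_body_radii[OF L] .
  have L': "bounded L" "L \<noteq> {}" using L compact_imp_bounded by (auto simp: convex_bodies_o_def)
  have K': "bounded K" "K \<noteq> {}" using K compact_imp_bounded by (auto simp: convex_bodies_o_def)
  have "s / R \<le> support_function L (contact_point K u)" "support_function L (contact_point K u) \<le> T / r"
    if u: "u \<in> smooth_points K" for u
  proof -
    let ?p = "contact_point K u"
    have p: "?p \<in> contact_set K u" by (rule contact_point_in[OF K])
    have "norm ?p \<le> 1 / r" using p polar_body_bounds(1)[OF rR] by (auto simp: contact_set_def)
    hence "T * norm ?p \<le> T * (1 / r)" using sT by (intro mult_left_mono) auto
    thus "support_function L ?p \<le> T / r" using support_function_le_norm[OF L'(2) sT(4), of ?p] by simp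
    have "1 \<le> R * norm ?p"
      using support_function_contact[OF K p smooth_points_nonzero[OF K u]] support_function_le_norm[OF K'(2) rR(4), of ?p] by simp
    hence "1 / R \<le> norm ?p" using rR by (simp add: field_simps)
    hence "s * (1 / R) \<le> s * norm ?p" using sT by (intro mult_left_mono) auto
    thus "s / R \<le> support_function L ?p" using support_function_ge_norm[OF L'(1) sT(3), of ?p] sT by simp
  qed
  hence "min 1 (s / R) \<le> support_ratio K L u \<and> support_ratio K L u \<le> max 1 (T / r)" for u
    by (auto simp: support_ratio_def min_le_iff_disj le_max_iff_disj)
  moreover have "min 1 (s / R) > 0" using sT rR by simp
  ultimately show ?thesis by blast
qed

section \<open>Jensen's inequality\<close>

lemma set_integrable_bounded_finite:
  fixes f :: "'a::euclidean_space \<Rightarrow> real"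
  assumes "A \<in> sets borel" "emeasure lborel A < \<infinity>" "f \<in> borel_measurable borel" "\<And>x. \<bar>f x\<bar> \<le> B"
  shows "set_integrable lborel A f"
  unfolding set_integrable_def
  by (rule integrableI_bounded_set_indicator[where B = B]) (use assms in auto)

lemma convex_on_support_line:
  fixes f :: "real \<Rightarrow> real"
  assumes "convex_on {0<..} f" "0 < m"
  obtains k where "\<And>y. 0 < y \<Longrightarrow> f m + k * (y - m) \<le> f y"
proof -
  have "f y \<ge> f m + (Inf ((\<lambda>t. (f m - f t) / (m - t)) ` ({m<..} \<inter> {0<..}))) * (y - m)" if "0 < y" for y
    using assms that by (intro convex_le_Inf_differential) (auto simp: interior_open)
  thus ?thesis using that by blast
qed

lemma strictly_convex_on_midpoint:
  fixes f :: "real \<Rightarrow> real"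
  assumes "strictly_convex_on {0<..} f" "0 < x" "0 < y" "x \<noteq> y"
  shows "f ((x + y) / 2) < (f x + f y) / 2"
proof -
  have "f ((1 - 1 / 2) *\<^sub>R x + (1 / 2) *\<^sub>R y) < (1 - 1 / 2) * f x + (1 / 2) * f y"
    using assms(1)[unfolded strictly_convex_on_def, THEN conjunct2, rule_format, of x y "1 / 2"] assms(2-4) by simp
  thus ?thesis by (simp add: add_divide_distrib)
qed

lemma strictly_convex_on_support_line_strict:
  fixes f :: "real \<Rightarrow> real"
  assumes sc: "strictly_convex_on {0<..} f" and m: "0 < m" and y: "0 < y"
    and k: "\<And>y. 0 < y \<Longrightarrow> f m + k * (y - m) \<le> f y"
    and eq: "f y = f m + k * (y - m)"
  shows "y = m"
proof (rule ccontr)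
  assume "y \<noteq> m"
  hence "f ((y + m) / 2) < (f y + f m) / 2"
    by (rule strictly_convex_on_midpoint[OF sc y m])
  also have "\<dots> = f m + k * ((y + m) / 2 - m)"
    unfolding eq by (simp add: field_simps)
  also have "\<dots> \<le> f ((y + m) / 2)"
    using m y by (intro k) auto
  finally show False by simp
qed

lemma convex_on_comp_borel:
  fixes f :: "real \<Rightarrow> real" and X :: "'a::euclidean_space \<Rightarrow> real"
  assumes f: "convex_on {0<..} f" and X [measurable]: "X \<in> borel_measurable borel" and pos: "\<And>x. 0 < X x"
  shows "(\<lambda>x. f (X x)) \<in> borel_measurable borel"
proof -
  have "continuous_on {0<..} f" by (rule convex_on_continuous[OF open_greaterThan f])
  hence [measurable]: "(\<lambda>x. indicator {0<..} x *\<^sub>R f x) \<in> borel_measurable borel"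
    by (intro borel_measurable_continuous_on_indicator) auto
  have "(\<lambda>x. f (X x)) = (\<lambda>x. indicator {0<..} (X x) *\<^sub>R f (X x))" using pos by auto
  also have "\<dots> \<in> borel_measurable borel" by measurable
  finally show ?thesis .
qed

lemma mono_pos_comp_bounds:
  fixes f :: "real \<Rightarrow> real"
  assumes "f \<in> {0<..} \<rightarrow> {0<..}" "mono_on {0<..} f" "0 < a" "\<And>x. a \<le> X x" "\<And>x. X x \<le> b"
  shows "0 < f a" "f a \<le> f (X x)" "f (X x) \<le> f b"
proof -
  have "0 < X x" for x using assms(3) assms(4)[of x] by linarith
  moreover have "0 < b" using assms(3) assms(4)[of x] assms(5)[of x] by linarith
  ultimately show "0 < f a" "f a \<le> f (X x)" "f (X x) \<le> f b"
    using assms by (auto intro: mono_onD)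
qed

text \<open>
Integrate the gap between \<open>f (X x)\<close> and a supporting line of \<open>f\<close> at the mean \<open>m\<close>: it is nonnegative, and for strictly convex
\<open>f\<close> it vanishes only where \<open>X x = m\<close>.
\<close>

lemma jensen_set_integral:
  fixes f :: "real \<Rightarrow> real" and X :: "'a::euclidean_space \<Rightarrow> real"
  assumes A: "A \<in> sets borel" "emeasure lborel A < \<infinity>" "0 < measure lborel A"
    and f: "f \<in> {0<..} \<rightarrow> {0<..}" "mono_on {0<..} f" "convex_on {0<..} f"
    and X: "X \<in> borel_measurable borel" "0 < a" "\<And>x. a \<le> X x" "\<And>x. X x \<le> b"
  defines "m \<equiv> (LINT x:A|lborel. X x) / measure lborel A"
  shows "0 < m"
    and "f m * measure lborel A \<le> (LINT x:A|lborel. f (X x))"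
    and "strictly_convex_on {0<..} f \<Longrightarrow> (LINT x:A|lborel. f (X x)) = f m * measure lborel A \<Longrightarrow>
      AE x in lborel. x \<in> A \<longrightarrow> X x = m"
proof -
  have Xpos: "0 < X x" for x using X(2) X(3)[of x] by linarith
  have bX: "\<bar>X x\<bar> \<le> b" for x using Xpos[of x] X(4)[of x] by simp
  have iX: "set_integrable lborel A X" by (rule set_integrable_bounded_finite[OF A(1,2) X(1) bX])
  have "\<bar>f (X x)\<bar> \<le> f b" for x
    using mono_pos_comp_bounds(1)[where X = X, OF f(1,2) X(2-4)]
      mono_pos_comp_bounds(2,3)[where X = X and x = x, OF f(1,2) X(2-4)] by linarith
  note ifX = set_integrable_bounded_finite[OF A(1,2) convex_on_comp_borel[OF f(3) X(1) Xpos] this]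
  have ic: "set_integrable lborel A (\<lambda>x. c)" for c :: real
    using A by (intro set_integrable_bounded_finite[where B = "\<bar>c\<bar>"]) auto
  have Ic: "(LINT x:A|lborel. c) = c * measure lborel A" for c :: real
    using A by (simp add: set_lebesgue_integral_def less_top mult.commute)
  have "a * measure lborel A \<le> (LINT x:A|lborel. X x)"
    unfolding Ic[symmetric] by (rule set_integral_mono[OF ic iX]) (use X(3) in auto)
  hence "a \<le> m" using A(3) by (simp add: m_def field_simps)
  thus m: "0 < m" using X(2) by linarith
  have mA: "(LINT x:A|lborel. X x) = m * measure lborel A" using A(3) by (simp add: m_def)
  obtain k where k: "\<And>y. 0 < y \<Longrightarrow> f m + k * (y - m) \<le> f y"
    using convex_on_support_line[OF f(3) m] by blast
  define h where "h x = f (X x) - (f m + k * (X x - m))" for x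
  have h0: "0 \<le> h x" for x using k[OF Xpos[of x]] by (simp add: h_def)
  have il: "set_integrable lborel A (\<lambda>x. f m + k * (X x - m))"
    using iX ic by (intro set_integral_add set_integrable_mult_right set_integral_diff) auto
  have ih: "set_integrable lborel A h" unfolding h_def by (rule set_integral_diff[OF ifX il])
  have "(LINT x:A|lborel. f m + k * (X x - m)) = (LINT x:A|lborel. f m) + (LINT x:A|lborel. k * (X x - m))"
    using iX ic by (intro set_integral_add set_integrable_mult_right set_integral_diff) auto
  also have "(LINT x:A|lborel. k * (X x - m)) = k * ((LINT x:A|lborel. X x) - (LINT x:A|lborel. m))"
    using iX ic by (simp add: set_integral_diff)
  finally have "(LINT x:A|lborel. f m + k * (X x - m)) = f m * measure lborel A"
    by (simp add: Ic mA)
  hence Ih: "(LINT x:A|lborel. h x) = (LINT x:A|lborel. f (X x)) - f m * measure lborel A"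
    unfolding h_def using set_integral_diff(2)[OF ifX il] by simp
  have "0 \<le> (LINT x:A|lborel. h x)"
    unfolding set_lebesgue_integral_def by (intro integral_nonneg_AE AE_I2) (use h0 in auto)
  thus "f m * measure lborel A \<le> (LINT x:A|lborel. f (X x))" using Ih by simp
  assume sc: "strictly_convex_on {0<..} f" and eq: "(LINT x:A|lborel. f (X x)) = f m * measure lborel A"
  have "(LINT x|lborel. indicator A x *\<^sub>R h x) = 0" using Ih eq by (simp add: set_lebesgue_integral_def)
  hence "AE x in lborel. indicator A x *\<^sub>R h x = 0"
    using ih h0 unfolding set_integrable_def by (subst (asm) integral_nonneg_eq_0_iff_AE) auto
  thus "AE x in lborel. x \<in> A \<longrightarrow> X x = m"
  proof eventually_elim
    case (elim x)
    show ?case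
    proof
      assume "x \<in> A"
      hence "f (X x) = f m + k * (X x - m)" using elim by (simp add: h_def)
      from strictly_convex_on_support_line_strict[OF sc m Xpos _ this] k show "X x = m" by blast
    qed
  qed
qed

lemma strictly_convex_mono_imp_less:
  fixes f :: "real \<Rightarrow> real"
  assumes sc: "strictly_convex_on {0<..} f" and mono: "mono_on {0<..} f" and xy: "0 < x" "x < y"
  shows "f x < f y"
proof -
  have "f x \<le> f y" using mono xy by (auto intro: mono_onD)
  moreover have "f x \<noteq> f y"
  proof
    assume eq: "f x = f y"
    have "f ((x + y) / 2) < (f x + f y) / 2"
      using xy by (intro strictly_convex_on_midpoint[OF sc]) auto
    moreover have "f x \<le> f ((x + y) / 2)"
      using xy by (intro mono_onD[OF mono]) auto
    ultimately show False using eq by simp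
  qed
  ultimately show ?thesis by simp
qed

section \<open>Minkowski's first inequality\<close>

lemma convex_body_measure:
  assumes "K \<in> convex_bodies_o"
  shows "K \<in> sets borel" "emeasure lborel K < \<infinity>" "0 < measure lborel K" "measure lebesgue K = measure lborel K"
proof -
  obtain r R where rR: "0 < r" "0 < R" "cball 0 r \<subseteq> K" "K \<subseteq> cball 0 R" using convex_body_radii[OF assms] .
  have "compact K" using assms by (simp add: convex_bodies_o_def)
  thus K: "K \<in> sets borel" by (rule borel_compact)
  show fin: "emeasure lborel K < \<infinity>" using emeasure_compact_finite[OF \<open>compact K\<close>] by simp
  have "0 < measure lborel (cball (0::'a) r)" using rR by (simp add: content_cball)
  also have "\<dots> \<le> measure lborel K"
    using rR K fin by (intro measure_mono_fmeasurable) (auto simp: fmeasurable_def)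
  finally show "0 < measure lborel K" .
  show "measure lebesgue K = measure lborel K" using K by (simp add: measure_completion)
qed

lemma star_body_measure:
  assumes "Q \<in> star_bodies"
  shows "Q \<in> sets borel" "emeasure lborel Q < \<infinity>" "0 < measure lborel Q" "measure lebesgue Q = measure lborel Q"
proof -
  have "compact Q" using assms by (simp add: star_bodies_def)
  thus Q: "Q \<in> sets borel" by (rule borel_compact)
  show fin: "emeasure lborel Q < \<infinity>" using emeasure_compact_finite[OF \<open>compact Q\<close>] by simp
  obtain a b where a: "a > 0" "\<And>u. a \<le> radial_ext Q u" using radial_ext_props(2)[OF assms] by blast
  have "cball 0 a \<subseteq> Q" by (subst star_body_eq[OF assms]) (use a in \<open>auto intro: order_trans\<close>)
  have "0 < measure lborel (cball (0::'a) a)" using a by (simp add: content_cball)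
  also have "\<dots> \<le> measure lborel Q"
    using \<open>cball 0 a \<subseteq> Q\<close> Q fin by (intro measure_mono_fmeasurable) (auto simp: fmeasurable_def)
  finally show "0 < measure lborel Q" .
  show "measure lebesgue Q = measure lborel Q" using Q by (simp add: measure_completion)
qed

lemma set_integral_star_body:
  fixes Q :: "'a::euclidean_space set"
  assumes "Q \<in> star_bodies" "G \<in> borel_measurable borel"
  shows "(LINT x:Q|lborel. G (sgn x)) = (LINT x:cball 0 1|lborel. radial_ext Q (sgn x) ^ DIM('a) * G (sgn x))"
proof -
  obtain a b where a: "a > 0" "\<And>u. a \<le> radial_ext Q u" using radial_ext_props(2)[OF assms(1)] by blast
  show ?thesis
    by (subst star_body_eq[OF assms(1)]) (rule set_integral_radial_body[OF radial_ext_props(1)[OF assms(1)] a(2,1) assms(2)])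
qed

lemma power_one_plus_le:
  fixes y Y :: real
  assumes "0 \<le> y" "y \<le> Y"
  shows "(1 + y) ^ n \<le> 1 + y * (\<Sum>i<n. (1 + Y) ^ i)"
proof -
  have "(1 + y) ^ n - 1 = y * (\<Sum>i<n. (1 + y) ^ i)"
    using power_diff_1_eq[of "1 + y" n] by simp
  moreover have "y * (\<Sum>i<n. (1 + y) ^ i) \<le> y * (\<Sum>i<n. (1 + Y) ^ i)"
    using assms by (intro mult_left_mono sum_mono power_mono) auto
  ultimately show ?thesis by linarith
qed

text \<open>
For \<open>x = k + e l\<close> with contact point \<open>p\<close> in direction \<open>x\<close> we have \<open>p \<bullet> k \<le> 1\<close> and \<open>p \<bullet> l \<le> h\<^sub>L(p)\<close>, so the radial
function of the sum is at most that of \<open>K\<close> times \<open>1 + e h\<^sub>L(p)\<close>.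
\<close>

lemma measure_minkowski_sum_le:
  fixes K L :: "'a::euclidean_space set"
  assumes K: "K \<in> convex_bodies_o" and L: "L \<in> convex_bodies_o" and e: "e > 0"
  shows "measure lborel {x + e *\<^sub>R y | x y. x \<in> K \<and> y \<in> L} \<le> (LINT x:K|lborel. (1 + e * support_ratio K L (sgn x)) ^ DIM('a))"
proof -
  let ?M = "{x + e *\<^sub>R y | x y. x \<in> K \<and> y \<in> L}"
  have Ks: "K \<in> star_bodies" by (rule convex_body_is_star_body[OF K])
  have cK: "compact K" and cL: "compact L" "L \<noteq> {}" using K L by (auto simp: convex_bodies_o_def)
  have M: "?M \<in> sets borel" using borel_compact[OF compact_lincomb[OF cK cL(1), of 1 e]] by simp
  obtain a b where a: "a > 0" "\<And>u. a \<le> radial_ext K u" "\<And>u. radial_ext K u \<le> b" using radial_ext_props(2)[OF Ks] by blast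
  obtain c d where c: "c > 0" "\<And>u. c \<le> support_ratio K L u" "\<And>u. support_ratio K L u \<le> d" using support_ratio_bounds[OF K L] by blast
  note [measurable] = radial_ext_props(1)[OF Ks] support_ratio_borel[OF K L]
  define \<rho> where "\<rho> u = radial_ext K u * (1 + e * support_ratio K L u)" for u
  have \<rho>: "\<rho> \<in> borel_measurable borel" unfolding \<rho>_def[abs_def] by measurable
  have \<rho>a: "a \<le> \<rho> u" for u
  proof -
    have "a * 1 \<le> radial_ext K u * (1 + e * support_ratio K L u)"
      using a(1) a(2)[of u] c(1) c(2)[of u] e by (intro mult_mono) auto
    thus ?thesis by (simp add: \<rho>_def)
  qed
  have \<rho>b: "\<rho> u \<le> b * (1 + e * d)" for u
    unfolding \<rho>_def using a(1) a(2)[of u] a(3)[of u] c(1) c(2)[of u] c(3)[of u] e by (intro mult_mono) auto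
  let ?W = "{x. norm x \<le> \<rho> (sgn x)}"
  have W: "?W \<in> sets borel" using \<rho> by measurable
  have Wfin: "emeasure lborel ?W < \<infinity>"
  proof -
    have "?W \<subseteq> cball 0 (b * (1 + e * d))"
    proof
      fix x assume "x \<in> ?W"
      thus "x \<in> cball 0 (b * (1 + e * d))" using \<rho>b[of "sgn x"] by simp
    qed
    hence "bounded ?W" using bounded_cball bounded_subset by blast
    thus ?thesis by (rule emeasure_bounded_finite)
  qed
  \<comment> \<open>The half-space bound, which places the sum inside the radial body \<open>?W\<close> up to a null set.\<close>
  have sub: "x \<in> ?W" if x: "x \<in> ?M" "x \<in> smooth_points K" for x
  proof -
    obtain k l where kl: "k \<in> K" "l \<in> L" "x = k + e *\<^sub>R l" using x(1) by blast
    have x0: "x \<noteq> 0" by (rule smooth_points_nonzero[OF K x(2)])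
    have sx: "sgn x \<in> smooth_points K"
      using smooth_points_scale[OF K x(2), of "inverse (norm x)"] x0 by (simp add: sgn_div_norm)
    let ?p = "contact_point K (sgn x)"
    have p: "?p \<in> contact_set K (sgn x)" by (rule contact_point_in[OF K])
    have g: "gauge_function K (sgn x) > 0" using x0 by (intro gauge_function_pos[OF K]) (simp add: sgn_zero_iff)
    have F: "support_ratio K L (sgn x) = support_function L ?p" using sx by (simp add: support_ratio_def)
    have R: "radial_ext K (sgn x) = 1 / gauge_function K (sgn x)"
      using x0 radial_function_convex_body[OF K, of "sgn x"] by (simp add: radial_ext_def norm_sgn sgn_zero_iff)
    have "norm x * gauge_function K (sgn x) = (norm x *\<^sub>R sgn x) \<bullet> ?p"
      using p by (simp add: contact_set_def)
    also have "norm x *\<^sub>R sgn x = x" using x0 by (simp add: sgn_div_norm)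
    also have "x \<bullet> ?p = ?p \<bullet> k + e * (?p \<bullet> l)"
    proof -
      have "(k + e *\<^sub>R l) \<bullet> q = q \<bullet> k + e * (q \<bullet> l)" for q
        by (simp add: inner_add_left inner_commute[of q])
      thus ?thesis unfolding kl(3) .
    qed
    also have "\<dots> \<le> 1 + e * support_function L ?p"
      using p kl e support_function_upper[OF compact_imp_bounded[OF cL(1)] kl(2), of ?p]
      by (intro add_mono mult_left_mono) (auto simp: contact_set_def polar_body_def)
    finally have "norm x \<le> (1 + e * support_function L ?p) / gauge_function K (sgn x)"
      using g by (simp add: field_simps)
    thus ?thesis by (simp add: \<rho>_def R F)
  qed
  have "emeasure lborel ?M \<le> emeasure lborel (?W \<union> - smooth_points K)"
    using sub W smooth_points_borel[OF K] by (intro emeasure_mono) auto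
  also have "\<dots> = emeasure lborel ?W"
    using W smooth_points_null[OF K] by (intro emeasure_Un_null_set) auto
  finally have "measure lborel ?M \<le> measure lborel ?W"
    using Wfin by (simp add: measure_def enn2real_mono)
  also have "measure lborel ?W = (LINT x:?W|lborel. 1)"
    using W Wfin by (simp add: set_lebesgue_integral_def)
  also have "\<dots> = (LINT x:cball 0 1|lborel. \<rho> (sgn x) ^ DIM('a) * 1)"
    by (rule set_integral_radial_body[OF \<rho> \<rho>a a(1), of "\<lambda>_. 1"]) simp
  also have "\<dots> = (LINT x:cball 0 1|lborel. radial_ext K (sgn x) ^ DIM('a) * (1 + e * support_ratio K L (sgn x)) ^ DIM('a))"
    by (simp add: \<rho>_def power_mult_distrib)
  also have "\<dots> = (LINT x:K|lborel. (1 + e * support_ratio K L (sgn x)) ^ DIM('a))"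
    by (rule set_integral_star_body[OF Ks, of "\<lambda>u. (1 + e * support_ratio K L u) ^ DIM('a)", symmetric]) measurable
  finally show ?thesis .
qed

text \<open>
Compare the lower bound of the Brunn--Minkowski inequality for the volume of \<open>K + e L\<close> with the upper bound of
\<open>measure_minkowski_sum_le\<close>.  The former is linearised by Bernoulli's inequality, the latter by
\<open>power_one_plus_le\<close>; the constant terms cancel, and \<open>e\<close> tends to zero.
\<close>

theorem minkowski_first_inequality:
  fixes K L :: "'a::euclidean_space set"
  assumes K: "K \<in> convex_bodies_o" and L: "L \<in> convex_bodies_o"
  shows "measure lborel K * (measure lborel L / measure lborel K) powr (1 / real DIM('a)) \<le>
     (LINT x:K|lborel. support_ratio K L (sgn x))"
proof -
  let ?n = "real DIM('a)"
  let ?F = "\<lambda>x. support_ratio K L (sgn x)"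
  note mK = convex_body_measure[OF K] and mL = convex_body_measure[OF L]
  have cK: "compact K" and cL: "compact L" using K L by (auto simp: convex_bodies_o_def)
  obtain c d where c: "c > 0" "\<And>u. c \<le> support_ratio K L u" "\<And>u. support_ratio K L u \<le> d" using support_ratio_bounds[OF K L] by blast
  have F0: "0 \<le> support_ratio K L u" for u using c(1) c(2)[of u] by linarith
  note [measurable] = support_ratio_borel[OF K L]
  define q where "q = (measure lborel L / measure lborel K) powr (1 / ?n)"
  define I where "I = (LINT x:K|lborel. ?F x)"
  have Fb: "\<bar>?F x\<bar> \<le> d" for x using F0[of "sgn x"] c(3)[of "sgn x"] by simp
  have iF: "set_integrable lborel K ?F"
    by (rule set_integrable_bounded_finite[OF mK(1,2) _ Fb]) measurable
  have i1: "set_integrable lborel K (\<lambda>x. 1 :: real)"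
    by (rule set_integrable_bounded_finite[OF mK(1,2), where B = 1]) auto
  \<comment> \<open>The sum on the right tends to the dimension as \<open>e\<close> tends to zero.\<close>
  have key: "?n * (measure lborel K * q) \<le> I * (\<Sum>i<DIM('a). (1 + e * d) ^ i)" if e: "e > 0" for e
  proof -
    let ?S = "\<Sum>i<DIM('a). (1 + e * d) ^ i"
    let ?M = "{x + e *\<^sub>R y | x y. x \<in> K \<and> y \<in> L}"
    let ?eL = "(\<lambda>x. e *\<^sub>R x) ` L"
    have cM: "compact ?M" using compact_lincomb[OF cK cL, of 1 e] by simp
    have meL: "measure lborel ?eL = e ^ DIM('a) * measure lborel L"
      by (rule measure_lborel_scale[OF mL(1) e])
    have "(measure lborel K powr (1 / ?n) + measure lborel ?eL powr (1 / ?n)) ^ DIM('a) \<le> measure lborel ?M"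
      using mK mL e by (intro brunn_minkowski cK cM compact_scaling cL) (auto simp: meL)
    also have "measure lborel ?eL powr (1 / ?n) = e * measure lborel L powr (1 / ?n)"
      unfolding meL using e mL by (simp add: powr_mult powr_realpow[symmetric] powr_powr)
    also have "measure lborel K powr (1 / ?n) + e * measure lborel L powr (1 / ?n) = measure lborel K powr (1 / ?n) * (1 + e * q)"
      using mK mL by (simp add: q_def powr_divide distrib_left)
    also have "\<dots> ^ DIM('a) = measure lborel K * (1 + e * q) ^ DIM('a)"
      using mK by (simp add: power_mult_distrib powr_realpow[symmetric] powr_powr)
    also note measure_minkowski_sum_le[OF K L e]
    finally have le: "measure lborel K * (1 + e * q) ^ DIM('a) \<le> (LINT x:K|lborel. (1 + e * ?F x) ^ DIM('a))" .
    have "1 + ?n * (e * q) \<le> (1 + e * q) ^ DIM('a)"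
      using e by (intro Bernoulli_inequality) (simp add: q_def order_trans[of _ 0])
    hence "measure lborel K * (1 + ?n * (e * q)) \<le> measure lborel K * (1 + e * q) ^ DIM('a)"
      using mK by (intro mult_left_mono) auto
    also note le
    also have "(LINT x:K|lborel. (1 + e * ?F x) ^ DIM('a)) \<le> (LINT x:K|lborel. 1 + (e * ?S) * ?F x)"
    proof (rule set_integral_mono)
      have "\<bar>(1 + e * ?F x) ^ DIM('a)\<bar> \<le> (1 + e * d) ^ DIM('a)" for x
        using F0[of "sgn x"] c(3)[of "sgn x"] e by (simp add: power_mono)
      thus "set_integrable lborel K (\<lambda>x. (1 + e * ?F x) ^ DIM('a))"
        by (intro set_integrable_bounded_finite[OF mK(1,2)]) measurable
      show "set_integrable lborel K (\<lambda>x. 1 + (e * ?S) * ?F x)"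
        using i1 iF by (intro set_integral_add set_integrable_mult_right)
      fix x
      show "(1 + e * ?F x) ^ DIM('a) \<le> 1 + (e * ?S) * ?F x"
        using power_one_plus_le[of "e * ?F x" "e * d" "DIM('a)"] F0[of "sgn x"] c(3)[of "sgn x"] e
        by (simp add: mult_ac)
    qed
    also have "\<dots> = measure lborel K + (e * ?S) * I"
    proof -
      have "(LINT x:K|lborel. 1 + (e * ?S) * ?F x) = (LINT x:K|lborel. 1) + (LINT x:K|lborel. (e * ?S) * ?F x)"
        using i1 iF by (intro set_integral_add set_integrable_mult_right)
      also have "(LINT x:K|lborel. (1::real)) = measure lborel K"
        using mK by (simp add: set_lebesgue_integral_def less_top)
      finally show ?thesis by (simp add: I_def)
    qed
    finally have "e * (?n * (measure lborel K * q)) \<le> e * (I * ?S)"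
      by (simp add: algebra_simps)
    thus ?thesis using e by simp
  qed
  have "((\<lambda>e. I * (\<Sum>i<DIM('a). (1 + e * d) ^ i)) \<longlongrightarrow> I * (\<Sum>i<DIM('a). (1 + 0 * d) ^ i)) (at_right 0)"
    by (intro tendsto_intros)
  moreover have "\<forall>\<^sub>F e in at_right (0::real). ?n * (measure lborel K * q) \<le> I * (\<Sum>i<DIM('a). (1 + e * d) ^ i)"
    using eventually_at_right_less[of "0::real"] by eventually_elim (rule key)
  ultimately have "?n * (measure lborel K * q) \<le> I * (\<Sum>i<DIM('a). (1 + 0 * d) ^ i)"
    by (rule tendsto_lowerbound) simp
  hence "?n * (measure lborel K * q) \<le> ?n * I" by (simp add: mult.commute)
  thus ?thesis by (simp add: q_def I_def)
qed

section \<open>The mixed volume as a volume integral\<close>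

text \<open>
Smoothness depends on the direction only, so the cone over the exceptional directions consists of nonsmooth points.
\<close>

lemma sphere_smooth_null:
  fixes K :: "'a::euclidean_space set"
  assumes K: "K \<in> convex_bodies_o"
  shows "emeasure sphere_measure (sphere 0 1 - smooth_points K) = 0"
proof -
  note R = smooth_points_borel[OF K]
  have B: "sphere 0 1 - smooth_points K \<in> sets borel" using R by auto
  have "unit_cone (sphere 0 1 - smooth_points K) \<subseteq> - smooth_points K"
  proof
    fix x assume x: "x \<in> unit_cone (sphere 0 1 - smooth_points K)"
    hence "sgn x \<noteq> 0" "sgn x \<notin> smooth_points K" by (auto simp: unit_cone_def)
    thus "x \<in> - smooth_points K"
      using smooth_points_scale[OF K, of x "inverse (norm x)"] by (auto simp: sgn_div_norm)
  qed
  hence "emeasure lborel (unit_cone (sphere 0 1 - smooth_points K)) \<le> emeasure lborel (- smooth_points K)"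
    using R by (intro emeasure_mono) auto
  also have "\<dots> = 0" using smooth_points_null[OF K] by auto
  finally show ?thesis by (simp add: emeasure_sphere_measure[OF B])
qed

definition volume_density :: "(real \<Rightarrow> real) \<Rightarrow> 'a::euclidean_space set \<Rightarrow> 'a set \<Rightarrow> 'a set \<Rightarrow> 'a \<Rightarrow> real" where
  "volume_density \<psi> K L Q u = \<psi> (support_ratio K L u) * (radial_ext K u / radial_ext Q u) ^ DIM('a)"

lemma volume_density_props:
  fixes K L Q :: "'a::euclidean_space set"
  assumes K: "K \<in> convex_bodies_o" and L: "L \<in> convex_bodies_o" and Q: "Q \<in> star_bodies"
    and \<psi>: "\<psi> \<in> {0<..} \<rightarrow> {0<..}" "mono_on {0<..} \<psi>" "convex_on {0<..} \<psi>"
  shows "volume_density \<psi> K L Q \<in> borel_measurable borel"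
    and "\<exists>a>0. \<exists>b. \<forall>u. a \<le> volume_density \<psi> K L Q u \<and> volume_density \<psi> K L Q u \<le> b"
    and "(LINT x:Q|lborel. volume_density \<psi> K L Q (sgn x)) = (LINT x:K|lborel. \<psi> (support_ratio K L (sgn x)))"
proof -
  note Ks = convex_body_is_star_body[OF K]
  obtain a b where a: "a > 0" "\<And>u. a \<le> radial_ext K u" "\<And>u. radial_ext K u \<le> b" using radial_ext_props(2)[OF Ks] by blast
  obtain a' b' where a': "a' > 0" "\<And>u. a' \<le> radial_ext Q u" "\<And>u. radial_ext Q u \<le> b'" using radial_ext_props(2)[OF Q] by blast
  obtain c d where c: "c > 0" "\<And>u. c \<le> support_ratio K L u" "\<And>u. support_ratio K L u \<le> d" using support_ratio_bounds[OF K L] by blast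
  have Fpos: "0 < support_ratio K L u" for u using c(1) c(2)[of u] by linarith
  note m [measurable] = radial_ext_props(1)[OF Ks] radial_ext_props(1)[OF Q] support_ratio_borel[OF K L]
  note \<psi>F [measurable] = convex_on_comp_borel[OF \<psi>(3) m(3) Fpos]
  show meas: "volume_density \<psi> K L Q \<in> borel_measurable borel"
    unfolding volume_density_def[abs_def] by measurable
  have \<psi>c: "0 < \<psi> c" and \<psi>b: "\<And>u. \<psi> c \<le> \<psi> (support_ratio K L u)" "\<And>u. \<psi> (support_ratio K L u) \<le> \<psi> d"
    using mono_pos_comp_bounds[where X = "support_ratio K L", OF \<psi>(1,2) c] by blast+
  have pQ: "0 < radial_ext Q u" for u using a'(1) a'(2)[of u] by linarith
  have pK: "0 < radial_ext K u" for u using a(1) a(2)[of u] by linarith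
  have b0: "0 < b" "0 < b'" using pK[of 0] a(3)[of 0] pQ[of 0] a'(3)[of 0] by linarith+
  have "\<psi> c * (a / b') ^ DIM('a) \<le> volume_density \<psi> K L Q u \<and> volume_density \<psi> K L Q u \<le> \<psi> d * (b / a') ^ DIM('a)" for u
    unfolding volume_density_def
  proof
    have "a / b' \<le> radial_ext K u / radial_ext Q u" using a a' pQ[of u] by (intro frac_le) (auto intro: less_imp_le order_trans)
    thus "\<psi> c * (a / b') ^ DIM('a) \<le> \<psi> (support_ratio K L u) * (radial_ext K u / radial_ext Q u) ^ DIM('a)"
      using \<psi>c \<psi>b(1)[of u] a b0 by (intro mult_mono power_mono) auto
    have "radial_ext K u / radial_ext Q u \<le> b / a'" using a a' pQ[of u] b0 by (intro frac_le) (auto intro: less_imp_le order_trans)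
    thus "\<psi> (support_ratio K L u) * (radial_ext K u / radial_ext Q u) ^ DIM('a) \<le> \<psi> d * (b / a') ^ DIM('a)"
      using \<psi>c \<psi>b(1)[of u] \<psi>b(2)[of u] pK[of u] pQ[of u] by (intro mult_mono power_mono) auto
  qed
  moreover have "0 < \<psi> c * (a / b') ^ DIM('a)" using \<psi>c a b0 by simp
  ultimately show "\<exists>a>0. \<exists>b. \<forall>u. a \<le> volume_density \<psi> K L Q u \<and> volume_density \<psi> K L Q u \<le> b" by blast
  have eq: "radial_ext Q u ^ DIM('a) * volume_density \<psi> K L Q u = radial_ext K u ^ DIM('a) * \<psi> (support_ratio K L u)" for u
    using pQ[of u] by (simp add: volume_density_def power_divide)
  have "(LINT x:Q|lborel. volume_density \<psi> K L Q (sgn x)) =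
      (LINT x:cball 0 1|lborel. radial_ext Q (sgn x) ^ DIM('a) * volume_density \<psi> K L Q (sgn x))"
    by (rule set_integral_star_body[OF Q meas])
  also have "\<dots> = (LINT x:K|lborel. \<psi> (support_ratio K L (sgn x)))"
    unfolding eq by (rule set_integral_star_body[OF Ks \<psi>F, symmetric])
  finally show "(LINT x:Q|lborel. volume_density \<psi> K L Q (sgn x)) = (LINT x:K|lborel. \<psi> (support_ratio K L (sgn x)))" .
qed

lemma mixed_volume_eq_integral:
  fixes K L Q :: "'a::euclidean_space set"
  assumes K: "K \<in> convex_bodies_o" and L: "L \<in> convex_bodies_o" and Q: "Q \<in> star_bodies"
    and \<phi>: "convex_on {0<..} \<phi>"
    and \<psi>: "\<psi> \<in> {0<..} \<rightarrow> {0<..}" "mono_on {0<..} \<psi>" "convex_on {0<..} \<psi>"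
  shows "mixed_volume \<phi> \<psi> K L Q = (LINT x:Q|lborel. \<phi> (volume_density \<psi> K L Q (sgn x)))"
proof -
  note vd = volume_density_props[OF K L Q \<psi>]
  have pos: "0 < volume_density \<psi> K L Q u" for u using vd(2) by (meson less_le_trans)
  note m [measurable] = radial_ext_props(1)[OF Q] convex_on_comp_borel[OF \<phi> vd(1) pos]
  have "(LINT u : sphere 0 1 | hausdorff_measure (DIM('a) - 1).
        \<phi> (\<psi> (support_function L (radial_gauss_map K u) / support_function K (radial_gauss_map K u))
             * (radial_function K u / radial_function Q u) ^ DIM('a))
        * radial_function Q u ^ DIM('a)) =
      real DIM('a) * (LINT x:cball 0 1|lborel. \<phi> (volume_density \<psi> K L Q (sgn x)) * radial_ext Q (sgn x) ^ DIM('a))"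
  proof (rule set_integral_sphere_hausdorff[where R = "smooth_points K"
        and ?f0.0 = "\<lambda>u. \<phi> (volume_density \<psi> K L Q u) * radial_ext Q u ^ DIM('a)"])
    show "(\<lambda>u. \<phi> (volume_density \<psi> K L Q u) * radial_ext Q u ^ DIM('a)) \<in> borel_measurable borel"
      by measurable
    fix u :: 'a assume u: "u \<in> sphere 0 1" "u \<in> smooth_points K"
    thus "\<phi> (\<psi> (support_function L (radial_gauss_map K u) / support_function K (radial_gauss_map K u))
             * (radial_function K u / radial_function Q u) ^ DIM('a))
        * radial_function Q u ^ DIM('a) = \<phi> (volume_density \<psi> K L Q u) * radial_ext Q u ^ DIM('a)"
      by (simp add: support_ratio_gauss_map[OF K L] volume_density_def radial_ext_def)
  qed (fact smooth_points_borel[OF K] sphere_smooth_null[OF K])+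
  hence "mixed_volume \<phi> \<psi> K L Q =
      (LINT x:cball 0 1|lborel. radial_ext Q (sgn x) ^ DIM('a) * \<phi> (volume_density \<psi> K L Q (sgn x)))"
    by (simp add: mixed_volume_def mult.commute)
  also have "\<dots> = (LINT x:Q|lborel. \<phi> (volume_density \<psi> K L Q (sgn x)))"
    by (rule set_integral_star_body[OF Q m(2), symmetric])
  finally show ?thesis .
qed

section \<open>Rigidity\<close>

lemma null_open_empty:
  fixes U :: "'a::euclidean_space set"
  assumes "open U" "AE x in lborel. x \<notin> U"
  shows "U = {}"
proof (rule ccontr)
  assume "U \<noteq> {}"
  then obtain x where "x \<in> U" by blast
  then obtain e where e: "e > 0" "cball x e \<subseteq> U" using assms(1) open_contains_cball by blast
  have "U \<in> null_sets lborel" using assms by (simp add: AE_iff_null_sets)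
  hence "emeasure lborel U = 0" by auto
  moreover have "emeasure lborel (cball x e) \<le> emeasure lborel U" using e assms(1) by (intro emeasure_mono) auto
  moreover have "0 < unit_ball_vol (real DIM('a)) * e ^ DIM('a)"
    using e(1) by (intro mult_pos_pos unit_ball_vol_pos zero_less_power) auto
  hence "0 < emeasure lborel (cball x e)"
    unfolding emeasure_cball[OF less_imp_le[OF e(1)]] by (simp only: ennreal_less_zero_iff)
  ultimately show False by simp
qed

text \<open>
A null set of points with exceptional direction in one ball dilates to a null set in every ball.
\<close>

lemma AE_sgn_extend:
  fixes A B :: "'a::euclidean_space set"
  assumes B: "B \<in> sets borel" and r: "0 < r" "cball 0 r \<subseteq> A" and ae: "AE x in lborel. x \<in> A \<longrightarrow> sgn x \<in> B"
  shows "AE x in lborel. sgn x \<in> B"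
proof -
  have B': "- B \<in> sets borel" using B by auto
  have m: "{x. sgn x \<in> - B \<and> norm x \<le> s} \<in> sets borel" for s
  proof -
    have "{x. sgn x \<in> - B \<and> norm x \<le> s} = (sgn -` (- B)) \<inter> cball 0 s" by auto
    moreover have "sgn -` (- B) \<in> sets borel" using measurable_sets[OF borel_measurable_sgn_vec B'] by simp
    ultimately show ?thesis by simp
  qed
  have "AE x in lborel. x \<notin> {x. sgn x \<in> - B \<and> norm x \<le> r}"
    using ae by eventually_elim (use r(2) in auto)
  moreover have "{x. sgn x \<in> - B \<and> norm x \<le> r} \<in> sets lborel" using m[of r] by simp
  ultimately have "{x. sgn x \<in> - B \<and> norm x \<le> r} \<in> null_sets lborel"
    using AE_iff_null_sets by blast
  hence "emeasure lborel {x. sgn x \<in> - B \<and> norm x \<le> r} = 0" by (rule null_setsD1)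
  hence z: "emeasure lborel (unit_cone (- B)) = 0"
    using emeasure_lborel_cone_scaled[OF B' r(1)] r(1) by simp
  have "{x. sgn x \<in> - B \<and> norm x \<le> real (Suc k)} \<in> null_sets lborel" for k
    using emeasure_lborel_cone_scaled[OF B', of "real (Suc k)"] z m[of "real (Suc k)"] by (simp add: null_sets_def)
  hence "(\<Union>k. {x. sgn x \<in> - B \<and> norm x \<le> real (Suc k)}) \<in> null_sets lborel" by (rule null_sets_UN)
  from AE_not_in[OF this] show ?thesis
  proof eventually_elim
    case (elim x)
    obtain k where "norm x \<le> real k" using real_arch_simple by blast
    hence "norm x \<le> real (Suc k)" by simp
    thus ?case using elim by blast
  qed
qed

lemma star_body_radial_iff:
  assumes "Q \<in> star_bodies" "norm u = 1" "t > 0"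
  shows "t *\<^sub>R u \<in> Q \<longleftrightarrow> t \<le> radial_function Q u"
proof -
  have "u \<noteq> 0" using assms(2) by auto
  thus ?thesis using star_body_iff[OF assms(1), of "t *\<^sub>R u"] assms(2,3) by (simp add: sgn_scaleR sgn_div_norm)
qed

lemma star_body_radial_pos:
  assumes "Q \<in> star_bodies" "norm u = 1"
  shows "radial_function Q u > 0"
  using assms by (auto simp: star_bodies_def)

lemma dilate_iff_radial:
  fixes K Q :: "'a::euclidean_space set"
  assumes K: "K \<in> star_bodies" and Q: "Q \<in> star_bodies" and c: "c > 0"
  shows "K = (\<lambda>x. c *\<^sub>R x) ` Q \<longleftrightarrow> (\<forall>u. norm u = 1 \<longrightarrow> radial_function K u = c * radial_function Q u)"
proof
  assume eq: "K = (\<lambda>x. c *\<^sub>R x) ` Q"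
  show "\<forall>u. norm u = 1 \<longrightarrow> radial_function K u = c * radial_function Q u"
  proof (intro allI impI)
    fix u :: 'a assume u: "norm u = 1"
    have *: "t \<le> radial_function K u \<longleftrightarrow> t \<le> c * radial_function Q u" if t: "t > 0" for t
    proof -
      have "t *\<^sub>R u \<in> K \<longleftrightarrow> (t / c) *\<^sub>R u \<in> Q"
      proof
        assume "t *\<^sub>R u \<in> K"
        then obtain x where x: "x \<in> Q" "t *\<^sub>R u = c *\<^sub>R x" using eq by blast
        have "(t / c) *\<^sub>R u = (1 / c) *\<^sub>R (t *\<^sub>R u)" by simp
        also have "\<dots> = x" unfolding x(2) using c by simp
        finally show "(t / c) *\<^sub>R u \<in> Q" using x(1) by simp
      next
        assume "(t / c) *\<^sub>R u \<in> Q"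
        hence "c *\<^sub>R ((t / c) *\<^sub>R u) \<in> K" using eq by blast
        thus "t *\<^sub>R u \<in> K" using c by simp
      qed
      thus ?thesis
        using star_body_radial_iff[OF K u t] star_body_radial_iff[OF Q u, of "t / c"] t c by (simp add: field_simps)
    qed
    show "radial_function K u = c * radial_function Q u"
      using *[OF star_body_radial_pos[OF K u]] *[OF mult_pos_pos[OF c star_body_radial_pos[OF Q u]]] by simp
  qed
next
  assume eq: "\<forall>u. norm u = 1 \<longrightarrow> radial_function K u = c * radial_function Q u"
  have *: "x \<in> K \<longleftrightarrow> (1 / c) *\<^sub>R x \<in> Q" for x
  proof (cases "x = 0")
    case True
    thus ?thesis using K Q by (simp add: star_bodies_def)
  next
    case False
    have "sgn ((1 / c) *\<^sub>R x) = sgn x" using c by (simp add: sgn_scaleR)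
    thus ?thesis
      using star_body_iff[OF K False] star_body_iff[OF Q, of "(1 / c) *\<^sub>R x"] eq[rule_format, of "sgn x"] False c
      by (simp add: norm_sgn field_simps)
  qed
  show "K = (\<lambda>x. c *\<^sub>R x) ` Q"
  proof
    show "K \<subseteq> (\<lambda>x. c *\<^sub>R x) ` Q"
    proof
      fix x assume "x \<in> K"
      hence "(1 / c) *\<^sub>R x \<in> Q" using * by blast
      hence "c *\<^sub>R ((1 / c) *\<^sub>R x) \<in> (\<lambda>x. c *\<^sub>R x) ` Q" by (rule imageI)
      thus "x \<in> (\<lambda>x. c *\<^sub>R x) ` Q" using c by simp
    qed
    show "(\<lambda>x. c *\<^sub>R x) ` Q \<subseteq> K"
    proof (rule image_subsetI)
      fix x assume "x \<in> Q"
      moreover have "(1 / c) *\<^sub>R (c *\<^sub>R x) = x" using c by simp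
      ultimately show "c *\<^sub>R x \<in> K" using *[of "c *\<^sub>R x"] by metis
    qed
  qed
qed

text \<open>
Where the ratio is \<open>c\<close>, the contact point \<open>p\<close> at \<open>x\<close> has \<open>p \<bullet> y \<le> c\<close>, so the gauge of \<open>x\<close> exceeds \<open>c\<close> by at
most a constant times \<open>norm (x - y)\<close>.  This holds on a dense set of points \<open>x\<close>, hence also for \<open>x = y\<close>.
\<close>

lemma support_ratio_const_imp_gauge_le:
  fixes K L :: "'a::euclidean_space set"
  assumes K: "K \<in> convex_bodies_o" and L: "L \<in> convex_bodies_o"
    and ae: "AE x in lborel. support_ratio K L (sgn x) = c" and y: "y \<in> L"
  shows "gauge_function K y \<le> c"
proof -
  obtain r R where rR: "0 < r" "0 < R" "cball 0 r \<subseteq> K" "K \<subseteq> cball 0 R" using convex_body_radii[OF K] .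
  have bL: "bounded L" using L compact_imp_bounded by (auto simp: convex_bodies_o_def)
  let ?U = "{x. c + norm (x - y) / r < gauge_function K x}"
  have "AE x in lborel. x \<notin> - smooth_points K" by (rule AE_not_in[OF smooth_points_null[OF K]])
  with ae have "AE x in lborel. x \<notin> ?U"
  proof eventually_elim
    case (elim x)
    hence x: "x \<in> smooth_points K" by simp
    have x0: "x \<noteq> 0" by (rule smooth_points_nonzero[OF K x])
    hence n: "inverse (norm x) > 0" by simp
    have sx: "sgn x = inverse (norm x) *\<^sub>R x" by (simp add: sgn_div_norm)
    have s: "sgn x \<in> smooth_points K" unfolding sx by (rule smooth_points_scale[OF K x n])
    let ?p = "contact_point K (sgn x)"
    have p: "?p \<in> contact_set K x"
      using contact_point_in[OF K, of "sgn x"] contact_set_scale[OF K n, of x] by (simp add: sx)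
    have "y \<bullet> ?p \<le> support_function L ?p"
      using support_function_upper[OF bL y, of ?p] by (simp add: inner_commute)
    also have "\<dots> = c" using elim s by (simp add: support_ratio_def)
    finally have 1: "y \<bullet> ?p \<le> c" .
    have "norm ?p \<le> 1 / r" using p polar_body_bounds(1)[OF rR] by (auto simp: contact_set_def)
    hence "norm (x - y) * norm ?p \<le> norm (x - y) * (1 / r)" by (intro mult_left_mono) auto
    hence 2: "(x - y) \<bullet> ?p \<le> norm (x - y) / r" using norm_cauchy_schwarz[of "x - y" ?p] by simp
    have "gauge_function K x = y \<bullet> ?p + (x - y) \<bullet> ?p"
      using p by (simp add: contact_set_def inner_diff_left)
    thus ?case using 1 2 by simp
  qed
  moreover have "open ?U"
    using rR by (intro open_Collect_less continuous_intros continuous_on_gauge_function[OF K]) auto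
  ultimately have "?U = {}" by (intro null_open_empty)
  hence "y \<notin> ?U" by blast
  thus ?thesis by simp
qed

lemma convex_body_subset_eq_measure:
  fixes L M :: "'a::euclidean_space set"
  assumes L: "compact L" and M: "compact M" "convex M" "interior M \<noteq> {}"
    and sub: "L \<subseteq> M" and meas: "measure lborel L = measure lborel M"
  shows "L = M"
proof (rule ccontr)
  assume "L \<noteq> M"
  then obtain x where x: "x \<in> M" "x \<notin> L" using sub by blast
  have "closure (interior M) = M"
    using convex_closure_interior[OF M(2,3)] compact_imp_closed[OF M(1)] by simp
  hence "x \<in> closure (interior M)" using x by simp
  moreover have "open (- L)" using compact_imp_closed[OF L] by auto
  ultimately have ne: "interior M \<inter> - L \<noteq> {}"
    using x(2) open_Int_closure_eq_empty[of "- L" "interior M"] by blast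
  have o: "open (interior M \<inter> - L)" using \<open>open (- L)\<close> by auto
  have bL: "L \<in> sets borel" and bM: "M \<in> sets borel" using L M borel_compact by auto
  have fL: "emeasure lborel L < \<infinity>" and fM: "emeasure lborel M < \<infinity>"
    using emeasure_compact_finite L M by auto
  have "measure lborel (M - L) = measure lborel M - measure lborel L"
    using bL bM fM sub by (intro measure_Diff) auto
  hence "measure lborel (M - L) = 0" using meas by simp
  moreover have "emeasure lborel (M - L) < \<infinity>"
    using emeasure_mono[of "M - L" M lborel] bM fM by (auto intro: order.strict_trans1)
  ultimately have "emeasure lborel (M - L) = 0" by (auto simp: measure_def enn2real_eq_0_iff)
  hence "M - L \<in> null_sets lborel" using bL bM by auto
  from AE_not_in[OF this] have "AE x in lborel. x \<notin> interior M \<inter> - L"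
    by eventually_elim (use interior_subset in auto)
  from null_open_empty[OF o this] show False using ne by blast
qed

lemma support_ratio_const_imp_dilate:
  fixes K L :: "'a::euclidean_space set"
  assumes K: "K \<in> convex_bodies_o" and L: "L \<in> convex_bodies_o" and c: "c > 0"
    and ae: "AE x in lborel. support_ratio K L (sgn x) = c"
    and meas: "measure lborel L = c ^ DIM('a) * measure lborel K"
  shows "L = (\<lambda>x. c *\<^sub>R x) ` K"
proof (rule convex_body_subset_eq_measure)
  have K': "compact K" "convex K" "interior K \<noteq> {}" using K by (auto simp: convex_bodies_o_def)
  show "compact L" using L by (simp add: convex_bodies_o_def)
  show "compact ((\<lambda>x. c *\<^sub>R x) ` K)" by (rule compact_scaling[OF K'(1)])
  show "convex ((\<lambda>x. c *\<^sub>R x) ` K)" by (rule convex_scaling[OF K'(2)])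
  show "interior ((\<lambda>x. c *\<^sub>R x) ` K) \<noteq> {}"
    using K'(3) interior_injective_linear_image[of "\<lambda>x. c *\<^sub>R x" K] c by (simp add: inj_on_def bounded_linear.linear[OF bounded_linear_scaleR_right])
  show "measure lborel L = measure lborel ((\<lambda>x. c *\<^sub>R x) ` K)"
    using measure_lborel_scale[OF borel_compact[OF K'(1)] c] meas by simp
  show "L \<subseteq> (\<lambda>x. c *\<^sub>R x) ` K"
  proof
    fix y assume y: "y \<in> L"
    have "gauge_function K ((1 / c) *\<^sub>R y) = gauge_function K y / c"
      using gauge_function_scale[OF K, of "1 / c" y] c by simp
    also have "\<dots> \<le> 1"
      using support_ratio_const_imp_gauge_le[OF K L ae y] c by (simp add: divide_le_eq)
    finally have "gauge_function K ((1 / c) *\<^sub>R y) \<le> 1" .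
    hence "(1 / c) *\<^sub>R y \<in> K" by (simp add: mem_convex_body_iff_gauge[OF K])
    hence "c *\<^sub>R ((1 / c) *\<^sub>R y) \<in> (\<lambda>x. c *\<^sub>R x) ` K" by (rule imageI)
    thus "y \<in> (\<lambda>x. c *\<^sub>R x) ` K" using c by simp
  qed
qed

lemma support_ratio_dilate:
  fixes K L :: "'a::euclidean_space set"
  assumes K: "K \<in> convex_bodies_o" and c: "c > 0" and L: "L = (\<lambda>x. c *\<^sub>R x) ` K" and u: "u \<in> smooth_points K"
  shows "support_ratio K L u = c"
proof -
  have K': "bounded K" "K \<noteq> {}" using K compact_imp_bounded by (auto simp: convex_bodies_o_def)
  let ?p = "contact_point K u"
  have "support_function L ?p = support_function K (c *\<^sub>R ?p)"
    unfolding L support_function_def by (simp add: image_image)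
  also have "\<dots> = c"
    using support_function_scale[OF K' c] support_function_contact[OF K contact_point_in[OF K] smooth_points_nonzero[OF K u]] by simp
  finally show ?thesis using u by (simp add: support_ratio_def)
qed

lemma radial_ratio_const:
  fixes K Q :: "'a::euclidean_space set"
  assumes K: "K \<in> star_bodies" and Q: "Q \<in> star_bodies"
    and ae: "AE x in lborel. (radial_ext K (sgn x) / radial_ext Q (sgn x)) ^ DIM('a) = c"
  obtains b where "b > 0" "K = (\<lambda>x. b *\<^sub>R x) ` Q"
proof -
  let ?h = "\<lambda>x. (radial_function K (sgn x) / radial_function Q (sgn x)) ^ DIM('a)"
  have cont: "continuous_on (- {0}) ?h"
  proof -
    have s: "continuous_on (- {0 :: 'a}) sgn" by (intro continuous_intros) auto
    have i: "sgn ` (- {0 :: 'a}) \<subseteq> sphere 0 1" by (auto simp: norm_sgn split: if_splits)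
    have k: "continuous_on (sphere 0 1) (radial_function K)" "continuous_on (sphere 0 1) (radial_function Q)"
      using K Q by (auto simp: star_bodies_def)
    show ?thesis
    proof (intro continuous_intros continuous_on_compose2[OF k(1) s i] continuous_on_compose2[OF k(2) s i] ballI)
      fix x :: 'a assume "x \<in> - {0}"
      thus "radial_function Q (sgn x) \<noteq> 0" using star_body_radial_pos[OF Q, of "sgn x"] by (simp add: norm_sgn)
    qed
  qed
  have "open (- {0} \<inter> ?h -` (- {c}))" by (rule continuous_open_preimage[OF cont]) auto
  moreover have "AE x in lborel. x \<notin> - {0} \<inter> ?h -` (- {c})"
    using ae
  proof eventually_elim
    case (elim x)
    thus ?case by (cases "x = 0") (simp_all add: radial_ext_def norm_sgn)
  qed
  ultimately have "- {0} \<inter> ?h -` (- {c}) = {}" by (rule null_open_empty)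
  hence h: "?h x = c" if "x \<noteq> 0" for x using that by blast
  have hu: "(radial_function K u / radial_function Q u) ^ DIM('a) = c" if u: "norm u = 1" for u
  proof -
    have "u \<noteq> 0" "sgn u = u" using u by (auto simp: sgn_div_norm)
    thus ?thesis using h[of u] by simp
  qed
  obtain v :: 'a where v: "norm v = 1" using vector_choose_size[of 1] by auto
  define b where "b = radial_function K v / radial_function Q v"
  have b: "b > 0" using star_body_radial_pos[OF K v] star_body_radial_pos[OF Q v] by (simp add: b_def)
  have "radial_function K u = b * radial_function Q u" if u: "norm u = 1" for u
  proof -
    have pos: "radial_function K u > 0" "radial_function Q u > 0" using star_body_radial_pos[OF K u] star_body_radial_pos[OF Q u] .
    have "(radial_function K u / radial_function Q u) ^ DIM('a) = b ^ DIM('a)" using hu[OF u] hu[OF v] by (simp add: b_def)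
    hence "radial_function K u / radial_function Q u = b"
      by (rule power_eq_imp_eq_base) (use pos b in auto)
    thus ?thesis using pos by (simp add: field_simps)
  qed
  thus ?thesis using that[OF b] dilate_iff_radial[OF K Q b] by blast
qed

section \<open>The inequality and its equality case\<close>

text \<open>
The factor by which \<open>K\<close> must be dilated to get the volume of \<open>L\<close>.
\<close>

definition relative_radius :: "'a::euclidean_space set \<Rightarrow> 'a set \<Rightarrow> real" where
  "relative_radius K L = (measure lborel L / measure lborel K) powr (1 / real DIM('a))"

definition mean_ratio :: "'a::euclidean_space set \<Rightarrow> 'a set \<Rightarrow> real" where
  "mean_ratio K L = (LINT x:K|lborel. support_ratio K L (sgn x)) / measure lborel K"

definition mean_density :: "(real \<Rightarrow> real) \<Rightarrow> 'a::euclidean_space set \<Rightarrow> 'a set \<Rightarrow> 'a set \<Rightarrow> real" where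
  "mean_density \<psi> K L Q = (LINT x:Q|lborel. volume_density \<psi> K L Q (sgn x)) / measure lborel Q"

context
  fixes K L Q :: "'a::euclidean_space set" and \<phi> \<psi> :: "real \<Rightarrow> real"
  assumes K: "K \<in> convex_bodies_o" and L: "L \<in> convex_bodies_o" and Q: "Q \<in> star_bodies"
    and \<phi>: "\<phi> \<in> {0<..} \<rightarrow> {0<..}" "mono_on {0<..} \<phi>" "convex_on {0<..} \<phi>"
    and \<psi>: "\<psi> \<in> {0<..} \<rightarrow> {0<..}" "mono_on {0<..} \<psi>" "convex_on {0<..} \<psi>"
begin

lemma relative_radius_props: "relative_radius K L > 0" "relative_radius K L ^ DIM('a) * measure lborel K = measure lborel L"
  using convex_body_measure(3)[OF K] convex_body_measure(3)[OF L]
  by (simp_all add: relative_radius_def powr_realpow[symmetric] powr_powr)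

lemma mean_ratio_ge: "relative_radius K L \<le> mean_ratio K L"
  using minkowski_first_inequality[OF K L] convex_body_measure(3)[OF K]
  by (simp add: relative_radius_def mean_ratio_def pos_le_divide_eq mult.commute)

lemma jensen_inner:
  shows "\<psi> (mean_ratio K L) * measure lborel K \<le> mean_density \<psi> K L Q * measure lborel Q"
    and "strictly_convex_on {0<..} \<psi> \<Longrightarrow> mean_density \<psi> K L Q * measure lborel Q = \<psi> (mean_ratio K L) * measure lborel K \<Longrightarrow>
      AE x in lborel. x \<in> K \<longrightarrow> support_ratio K L (sgn x) = mean_ratio K L"
proof -
  obtain c d where c: "c > 0" "\<And>u. c \<le> support_ratio K L u" "\<And>u. support_ratio K L u \<le> d" using support_ratio_bounds[OF K L] by blast
  note m = borel_measurable_sgn_comp[OF support_ratio_borel[OF K L]]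
  note J = jensen_set_integral[OF convex_body_measure(1,2,3)[OF K] \<psi> m c(1), of d, folded mean_ratio_def]
  have eq: "mean_density \<psi> K L Q * measure lborel Q = (LINT x:K|lborel. \<psi> (support_ratio K L (sgn x)))"
    using star_body_measure(3)[OF Q] volume_density_props(3)[OF K L Q \<psi>] by (simp add: mean_density_def)
  show "\<psi> (mean_ratio K L) * measure lborel K \<le> mean_density \<psi> K L Q * measure lborel Q"
    unfolding eq by (rule J(2)) (use c in auto)
  show "AE x in lborel. x \<in> K \<longrightarrow> support_ratio K L (sgn x) = mean_ratio K L"
    if "strictly_convex_on {0<..} \<psi>" "mean_density \<psi> K L Q * measure lborel Q = \<psi> (mean_ratio K L) * measure lborel K"
    by (rule J(3)) (use c that eq in auto)
qed

lemma jensen_outer: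
  shows "0 < mean_density \<psi> K L Q"
    and "\<phi> (mean_density \<psi> K L Q) * measure lborel Q \<le> mixed_volume \<phi> \<psi> K L Q"
    and "strictly_convex_on {0<..} \<phi> \<Longrightarrow> mixed_volume \<phi> \<psi> K L Q = \<phi> (mean_density \<psi> K L Q) * measure lborel Q \<Longrightarrow>
      AE x in lborel. x \<in> Q \<longrightarrow> volume_density \<psi> K L Q (sgn x) = mean_density \<psi> K L Q"
proof -
  obtain a b where a: "a > 0" "\<And>u. a \<le> volume_density \<psi> K L Q u" "\<And>u. volume_density \<psi> K L Q u \<le> b"
    using volume_density_props(2)[OF K L Q \<psi>] by blast
  note m = borel_measurable_sgn_comp[OF volume_density_props(1)[OF K L Q \<psi>]]
  note J = jensen_set_integral[OF star_body_measure(1,2,3)[OF Q] \<phi> m a(1), of b, folded mean_density_def]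
  note eq = mixed_volume_eq_integral[OF K L Q \<phi>(3) \<psi>]
  show "0 < mean_density \<psi> K L Q" by (rule J(1)) (use a in auto)
  show "\<phi> (mean_density \<psi> K L Q) * measure lborel Q \<le> mixed_volume \<phi> \<psi> K L Q"
    unfolding eq by (rule J(2)) (use a in auto)
  show "AE x in lborel. x \<in> Q \<longrightarrow> volume_density \<psi> K L Q (sgn x) = mean_density \<psi> K L Q"
    if "strictly_convex_on {0<..} \<phi>" "mixed_volume \<phi> \<psi> K L Q = \<phi> (mean_density \<psi> K L Q) * measure lborel Q"
    by (rule J(3)) (use a that eq in auto)
qed

lemma psi_relative_radius_le:
  "\<psi> (relative_radius K L) \<le> \<psi> (mean_ratio K L)"
  "0 < measure lborel K / measure lborel Q * \<psi> (relative_radius K L)"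
  "measure lborel K / measure lborel Q * \<psi> (relative_radius K L) \<le> mean_density \<psi> K L Q"
proof -
  note VK = convex_body_measure(3)[OF K] and VQ = star_body_measure(3)[OF Q]
  have p: "0 < \<psi> (relative_radius K L)" using \<psi>(1) relative_radius_props(1) by auto
  show le: "\<psi> (relative_radius K L) \<le> \<psi> (mean_ratio K L)"
    using relative_radius_props(1) mean_ratio_ge by (intro mono_onD[OF \<psi>(2)]) auto
  show "0 < measure lborel K / measure lborel Q * \<psi> (relative_radius K L)" using p VK VQ by simp
  have "measure lborel K * \<psi> (relative_radius K L) \<le> measure lborel K * \<psi> (mean_ratio K L)"
    using le VK by (intro mult_left_mono) auto
  also have "\<dots> \<le> mean_density \<psi> K L Q * measure lborel Q" using jensen_inner(1) by (simp add: mult.commute)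
  finally show "measure lborel K / measure lborel Q * \<psi> (relative_radius K L) \<le> mean_density \<psi> K L Q"
    using VQ by (simp add: pos_divide_le_eq)
qed

lemma mixed_volume_ge:
  "\<phi> (measure lborel K / measure lborel Q * \<psi> (relative_radius K L)) * measure lborel Q \<le> mixed_volume \<phi> \<psi> K L Q"
proof -
  have "\<phi> (measure lborel K / measure lborel Q * \<psi> (relative_radius K L)) \<le> \<phi> (mean_density \<psi> K L Q)"
    using psi_relative_radius_le(2,3) jensen_outer(1) by (intro mono_onD[OF \<phi>(2)]) auto
  hence "\<phi> (measure lborel K / measure lborel Q * \<psi> (relative_radius K L)) * measure lborel Q \<le> \<phi> (mean_density \<psi> K L Q) * measure lborel Q"
    using star_body_measure(3)[OF Q] by (intro mult_right_mono) auto
  also note jensen_outer(2)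
  finally show ?thesis .
qed

text \<open>
Since \<open>\<phi>\<close> and \<open>\<psi>\<close> are strictly increasing, equality forces every inequality in the chain
\<open>relative_radius \<le> mean_ratio\<close>, Jensen for \<open>\<psi>\<close>, Jensen for \<open>\<phi>\<close> to be an equality.
\<close>

lemma mixed_volume_eq_imp_dilates:
  assumes sc: "strictly_convex_on {0<..} \<phi>" "strictly_convex_on {0<..} \<psi>"
    and eq: "mixed_volume \<phi> \<psi> K L Q = \<phi> (measure lborel K / measure lborel Q * \<psi> (relative_radius K L)) * measure lborel Q"
  shows "L = (\<lambda>x. relative_radius K L *\<^sub>R x) ` K" "\<exists>b>0. K = (\<lambda>x. b *\<^sub>R x) ` Q"
proof -
  let ?t = "measure lborel K / measure lborel Q * \<psi> (relative_radius K L)"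
  note VK = convex_body_measure(3)[OF K] and VQ = star_body_measure(3)[OF Q]
  note Ks = convex_body_is_star_body[OF K]
  have "\<phi> (mean_density \<psi> K L Q) \<le> \<phi> ?t" using jensen_outer(2) eq VQ by simp
  hence "\<not> ?t < mean_density \<psi> K L Q"
    using strictly_convex_mono_imp_less[OF sc(1) \<phi>(2) psi_relative_radius_le(2)] by fastforce
  hence t: "mean_density \<psi> K L Q = ?t" using psi_relative_radius_le(3) by simp
  hence md: "mean_density \<psi> K L Q * measure lborel Q = measure lborel K * \<psi> (relative_radius K L)" using VQ by simp
  hence "\<psi> (mean_ratio K L) \<le> \<psi> (relative_radius K L)" using jensen_inner(1) VK by (simp add: mult.commute)
  hence "\<not> relative_radius K L < mean_ratio K L"
    using strictly_convex_mono_imp_less[OF sc(2) \<psi>(2) relative_radius_props(1)] by fastforce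
  hence mr: "mean_ratio K L = relative_radius K L" using mean_ratio_ge by simp
  obtain r R where rR: "0 < r" "0 < R" "cball 0 r \<subseteq> K" "K \<subseteq> cball 0 R" using convex_body_radii[OF K] .
  have B1: "{u. support_ratio K L u = mean_ratio K L} \<in> sets borel"
    using measurable_sets[OF support_ratio_borel[OF K L], of "{mean_ratio K L}"] by (simp add: vimage_def)
  have "AE x in lborel. x \<in> K \<longrightarrow> support_ratio K L (sgn x) = mean_ratio K L"
    using md mr sc(2) by (intro jensen_inner(2)) (auto simp: mult.commute)
  hence "AE x in lborel. sgn x \<in> {u. support_ratio K L u = mean_ratio K L}"
    by (intro AE_sgn_extend[OF B1 rR(1,3)]) simp
  hence ratio: "AE x in lborel. support_ratio K L (sgn x) = relative_radius K L" by (simp add: mr)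
  show "L = (\<lambda>x. relative_radius K L *\<^sub>R x) ` K"
    by (rule support_ratio_const_imp_dilate[OF K L relative_radius_props(1) ratio relative_radius_props(2)[symmetric]])
  obtain a b where a: "a > 0" "\<And>u. a \<le> radial_ext Q u" using radial_ext_props(2)[OF Q] by blast
  have aQ: "cball 0 a \<subseteq> Q" by (subst star_body_eq[OF Q]) (use a in \<open>auto intro: order_trans\<close>)
  have B2: "{u. volume_density \<psi> K L Q u = mean_density \<psi> K L Q} \<in> sets borel"
    using measurable_sets[OF volume_density_props(1)[OF K L Q \<psi>], of "{mean_density \<psi> K L Q}"] by (simp add: vimage_def)
  have "AE x in lborel. x \<in> Q \<longrightarrow> volume_density \<psi> K L Q (sgn x) = mean_density \<psi> K L Q"
    using sc(1) eq t by (intro jensen_outer(3)) auto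
  hence "AE x in lborel. sgn x \<in> {u. volume_density \<psi> K L Q u = mean_density \<psi> K L Q}"
    by (intro AE_sgn_extend[OF B2 a(1) aQ]) simp
  with ratio have "AE x in lborel. (radial_ext K (sgn x) / radial_ext Q (sgn x)) ^ DIM('a) = mean_density \<psi> K L Q / \<psi> (relative_radius K L)"
  proof eventually_elim
    case (elim x)
    have "0 < \<psi> (relative_radius K L)" using \<psi>(1) relative_radius_props(1) by auto
    thus ?case using elim by (simp add: volume_density_def field_simps)
  qed
  then obtain b where "b > 0" "K = (\<lambda>x. b *\<^sub>R x) ` Q" using radial_ratio_const[OF Ks Q] by blast
  thus "\<exists>b>0. K = (\<lambda>x. b *\<^sub>R x) ` Q" by blast
qed

lemma mixed_volume_eq_of_dilates:
  assumes a: "a > 0" "L = (\<lambda>x. a *\<^sub>R x) ` K" and b: "b > 0" "K = (\<lambda>x. b *\<^sub>R x) ` Q"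
  shows "mixed_volume \<phi> \<psi> K L Q = \<phi> (measure lborel K / measure lborel Q * \<psi> (relative_radius K L)) * measure lborel Q"
proof -
  note VK = convex_body_measure(3)[OF K] and VQ = star_body_measure(3)[OF Q]
  note Ks = convex_body_is_star_body[OF K]
  have "measure lborel L = a ^ DIM('a) * measure lborel K"
    unfolding a(2) by (rule measure_lborel_scale[OF convex_body_measure(1)[OF K] a(1)])
  hence ra: "relative_radius K L = a"
    using a(1) VK by (simp add: relative_radius_def powr_realpow[symmetric] powr_powr)
  have "measure lborel K = b ^ DIM('a) * measure lborel Q"
    unfolding b(2) by (rule measure_lborel_scale[OF star_body_measure(1)[OF Q] b(1)])
  hence vb: "measure lborel K / measure lborel Q = b ^ DIM('a)" using VQ by simp
  let ?c = "\<phi> (\<psi> a * b ^ DIM('a))"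
  have pos: "0 < volume_density \<psi> K L Q u" for u
    using volume_density_props(2)[OF K L Q \<psi>] by (meson less_le_trans)
  note [measurable] = convex_on_comp_borel[OF \<phi>(3) volume_density_props(1)[OF K L Q \<psi>] pos] star_body_measure(1)[OF Q]
  have "AE x in lborel. x \<notin> - smooth_points K" by (rule AE_not_in[OF smooth_points_null[OF K]])
  hence ae: "AE x in lborel. indicator Q x *\<^sub>R \<phi> (volume_density \<psi> K L Q (sgn x)) = indicator Q x *\<^sub>R ?c"
  proof eventually_elim
    case (elim x)
    hence x: "x \<in> smooth_points K" by simp
    have x0: "x \<noteq> 0" by (rule smooth_points_nonzero[OF K x])
    have s: "sgn x \<in> smooth_points K"
      using smooth_points_scale[OF K x, of "inverse (norm x)"] x0 by (simp add: sgn_div_norm)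
    have n: "norm (sgn x) = 1" using x0 by (simp add: norm_sgn)
    have "radial_function K (sgn x) = b * radial_function Q (sgn x)"
      using dilate_iff_radial[OF Ks Q b(1)] b(2) n by blast
    hence "volume_density \<psi> K L Q (sgn x) = \<psi> a * b ^ DIM('a)"
      using star_body_radial_pos[OF Q n] support_ratio_dilate[OF K a s] n by (simp add: volume_density_def radial_ext_def)
    thus ?case by simp
  qed
  have "mixed_volume \<phi> \<psi> K L Q = (LINT x:Q|lborel. ?c)"
    unfolding mixed_volume_eq_integral[OF K L Q \<phi>(3) \<psi>] set_lebesgue_integral_def
    by (rule integral_cong_AE[OF _ _ ae]) measurable
  also have "\<dots> = ?c * measure lborel Q"
    using star_body_measure(1,2)[OF Q] by (simp add: set_lebesgue_integral_def less_top mult.commute)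
  finally show ?thesis by (simp add: ra vb mult.commute)
qed

end

lemma dilatates_sym: "dilatates A B \<Longrightarrow> dilatates B A"
proof -
  assume "dilatates A B"
  then obtain c where c: "c > 0" "A = (\<lambda>x. c *\<^sub>R x) ` B" by (auto simp: dilatates_def)
  have "B = (\<lambda>x. (1 / c) *\<^sub>R x) ` A" unfolding c(2) image_image using c(1) by simp
  thus "dilatates B A" using c(1) by (auto simp: dilatates_def intro!: exI[of _ "1 / c"])
qed

lemma dilatates_trans: "dilatates A B \<Longrightarrow> dilatates B C \<Longrightarrow> dilatates A C"
proof -
  assume "dilatates A B" "dilatates B C"
  then obtain c d where c: "c > 0" "A = (\<lambda>x. c *\<^sub>R x) ` B" and d: "d > 0" "B = (\<lambda>x. d *\<^sub>R x) ` C"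
    by (auto simp: dilatates_def)
  have "A = (\<lambda>x. (c * d) *\<^sub>R x) ` C" unfolding c(2) d(2) image_image by simp
  thus "dilatates A C" using c(1) d(1) by (auto simp: dilatates_def intro!: exI[of _ "c * d"])
qed

theorem theorem8p5:
  fixes K L Q :: "'a::euclidean_space set" and \<phi> \<psi> :: "real \<Rightarrow> real"
  assumes "K \<in> convex_bodies_o" and "L \<in> convex_bodies_o" and "Q \<in> star_bodies"
    and "\<phi> \<in> {0<..} \<rightarrow> {0<..}" and "mono_on {0<..} \<phi>" and "convex_on {0<..} \<phi>"
    and "\<psi> \<in> {0<..} \<rightarrow> {0<..}" and "mono_on {0<..} \<psi>" and "convex_on {0<..} \<psi>"
  shows "mixed_volume \<phi> \<psi> K L Q \<ge>
           \<phi> (measure lebesgue K / measure lebesgue Q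
                * \<psi> ((measure lebesgue L / measure lebesgue K) powr (1 / real DIM('a))))
             * measure lebesgue Q
       \<and> (strictly_convex_on {0<..} \<phi> \<and> strictly_convex_on {0<..} \<psi> \<longrightarrow>
           (mixed_volume \<phi> \<psi> K L Q =
              \<phi> (measure lebesgue K / measure lebesgue Q
                   * \<psi> ((measure lebesgue L / measure lebesgue K) powr (1 / real DIM('a))))
                * measure lebesgue Q
            \<longleftrightarrow> dilatates K L \<and> dilatates K Q \<and> dilatates L Q))"
  unfolding convex_body_measure(4)[OF assms(1)] convex_body_measure(4)[OF assms(2)] star_body_measure(4)[OF assms(3)]
    relative_radius_def[symmetric]
proof (intro conjI impI iffI)
  show "\<phi> (measure lborel K / measure lborel Q * \<psi> (relative_radius K L)) * measure lborel Q \<le> mixed_volume \<phi> \<psi> K L Q"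
    by (rule mixed_volume_ge[OF assms])
next
  assume sc: "strictly_convex_on {0<..} \<phi> \<and> strictly_convex_on {0<..} \<psi>"
  {
    assume "mixed_volume \<phi> \<psi> K L Q = \<phi> (measure lborel K / measure lborel Q * \<psi> (relative_radius K L)) * measure lborel Q"
    note d = mixed_volume_eq_imp_dilates[OF assms conjunct1[OF sc] conjunct2[OF sc] this]
    have KQ: "dilatates K Q" using d(2) by (simp add: dilatates_def)
    have LK: "dilatates L K" using d(1) relative_radius_props(1)[OF assms] by (auto simp: dilatates_def)
    show "dilatates K L" by (rule dilatates_sym[OF LK])
    show "dilatates K Q" by (rule KQ)
    show "dilatates L Q" by (rule dilatates_trans[OF LK KQ])
  }
  assume "dilatates K L \<and> dilatates K Q \<and> dilatates L Q"
  hence "dilatates L K" "dilatates K Q" using dilatates_sym by blast+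
  then obtain a b where "a > 0" "L = (\<lambda>x. a *\<^sub>R x) ` K" "b > 0" "K = (\<lambda>x. b *\<^sub>R x) ` Q"
    by (auto simp: dilatates_def)
  thus "mixed_volume \<phi> \<psi> K L Q = \<phi> (measure lborel K / measure lborel Q * \<psi> (relative_radius K L)) * measure lborel Q"
    by (rule mixed_volume_eq_of_dilates[OF assms])
qed

end
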